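(* Let $\mathbb{G}_1,\mathbb{G}_2$ be monoidally equivalent compact quantum groups with monoidal equivalence $\varphi:\mathbb{G}_2\to\mathbb{G}_1$. Let $\mathcal{B}$, with commuting actions $\delta_1:\mathcal{B}\to\mathcal{C}(\mathbb{G}_1)\otimes_{\rm alg}\mathcal{B}$ and $\delta_2:\mathcal{B}\to\mathcal{B}\otimes_{\rm alg}\mathcal{C}(\mathbb{G}_2)$, be the link algebra of $\varphi$, and let $\tilde{\mathcal{B}}$, with commuting actions $\gamma_2:\tilde{\mathcal{B}}\to\mathcal{C}(\mathbb{G}_2)\otimes_{\rm alg}\tilde{\mathcal{B}}$ and $\gamma_1:\tilde{\mathcal{B}}\to\tilde{\mathcal{B}}\otimes_{\rm alg}\mathcal{C}(\mathbb{G}_1)$, be the link algebra of the inverse monoidal equivalence $\varphi^{-1}:\mathbb{G}_1\to\mathbb{G}_2$. Let $\alpha_1:\mathcal{D}_1\to\mathcal{D}_1\otimes_{\rm alg}\mathcal{C}(\mathbb{G}_1)$ be an action, and let $\alpha_2:=\mathrm{id}\boxtimes\delta_2$ be the action of $\mathbb{G}_2$ on $\mathcal{D}_1\boxtimes_{\rm alg}^{\alpha_1}\mathcal{B}$. Then $\mathcal{D}_1$ and $(\mathcal{D}_1\boxtimes_{\rm alg}^{\alpha_1}\mathcal{B})\boxtimes_{\rm alg}^{\alpha_2}\tilde{\mathcal{B}}$ are $^*$-isomorphic. Moreover, this $^*$-isomorphism intertwines the action $\alpha_1$ with the action $\alpha_1'$ obtained by restricting $\mathrm{id}\otimes\mathrm{id}\otimes\gamma_1$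 to $(\mathcal{D}_1\boxtimes_{\rm alg}^{\alpha_1}\mathcal{B})\boxtimes_{\rm alg}^{\alpha_2}\tilde{\mathcal{B}}$.
   Context: Compact quantum groups are in Woronowicz's sense. For a compact quantum group $\mathbb{G}$ with comultiplication $\Delta$: unitary representations satisfy $(\mathrm{id}\otimes\Delta)(U)=U_{12}U_{13}$; $\mathrm{Mor}(U^1,U^2)=\{T\in\mathcal{L}(H_2,H_1)\mid U^1(T\otimes1)=(T\otimes1)U^2\}$; the tensor product of representations is $U^1_{13}U^2_{23}$; $\mathrm{Irred}(\mathbb{G})$ is the set of classes of irreducible unitary representations with representatives $U^x$ on $H_x$; $x\otimes y$ is the tensor product of $U^x,U^y$; $\varepsilon$ is the trivial class; $\mathcal{C}(\mathbb{G})$ is the Hopf $^*$-algebra spanned by the coefficients of the $U^x$. A monoidal equivalence $\varphi:\mathbb{G}_2\to\mathbb{G}_1$ is a bijection $\varphi:\mathrm{Irred}(\mathbb{G}_2)\to\mathrm{Irred}(\mathbb{G}_1)$ with $\varphi(\varepsilon)=\varepsilon$ together with linear isomorphisms $\varphi:\mathrm{Mor}(x_1\otimes\cdots\otimes x_r,y_1\otimes\cdots\otimes y_k)\to\mathrm{Mor}(\varphi(x_1)\otimes\cdots\otimes\varphi(x_r),\varphi(y_1)\otimes\cdots\otimes\varphi(y_k))$ satisfying $\varphi(1)=1$, $\varphi(S\otimes T)=\varphi(S)\otimes\varphi(T)$, $\varphi(S^* )=\varphi(S)^*$, $\varphi(ST)=\varphi(S)\varphi(T)$ whenever these make sense. The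 link algebra of $\varphi$ (known to exist and be unique) is the unital $^*$-algebra $\mathcal{B}$ with faithful state $\omega$ and unitaries $X^x\in\mathcal{L}(H_x,H_{\varphi(x)})\otimes\mathcal{B}$, $x\in\mathrm{Irred}(\mathbb{G}_2)$, such that: $X^y_{13}X^z_{23}(S\otimes1)=(\varphi(S)\otimes1)X^x$ for $S\in\mathrm{Mor}(y\otimes z,x)$; the coefficients of the $X^x$ form a linear basis of $\mathcal{B}$; $(\mathrm{id}\otimes\omega)(X^x)=0$ for $x\neq\varepsilon$. It has unique commuting ergodic actions $\delta_1,\delta_2$ with $(\mathrm{id}\otimes\delta_1)(X^x)=U^{\varphi(x)}_{12}X^x_{13}$ and $(\mathrm{id}\otimes\delta_2)(X^x)=X^x_{12}U^x_{13}$. Likewise $\tilde{\mathcal{B}}$ is spanned by the coefficients of unitaries $Y^x\in\mathcal{L}(H_{\varphi(x)},H_x)\otimes\tilde{\mathcal{B}}$, with $(\mathrm{id}\otimes\gamma_2)(Y^x)=U^x_{12}Y^x_{13}$ and $(\mathrm{id}\otimes\gamma_1)(Y^x)=Y^x_{12}U^{\varphi(x)}_{13}$. An action $\alpha:\mathcal{D}\to\mathcal{D}\otimes_{\rm alg}\mathcal{C}(\mathbb{G})$ means a Hopf $^*$-algebra action (a unital $^*$-homomorphism that is a coaction) on a unital $^*$-algebra; such $\mathcal{D}$ arise as the spectral subalgebra of an action of $\mathbb{G}$ on a unital C$^*$-algebra $D$, i.e. the span of all $v(\xi\otimes 1)$ with $\xi\in H_x$ and $v\in\overline{H}_x\otimes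 D$ satisfying $(\mathrm{id}\otimes\alpha)(v)=v_{12}U^x_{13}$. If $\mathcal{E}$ is a $^*$-algebra with a left action $\delta:\mathcal{E}\to\mathcal{C}(\mathbb{G})\otimes_{\rm alg}\mathcal{E}$, then $\mathcal{D}\boxtimes^{\alpha}_{\rm alg}\mathcal{E}:=\{a\in\mathcal{D}\otimes_{\rm alg}\mathcal{E}\mid(\alpha\otimes\mathrm{id})(a)=(\mathrm{id}\otimes\delta)(a)\}$. In $\mathcal{D}_1\boxtimes^{\alpha_1}_{\rm alg}\mathcal{B}$ the left action is $\delta_1$; in $(\cdot)\boxtimes^{\alpha_2}_{\rm alg}\tilde{\mathcal{B}}$ it is $\gamma_2$. $\mathrm{id}\boxtimes\delta_2$ denotes the restriction of $\mathrm{id}\otimes\delta_2$ to $\mathcal{D}_1\boxtimes^{\alpha_1}_{\rm alg}\mathcal{B}$. *)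

theory Defs
  imports Complex_Main "HOL-Library.Poly_Mapping" "Jordan_Normal_Form.Matrix"
begin

section \<open>Complex \<open>*\<close>-algebras and C\<open>*\<close>-algebras\<close>

class scaleC =
  fixes scaleC :: "complex \<Rightarrow> 'a \<Rightarrow> 'a" (infixr "*\<^sub>C" 75)

class complex_vector = ab_group_add + scaleC +
  assumes scaleC_add_right: "c *\<^sub>C (x + y) = c *\<^sub>C x + c *\<^sub>C y"
    and scaleC_add_left: "(c + d) *\<^sub>C x = c *\<^sub>C x + d *\<^sub>C x"
    and scaleC_scaleC: "c *\<^sub>C d *\<^sub>C x = (c * d) *\<^sub>C x"
    and scaleC_one: "1 *\<^sub>C x = x"

global_interpretation complex_vector:
  vector_space "scaleC :: complex \<Rightarrow> 'a \<Rightarrow> 'a::complex_vector"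
  by unfold_locales (rule scaleC_add_right scaleC_add_left scaleC_scaleC scaleC_one)+

abbreviation cspan :: "'a::complex_vector set \<Rightarrow> 'a set"
  where "cspan \<equiv> module.span scaleC"

abbreviation cindependent :: "'a::complex_vector set \<Rightarrow> bool"
  where "cindependent S \<equiv> \<not> module.dependent scaleC S"

abbreviation clinear :: "('a::complex_vector \<Rightarrow> 'b::complex_vector) \<Rightarrow> bool"
  where "clinear \<equiv> Vector_Spaces.linear scaleC scaleC"

text \<open>Algebras are unital; the zero algebra is not excluded, which is why the sort is
  \<^class>\<open>ring\<close> together with \<^class>\<open>monoid_mult\<close> rather than \<^class>\<open>ring_1\<close>.\<close>

class complex_algebra_1 = complex_vector + ring + monoid_mult +
  assumes scaleC_mult_left: "(c *\<^sub>C x) * y = c *\<^sub>C (x * y)"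
    and scaleC_mult_right: "x * (c *\<^sub>C y) = c *\<^sub>C (x * y)"

class star_algebra = complex_algebra_1 +
  fixes star :: "'a \<Rightarrow> 'a"
  assumes star_star: "star (star x) = x"
    and star_add: "star (x + y) = star x + star y"
    and star_scaleC: "star (c *\<^sub>C x) = cnj c *\<^sub>C star x"
    and star_mult: "star (x * y) = star y * star x"

class cstar_algebra = star_algebra + real_normed_algebra + complete_space + zero_neq_one +
  assumes scaleR_eq_scaleC: "r *\<^sub>R x = complex_of_real r *\<^sub>C x"
    and norm_scaleC: "norm (c *\<^sub>C x) = cmod c * norm x"
    and cstar_identity: "norm (star x * x) = (norm x)\<^sup>2"

instantiation complex :: star_algebra
begin
definition scaleC_complex :: "complex \<Rightarrow> complex \<Rightarrow> complex" where "scaleC_complex c x = c * x"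
definition star_complex :: "complex \<Rightarrow> complex" where "star_complex = cnj"
instance
  by standard (auto simp: scaleC_complex_def star_complex_def algebra_simps)
end

definition star_hom :: "('a::star_algebra \<Rightarrow> 'b::star_algebra) \<Rightarrow> bool" where
  "star_hom f \<longleftrightarrow> clinear f \<and> f 1 = 1 \<and> (\<forall>x y. f (x * y) = f x * f y) \<and>
     (\<forall>x. f (star x) = star (f x))"

definition faithful_state :: "('a::star_algebra \<Rightarrow> complex) \<Rightarrow> bool" where
  "faithful_state \<omega> \<longleftrightarrow> clinear \<omega> \<and> \<omega> 1 = 1 \<and>
     (\<forall>x. \<exists>r\<ge>0. \<omega> (star x * x) = complex_of_real r) \<and>
     (\<forall>x. \<omega> (star x * x) = 0 \<longrightarrow> x = 0)"


section \<open>The algebraic tensor product\<close>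

text \<open>The tensor product over the complex numbers is the free complex vector space on the pairs
  \<open>(a, b)\<close>, divided by the span of the bilinearity relations.\<close>

instantiation poly_mapping :: (type, complex_vector) complex_vector
begin
lift_definition scaleC_poly_mapping :: "complex \<Rightarrow> ('a \<Rightarrow>\<^sub>0 'b) \<Rightarrow> ('a \<Rightarrow>\<^sub>0 'b)"
  is "\<lambda>c f k. c *\<^sub>C f k"
  by (rule finite_subset[rotated], assumption) auto
instance
  by standard (transfer; auto simp: scaleC_add_right scaleC_add_left scaleC_scaleC scaleC_one)+
end

definition tensor_relators ::
    "(('a::complex_vector \<times> 'b::complex_vector) \<Rightarrow>\<^sub>0 complex) set" where
  "tensor_relators =
     {Poly_Mapping.single (a + a', b) 1 - Poly_Mapping.single (a, b) 1
        - Poly_Mapping.single (a', b) 1 | a a' b. True}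
   \<union> {Poly_Mapping.single (a, b + b') 1 - Poly_Mapping.single (a, b) 1
        - Poly_Mapping.single (a, b') 1 | a b b'. True}
   \<union> {Poly_Mapping.single (c *\<^sub>C a, b) 1 - Poly_Mapping.single (a, b) c | a b c. True}
   \<union> {Poly_Mapping.single (a, c *\<^sub>C b) 1 - Poly_Mapping.single (a, b) c | a b c. True}"

definition tensor_rel ::
    "(('a::complex_vector \<times> 'b::complex_vector) \<Rightarrow>\<^sub>0 complex) \<Rightarrow> ('a \<times> 'b \<Rightarrow>\<^sub>0 complex) \<Rightarrow> bool" where
  "tensor_rel p q \<longleftrightarrow> p - q \<in> cspan tensor_relators"

lemma equivp_tensor_rel: "equivp tensor_rel"
proof (rule equivpI)
  show "reflp tensor_rel"
    by (simp add: reflp_def tensor_rel_def complex_vector.span_zero)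
  show "symp tensor_rel"
    unfolding symp_def tensor_rel_def
    using complex_vector.span_neg by fastforce
  show "transp tensor_rel"
    unfolding transp_def tensor_rel_def using complex_vector.span_add by fastforce
qed

quotient_type (overloaded) ('a, 'b) tensor (infixr "\<otimes>" 72) =
    "('a::complex_vector \<times> 'b::complex_vector) \<Rightarrow>\<^sub>0 complex" / tensor_rel
  by (rule equivp_tensor_rel)

instantiation tensor :: (complex_vector, complex_vector) complex_vector
begin
lift_definition zero_tensor :: "'a \<otimes> 'b" is 0 .
lift_definition plus_tensor :: "'a \<otimes> 'b \<Rightarrow> 'a \<otimes> 'b \<Rightarrow> 'a \<otimes> 'b" is "(+)"
  unfolding tensor_rel_def using complex_vector.span_add by (fastforce simp: add_diff_add)
lift_definition uminus_tensor :: "'a \<otimes> 'b \<Rightarrow> 'a \<otimes> 'b" is uminus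
  unfolding tensor_rel_def using complex_vector.span_neg by (fastforce simp: minus_diff_minus)
lift_definition minus_tensor :: "'a \<otimes> 'b \<Rightarrow> 'a \<otimes> 'b \<Rightarrow> 'a \<otimes> 'b" is "(-)"
  unfolding tensor_rel_def
  subgoal for p q r s
    using complex_vector.span_diff[of "p - q" tensor_relators "r - s"] by (simp add: algebra_simps)
  done
lift_definition scaleC_tensor :: "complex \<Rightarrow> 'a \<otimes> 'b \<Rightarrow> 'a \<otimes> 'b" is "(*\<^sub>C)"
  unfolding tensor_rel_def
  subgoal for c p q
    using complex_vector.span_scale[of "p - q" tensor_relators c]
    by (simp add: complex_vector.scale_right_diff_distrib)
  done
instance
  by standard
    (transfer; simp add: tensor_rel_def complex_vector.span_zero algebra_simps
       scaleC_add_right scaleC_add_left scaleC_scaleC scaleC_one)+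
end

lift_definition tensor_elem :: "'a::complex_vector \<Rightarrow> 'b::complex_vector \<Rightarrow> 'a \<otimes> 'b"
    (infixr "\<otimes>\<^sub>t" 72)
  is "\<lambda>a b. Poly_Mapping.single (a, b) 1" .

text \<open>\<open>free_lift \<sigma> f\<close> extends \<open>f\<close> to the free vector space, linearly for \<open>\<sigma> = id\<close> and
  antilinearly for \<open>\<sigma> = cnj\<close>. Below it is applied to an arbitrary representative of a tensor,
  which is meaningful when \<open>f\<close> is \<open>\<sigma>\<close>-bilinear, by \<open>tensor_lift_gen\<close>.\<close>

definition free_lift :: "(complex \<Rightarrow> complex) \<Rightarrow> ('a \<Rightarrow> 'b \<Rightarrow> 'c::complex_vector) \<Rightarrow>
    ('a \<times> 'b \<Rightarrow>\<^sub>0 complex) \<Rightarrow> 'c" where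
  "free_lift \<sigma> f p = (\<Sum>k\<in>Poly_Mapping.keys p. \<sigma> (Poly_Mapping.lookup p k) *\<^sub>C f (fst k) (snd k))"

definition tensor_lift_gen :: "(complex \<Rightarrow> complex) \<Rightarrow>
    ('a::complex_vector \<Rightarrow> 'b::complex_vector \<Rightarrow> 'c::complex_vector) \<Rightarrow> 'a \<otimes> 'b \<Rightarrow> 'c" where
  "tensor_lift_gen \<sigma> f t = free_lift \<sigma> f (rep_tensor t)"

abbreviation tensor_lift :: "('a::complex_vector \<Rightarrow> 'b::complex_vector \<Rightarrow> 'c::complex_vector) \<Rightarrow>
    'a \<otimes> 'b \<Rightarrow> 'c" where
  "tensor_lift \<equiv> tensor_lift_gen id"

definition conj_map :: "(complex \<Rightarrow> complex) \<Rightarrow> bool" where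
  "conj_map \<sigma> \<longleftrightarrow> \<sigma> = id \<or> \<sigma> = cnj"

definition bilin :: "(complex \<Rightarrow> complex) \<Rightarrow>
    ('a::complex_vector \<Rightarrow> 'b::complex_vector \<Rightarrow> 'c::complex_vector) \<Rightarrow> bool" where
  "bilin \<sigma> f \<longleftrightarrow>
     (\<forall>a a' b. f (a + a') b = f a b + f a' b) \<and> (\<forall>a b b'. f a (b + b') = f a b + f a b') \<and>
     (\<forall>c a b. f (c *\<^sub>C a) b = \<sigma> c *\<^sub>C f a b) \<and> (\<forall>c a b. f a (c *\<^sub>C b) = \<sigma> c *\<^sub>C f a b)"

lemma conj_mapD:
  assumes "conj_map \<sigma>"
  shows "\<sigma> (x + y) = \<sigma> x + \<sigma> y" "\<sigma> (x * y) = \<sigma> x * \<sigma> y" "\<sigma> 0 = 0" "\<sigma> 1 = 1"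
  using assms by (auto simp: conj_map_def)

lemma conj_map_id [simp]: "conj_map id" and conj_map_cnj [simp]: "conj_map cnj"
  by (simp_all add: conj_map_def)

lemma free_lift_superset:
  assumes "conj_map \<sigma>" "finite K" "Poly_Mapping.keys p \<subseteq> K"
  shows "free_lift \<sigma> f p = (\<Sum>k\<in>K. \<sigma> (Poly_Mapping.lookup p k) *\<^sub>C f (fst k) (snd k))"
  unfolding free_lift_def
  by (rule sum.mono_neutral_left[OF assms(2,3)])
     (auto simp: in_keys_iff conj_mapD[OF assms(1)])

lemma free_lift_add:
  assumes s: "conj_map \<sigma>"
  shows "free_lift \<sigma> f (p + q) = free_lift \<sigma> f p + free_lift \<sigma> f q"
proof -
  let ?K = "Poly_Mapping.keys p \<union> Poly_Mapping.keys q"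
  have K: "finite ?K" by simp
  show ?thesis
    using Poly_Mapping.keys_add[of p q]
    by (simp add: free_lift_superset[OF s K] lookup_add conj_mapD[OF s] scaleC_add_left
        sum.distrib)
qed

lemma free_lift_scale:
  assumes s: "conj_map \<sigma>"
  shows "free_lift \<sigma> f (c *\<^sub>C p) = \<sigma> c *\<^sub>C free_lift \<sigma> f p"
proof -
  have l: "Poly_Mapping.lookup (c *\<^sub>C p) k = c * Poly_Mapping.lookup p k" for k
    by (simp add: scaleC_poly_mapping.rep_eq scaleC_complex_def)
  have "Poly_Mapping.keys (c *\<^sub>C p) \<subseteq> Poly_Mapping.keys p"
    by (auto simp: in_keys_iff l)
  then have "free_lift \<sigma> f (c *\<^sub>C p) =
      (\<Sum>k\<in>Poly_Mapping.keys p. \<sigma> (c * Poly_Mapping.lookup p k) *\<^sub>C f (fst k) (snd k))"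
    by (simp add: free_lift_superset[OF s finite_keys] l)
  then show ?thesis
    by (simp add: free_lift_def conj_mapD[OF s] complex_vector.scale_sum_right scaleC_scaleC)
qed

lemma free_lift_single:
  assumes s: "conj_map \<sigma>"
  shows "free_lift \<sigma> f (Poly_Mapping.single k c) = \<sigma> c *\<^sub>C f (fst k) (snd k)"
  by (subst free_lift_superset[OF s, of "{k}"]) (auto simp: lookup_single)

lemma free_lift_diff:
  assumes s: "conj_map \<sigma>"
  shows "free_lift \<sigma> f (p - q) = free_lift \<sigma> f p - free_lift \<sigma> f q"
  using free_lift_add[OF s, of f "p - q" q] by (simp add: algebra_simps)

lemma free_lift_rel:
  assumes s: "conj_map \<sigma>" and b: "bilin \<sigma> f" and r: "tensor_rel p q"
  shows "free_lift \<sigma> f p = free_lift \<sigma> f q"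
proof -
  have "free_lift \<sigma> f x = 0" if "x \<in> cspan tensor_relators" for x
    using that
  proof (induction rule: complex_vector.span_induct_alt)
    case base
    show ?case by (simp add: free_lift_def)
  next
    case (step c x y)
    have "free_lift \<sigma> f x = 0"
      using step(1) b
      by (auto simp: tensor_relators_def free_lift_diff[OF s] free_lift_single[OF s]
          conj_mapD[OF s] scaleC_one bilin_def)
    then show ?case
      using step by (simp add: free_lift_add[OF s] free_lift_scale[OF s])
  qed
  then show ?thesis
    using r free_lift_diff[OF s, of f p q] by (simp add: tensor_rel_def)
qed

lemma tensor_lift_gen_abs:
  assumes "conj_map \<sigma>" "bilin \<sigma> f"
  shows "tensor_lift_gen \<sigma> f (abs_tensor p) = free_lift \<sigma> f p"
  unfolding tensor_lift_gen_def
  by (rule free_lift_rel[OF assms]) (rule Quotient_rep_abs[OF Quotient_tensor equivp_reflp[OF equivp_tensor_rel]])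

lemma tensor_lift_gen:
  assumes "conj_map \<sigma>" "bilin \<sigma> f"
  shows "tensor_lift_gen \<sigma> f (s + t) = tensor_lift_gen \<sigma> f s + tensor_lift_gen \<sigma> f t"
    and "tensor_lift_gen \<sigma> f (c *\<^sub>C t) = \<sigma> c *\<^sub>C tensor_lift_gen \<sigma> f t"
    and "tensor_lift_gen \<sigma> f (a \<otimes>\<^sub>t b) = f a b"
proof -
  obtain p q where "s = abs_tensor p" "t = abs_tensor q"
    by (metis Quotient_abs_rep[OF Quotient_tensor])
  then show "tensor_lift_gen \<sigma> f (s + t) = tensor_lift_gen \<sigma> f s + tensor_lift_gen \<sigma> f t"
    "tensor_lift_gen \<sigma> f (c *\<^sub>C t) = \<sigma> c *\<^sub>C tensor_lift_gen \<sigma> f t"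
    by (simp_all add: plus_tensor.abs_eq scaleC_tensor.abs_eq tensor_lift_gen_abs[OF assms]
        free_lift_add[OF assms(1)] free_lift_scale[OF assms(1)])
  show "tensor_lift_gen \<sigma> f (a \<otimes>\<^sub>t b) = f a b"
    by (simp add: tensor_elem.abs_eq tensor_lift_gen_abs[OF assms] free_lift_single[OF assms(1)]
        conj_mapD[OF assms(1)] scaleC_one)
qed

lemma tensor_lift_linear:
  assumes "bilin id f"
  shows "clinear (tensor_lift f)"
  using tensor_lift_gen[OF conj_map_id assms]
  by unfold_locales auto

lemma tensor_elem_bilin:
  "(a + a') \<otimes>\<^sub>t b = a \<otimes>\<^sub>t b + a' \<otimes>\<^sub>t b"
  "a \<otimes>\<^sub>t (b + b') = a \<otimes>\<^sub>t b + a \<otimes>\<^sub>t b'"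
  "(c *\<^sub>C a) \<otimes>\<^sub>t b = c *\<^sub>C (a \<otimes>\<^sub>t b)"
  "a \<otimes>\<^sub>t (c *\<^sub>C b) = c *\<^sub>C (a \<otimes>\<^sub>t b)"
proof -
  have s: "c *\<^sub>C Poly_Mapping.single k 1 = Poly_Mapping.single k c" for c and k :: "'a \<times> 'b"
    by (rule poly_mapping_eqI)
       (simp add: scaleC_poly_mapping.rep_eq lookup_single scaleC_complex_def when_def)
  show "(a + a') \<otimes>\<^sub>t b = a \<otimes>\<^sub>t b + a' \<otimes>\<^sub>t b"
    by transfer
       (simp only: tensor_rel_def, rule complex_vector.span_base,
         simp add: tensor_relators_def diff_diff_eq[symmetric], blast)
  show "a \<otimes>\<^sub>t (b + b') = a \<otimes>\<^sub>t b + a \<otimes>\<^sub>t b'"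
    by transfer
       (simp only: tensor_rel_def, rule complex_vector.span_base,
         simp add: tensor_relators_def diff_diff_eq[symmetric], blast)
  show "(c *\<^sub>C a) \<otimes>\<^sub>t b = c *\<^sub>C (a \<otimes>\<^sub>t b)"
    by transfer
       (simp only: tensor_rel_def s, rule complex_vector.span_base,
         simp add: tensor_relators_def, blast)
  show "a \<otimes>\<^sub>t (c *\<^sub>C b) = c *\<^sub>C (a \<otimes>\<^sub>t b)"
    by transfer
       (simp only: tensor_rel_def s, rule complex_vector.span_base,
         simp add: tensor_relators_def, blast)
qed

lemma tensor_induct [case_names elem add]:
  assumes elem: "\<And>a b. P (a \<otimes>\<^sub>t b)" and add: "\<And>s t. P s \<Longrightarrow> P t \<Longrightarrow> P (s + t)"
  shows "P t"
proof -
  have single: "abs_tensor (Poly_Mapping.single (a, b) c) = (c *\<^sub>C a) \<otimes>\<^sub>t b" for c a b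
  proof -
    have "c *\<^sub>C Poly_Mapping.single (a, b) 1 = Poly_Mapping.single (a, b) c"
      by (rule poly_mapping_eqI)
         (simp add: scaleC_poly_mapping.rep_eq lookup_single scaleC_complex_def when_def)
    then show ?thesis
      by (metis tensor_elem_bilin(3) tensor_elem.abs_eq scaleC_tensor.abs_eq)
  qed
  have zero: "abs_tensor 0 = 0 \<otimes>\<^sub>t 0"
    using single[of 0 0 0] by simp
  have "P (abs_tensor p)" for p
  proof (induction p rule: update_induct)
    case const
    show ?case by (simp add: zero elem)
  next
    case (update p k c)
    have "Poly_Mapping.update k c p = p + Poly_Mapping.single k c"
      using update(1)
      by (intro poly_mapping_eqI) (auto simp: lookup_update lookup_add lookup_single in_keys_iff when_def)
    then have "abs_tensor (Poly_Mapping.update k c p) =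
        abs_tensor p + (c *\<^sub>C fst k) \<otimes>\<^sub>t snd k"
      using single[of "fst k" "snd k" c] by (simp add: plus_tensor.abs_eq[symmetric])
    then show ?case using update elem add by simp
  qed
  then show ?thesis by (metis Quotient_abs_rep[OF Quotient_tensor])
qed

lemma bilin_plus: "bilin \<sigma> f \<Longrightarrow> bilin \<sigma> g \<Longrightarrow> bilin \<sigma> (\<lambda>a b. f a b + g a b)"
  by (simp add: bilin_def scaleC_add_right add.assoc add.left_commute)

instantiation tensor :: (star_algebra, star_algebra) star_algebra
begin

definition one_tensor :: "'a \<otimes> 'b" where "one_tensor = 1 \<otimes>\<^sub>t 1"

definition times_tensor :: "'a \<otimes> 'b \<Rightarrow> 'a \<otimes> 'b \<Rightarrow> 'a \<otimes> 'b" where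
  "s * t = tensor_lift (\<lambda>a b. tensor_lift (\<lambda>c d. (a * c) \<otimes>\<^sub>t (b * d)) t) s"

definition star_tensor :: "'a \<otimes> 'b \<Rightarrow> 'a \<otimes> 'b" where
  "star_tensor = tensor_lift_gen cnj (\<lambda>a b. star a \<otimes>\<^sub>t star b)"

lemma bilin_inner: "bilin id (\<lambda>c d. (a * c) \<otimes>\<^sub>t (b * d))" for a :: 'a and b :: 'b
  by (simp add: bilin_def algebra_simps tensor_elem_bilin scaleC_mult_right)

lemma bilin_outer: "bilin id (\<lambda>a b. tensor_lift (\<lambda>c d. (a * c) \<otimes>\<^sub>t (b * d)) t)"
  for t :: "'a \<otimes> 'b"
proof -
  note lift = tensor_lift_gen[OF conj_map_id bilin_inner]
  show ?thesis
  proof (induction t rule: tensor_induct)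
    case (elem a b)
    show ?case
      unfolding lift by (simp add: bilin_def algebra_simps tensor_elem_bilin scaleC_mult_left)
  next
    case (add s t)
    then show ?case
      unfolding lift by (rule bilin_plus)
  qed
qed

lemma bilin_star: "bilin cnj (\<lambda>(a::'a) (b::'b). star a \<otimes>\<^sub>t star b)"
  by (simp add: bilin_def star_add star_scaleC tensor_elem_bilin)

lemma times_tensor_simps:
  fixes r s t :: "'a \<otimes> 'b"
  shows "(r + s) * t = r * t + s * t" "r * (s + t) = r * s + r * t"
    "(c *\<^sub>C r) * s = c *\<^sub>C (r * s)" "r * (c *\<^sub>C s) = c *\<^sub>C (r * s)"
    "(a \<otimes>\<^sub>t b) * (a' \<otimes>\<^sub>t b') = (a * a') \<otimes>\<^sub>t (b * b')"
proof -
  note inner = tensor_lift_gen[OF conj_map_id bilin_inner]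
  note outer = tensor_lift_gen[OF conj_map_id bilin_outer]
  show l: "(r + s) * t = r * t + s * t" for r s t :: "'a \<otimes> 'b"
    unfolding times_tensor_def unfolding outer id_apply ..
  show "(c *\<^sub>C r) * s = c *\<^sub>C (r * s)"
    unfolding times_tensor_def unfolding outer id_apply ..
  show "(a \<otimes>\<^sub>t b) * (a' \<otimes>\<^sub>t b') = (a * a') \<otimes>\<^sub>t (b * b')"
    unfolding times_tensor_def unfolding outer unfolding inner id_apply ..
  show "r * (s + t) = r * s + r * t"
  proof (induction r rule: tensor_induct)
    case (elem a b)
    show ?case unfolding times_tensor_def unfolding outer unfolding inner id_apply ..
  qed (simp add: l)
  show "r * (c *\<^sub>C s) = c *\<^sub>C (r * s)"
  proof (induction r rule: tensor_induct)
    case (elem a b)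
    show ?case unfolding times_tensor_def unfolding outer unfolding inner id_apply ..
  qed (simp add: l scaleC_add_right)
qed

lemma star_tensor_simps:
  fixes r s :: "'a \<otimes> 'b"
  shows "star (r + s) = star r + star s" "star (c *\<^sub>C r) = cnj c *\<^sub>C star r"
    "star (a \<otimes>\<^sub>t b) = star a \<otimes>\<^sub>t star b"
  by (simp_all add: star_tensor_def tensor_lift_gen[OF conj_map_cnj bilin_star])

instance
proof
  fix r s t :: "'a \<otimes> 'b" and c :: complex
  show "(r + s) * t = r * t + s * t" "r * (s + t) = r * s + r * t"
    "(c *\<^sub>C r) * s = c *\<^sub>C (r * s)" "r * (c *\<^sub>C s) = c *\<^sub>C (r * s)"
    "star (r + s) = star r + star s" "star (c *\<^sub>C r) = cnj c *\<^sub>C star r"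
    by (rule times_tensor_simps star_tensor_simps)+
  show "1 * r = r" "r * 1 = r" "star (star r) = r"
    by (induction r rule: tensor_induct;
        simp add: one_tensor_def times_tensor_simps star_tensor_simps star_star)+
  show "star (r * s) = star s * star r"
  proof (induction r rule: tensor_induct)
    case (elem a b)
    show ?case
      by (induction s rule: tensor_induct)
         (simp_all add: times_tensor_simps star_tensor_simps star_mult)
  qed (simp_all add: times_tensor_simps star_tensor_simps)
  show "r * s * t = r * (s * t)"
  proof (induction r rule: tensor_induct)
    case (elem a b)
    show ?case
    proof (induction s rule: tensor_induct)
      case (elem a b)
      show ?case
        by (induction t rule: tensor_induct)
           (simp_all add: times_tensor_simps mult.assoc)
    qed (simp_all add: times_tensor_simps)
  qed (simp_all add: times_tensor_simps)
qed

end

lemma tensor_elem_mult: "(a \<otimes>\<^sub>t b) * (a' \<otimes>\<^sub>t b') = (a * a') \<otimes>\<^sub>t (b * b')"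
  and tensor_elem_star: "star (a \<otimes>\<^sub>t b) = star a \<otimes>\<^sub>t star b"
  and tensor_one: "1 = 1 \<otimes>\<^sub>t 1"
  by (simp_all add: times_tensor_simps star_tensor_simps one_tensor_def)

definition tensor_map :: "('a::complex_vector \<Rightarrow> 'c::complex_vector) \<Rightarrow>
    ('b::complex_vector \<Rightarrow> 'd::complex_vector) \<Rightarrow> 'a \<otimes> 'b \<Rightarrow> 'c \<otimes> 'd" where
  "tensor_map f g = tensor_lift (\<lambda>a b. f a \<otimes>\<^sub>t g b)"

definition assoc_left ::
    "'a::complex_vector \<otimes> ('b::complex_vector \<otimes> 'c::complex_vector) \<Rightarrow> ('a \<otimes> 'b) \<otimes> 'c" where
  "assoc_left = tensor_lift (\<lambda>a. tensor_lift (\<lambda>b c. (a \<otimes>\<^sub>t b) \<otimes>\<^sub>t c))"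

definition assoc_right ::
    "('a::complex_vector \<otimes> 'b::complex_vector) \<otimes> 'c::complex_vector \<Rightarrow> 'a \<otimes> ('b \<otimes> 'c)" where
  "assoc_right = tensor_lift (\<lambda>s c. tensor_lift (\<lambda>a b. a \<otimes>\<^sub>t (b \<otimes>\<^sub>t c)) s)"

definition tensor_span ::
    "'a::complex_vector set \<Rightarrow> 'b::complex_vector set \<Rightarrow> ('a \<otimes> 'b) set" where
  "tensor_span V W = cspan {v \<otimes>\<^sub>t w | v w. v \<in> V \<and> w \<in> W}"


section \<open>Compact quantum groups\<close>

definition cstar_norm :: "('a::star_algebra \<Rightarrow> real) \<Rightarrow> bool" where
  "cstar_norm N \<longleftrightarrow>
     (\<forall>x. 0 \<le> N x) \<and> (\<forall>x. N x = 0 \<longleftrightarrow> x = 0) \<and> (\<forall>x y. N (x + y) \<le> N x + N y) \<and>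
     (\<forall>c x. N (c *\<^sub>C x) = cmod c * N x) \<and> (\<forall>x y. N (x * y) \<le> N x * N y) \<and>
     (\<forall>x. N (star x * x) = (N x)\<^sup>2)"

definition dense_set :: "'a::metric_space set \<Rightarrow> bool" where
  "dense_set S \<longleftrightarrow> (\<forall>x. \<forall>e>0. \<exists>y\<in>S. dist x y < e)"

text \<open>\<open>min_tensor j\<close>: the C\<open>*\<close>-algebra \<open>'c\<close>, together with the embedding \<open>j\<close>, is the completion
  of the algebraic tensor product for its smallest C\<open>*\<close>-norm.\<close>

definition min_tensor ::
    "('a::cstar_algebra \<otimes> 'b::cstar_algebra \<Rightarrow> 'c::cstar_algebra) \<Rightarrow> bool" where
  "min_tensor j \<longleftrightarrow> star_hom j \<and> inj j \<and> dense_set (range j) \<and>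
     (\<forall>N. cstar_norm N \<longrightarrow> (\<forall>t. norm (j t) \<le> N t))"

text \<open>\<open>'a\<close> is the C\<open>*\<close>-algebra of the quantum group; \<open>'aa\<close> and \<open>'aaa\<close> are its second and third
  minimal tensor powers, the latter being both \<open>'aa \<otimes> 'a\<close> and \<open>'a \<otimes> 'aa\<close> (completed).\<close>

record (overloaded) ('a, 'aa, 'aaa) quantum_group =
  comult :: "'a \<Rightarrow> 'aa"
  emb :: "'a \<otimes> 'a \<Rightarrow> 'aa"
  emb_left :: "'aa \<otimes> 'a \<Rightarrow> 'aaa"
  emb_right :: "'a \<otimes> 'aa \<Rightarrow> 'aaa"

text \<open>Woronowicz's axioms. The maps \<open>L\<close> and \<open>R\<close> are \<open>\<Delta> \<otimes> id\<close> and \<open>id \<otimes> \<Delta>\<close>: being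
  \<open>*\<close>-homomorphisms of C\<open>*\<close>-algebras they are continuous, hence determined by their values on the
  algebraic tensor product.\<close>

definition compact_quantum_group ::
    "('a::cstar_algebra, 'aa::cstar_algebra, 'aaa::cstar_algebra) quantum_group \<Rightarrow> bool" where
  "compact_quantum_group G \<longleftrightarrow>
     min_tensor (emb G) \<and> min_tensor (emb_left G) \<and> min_tensor (emb_right G) \<and>
     (\<forall>a b c. emb_left G (emb G (a \<otimes>\<^sub>t b) \<otimes>\<^sub>t c) = emb_right G (a \<otimes>\<^sub>t emb G (b \<otimes>\<^sub>t c))) \<and>
     star_hom (comult G) \<and>
     (\<exists>L R. star_hom L \<and> star_hom R \<and>
        (\<forall>a b. L (emb G (a \<otimes>\<^sub>t b)) = emb_left G (comult G a \<otimes>\<^sub>t b)) \<and>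
        (\<forall>a b. R (emb G (a \<otimes>\<^sub>t b)) = emb_right G (a \<otimes>\<^sub>t comult G b)) \<and>
        (\<forall>a. L (comult G a) = R (comult G a))) \<and>
     dense_set (cspan {comult G a * emb G (b \<otimes>\<^sub>t 1) | a b. True}) \<and>
     dense_set (cspan {comult G a * emb G (1 \<otimes>\<^sub>t b) | a b. True})"


section \<open>Representations\<close>

text \<open>Finite-dimensional Hilbert spaces are taken to be \<open>\<complex>\<^sup>n\<close>, so that an element of
  \<open>\<L>(\<complex>\<^sup>n, \<complex>\<^sup>m) \<otimes> \<A>\<close> is an \<open>m \<times> n\<close> matrix over \<open>\<A>\<close>.\<close>

definition adj :: "'a::star_algebra mat \<Rightarrow> 'a mat" where
  "adj U = map_mat star (transpose_mat U)"

definition unitary_mat :: "'a::star_algebra mat \<Rightarrow> bool" where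
  "unitary_mat U \<longleftrightarrow> adj U * U = 1\<^sub>m (dim_col U) \<and> U * adj U = 1\<^sub>m (dim_row U)"

text \<open>The matrix \<open>T \<otimes> 1\<close> for a scalar matrix \<open>T\<close>.\<close>

definition amp :: "complex mat \<Rightarrow> 'a::star_algebra mat" where
  "amp T = map_mat (\<lambda>c. c *\<^sub>C 1) T"

text \<open>\<open>kron U V\<close> is \<open>U\<^sub>1\<^sub>3 V\<^sub>2\<^sub>3\<close>: its entry at \<open>((i, k), (j, l))\<close> is \<open>U\<^sub>i\<^sub>j V\<^sub>k\<^sub>l\<close>. On scalar
  matrices it is the tensor product of operators.\<close>

definition kron :: "'a::times mat \<Rightarrow> 'a mat \<Rightarrow> 'a mat" where
  "kron U V = mat (dim_row U * dim_row V) (dim_col U * dim_col V)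
     (\<lambda>(p, q). U $$ (p div dim_row V, q div dim_col V) * V $$ (p mod dim_row V, q mod dim_col V))"

definition unitary_rep ::
    "('a::cstar_algebra, 'aa::cstar_algebra, 'aaa::cstar_algebra) quantum_group \<Rightarrow> 'a mat \<Rightarrow> bool" where
  "unitary_rep G U \<longleftrightarrow> square_mat U \<and> unitary_mat U \<and>
     (\<forall>i<dim_row U. \<forall>j<dim_row U.
        comult G (U $$ (i, j)) = (\<Sum>k<dim_row U. emb G (U $$ (i, k) \<otimes>\<^sub>t U $$ (k, j))))"

definition Mor :: "'a::cstar_algebra mat \<Rightarrow> 'a mat \<Rightarrow> complex mat set" where
  "Mor U V = {T \<in> carrier_mat (dim_row U) (dim_row V). U * amp T = amp T * V}"

definition irreducible_rep ::
    "('a::cstar_algebra, 'aa::cstar_algebra, 'aaa::cstar_algebra) quantum_group \<Rightarrow> 'a mat \<Rightarrow> bool" where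
  "irreducible_rep G U \<longleftrightarrow> unitary_rep G U \<and> 0 < dim_row U \<and>
     Mor U U = {c \<cdot>\<^sub>m 1\<^sub>m (dim_row U) | c. True}"

definition rep_equiv ::
    "('a::cstar_algebra, 'aa::cstar_algebra, 'aaa::cstar_algebra) quantum_group \<Rightarrow> ('a mat \<times> 'a mat) set" where
  "rep_equiv G = {(U, V). irreducible_rep G U \<and> irreducible_rep G V \<and>
     (\<exists>T \<in> Mor U V. unitary_mat T)}"

definition Irred ::
    "('a::cstar_algebra, 'aa::cstar_algebra, 'aaa::cstar_algebra) quantum_group \<Rightarrow> 'a mat set set" where
  "Irred G = {U. irreducible_rep G U} // rep_equiv G"

definition triv ::
    "('a::cstar_algebra, 'aa::cstar_algebra, 'aaa::cstar_algebra) quantum_group \<Rightarrow> 'a mat set" where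
  "triv G = rep_equiv G `` {1\<^sub>m 1}"

text \<open>The representative \<open>U\<^sup>x\<close> of the class \<open>x\<close>, and the dimension of \<open>H\<^sub>x\<close>.\<close>

definition irrep :: "'a mat set \<Rightarrow> 'a mat" where
  "irrep x = (SOME U. U \<in> x)"

definition hdim :: "'a mat set \<Rightarrow> nat" where
  "hdim x = dim_row (irrep x)"

definition tensor_rep :: "'a::cstar_algebra mat set list \<Rightarrow> 'a mat" where
  "tensor_rep xs = foldr (\<lambda>x U. kron (irrep x) U) xs (1\<^sub>m 1)"

definition mor :: "'a::cstar_algebra mat set list \<Rightarrow> 'a mat set list \<Rightarrow> complex mat set" where
  "mor xs ys = Mor (tensor_rep xs) (tensor_rep ys)"

definition words ::
    "('a::cstar_algebra, 'aa::cstar_algebra, 'aaa::cstar_algebra) quantum_group \<Rightarrow> 'a mat set list set" where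
  "words G = {xs. xs \<noteq> [] \<and> set xs \<subseteq> Irred G}"


section \<open>The Hopf \<open>*\<close>-algebra of coefficients and its actions\<close>

definition coeff_algebra ::
    "('a::cstar_algebra, 'aa::cstar_algebra, 'aaa::cstar_algebra) quantum_group \<Rightarrow> 'a set" where
  "coeff_algebra G =
     cspan {irrep x $$ (i, j) | x i j. x \<in> Irred G \<and> i < hdim x \<and> j < hdim x}"

text \<open>\<open>coeff_algebra G\<close> is a Hopf \<open>*\<close>-algebra with counit \<open>\<epsilon>\<close> and antipode \<open>S\<close>. Both maps are
  defined on the whole C\<open>*\<close>-algebra (any linear extension will do), but only their restrictions to
  \<open>coeff_algebra G\<close> matter. As \<open>emb G\<close> is injective, \<open>t\<close> is the value of the comultiplication at
  \<open>a\<close> in the algebraic tensor product.\<close>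

definition hopf_star_algebra ::
    "('a::cstar_algebra, 'aa::cstar_algebra, 'aaa::cstar_algebra) quantum_group \<Rightarrow>
      ('a \<Rightarrow> complex) \<Rightarrow> ('a \<Rightarrow> 'a) \<Rightarrow> bool" where
  "hopf_star_algebra G \<epsilon> S \<longleftrightarrow>
     1 \<in> coeff_algebra G \<and>
     (\<forall>a\<in>coeff_algebra G. star a \<in> coeff_algebra G \<and> S a \<in> coeff_algebra G) \<and>
     (\<forall>a\<in>coeff_algebra G. \<forall>b\<in>coeff_algebra G. a * b \<in> coeff_algebra G) \<and>
     clinear \<epsilon> \<and> clinear S \<and> \<epsilon> 1 = 1 \<and>
     (\<forall>a\<in>coeff_algebra G. \<epsilon> (star a) = cnj (\<epsilon> a)) \<and>
     (\<forall>a\<in>coeff_algebra G. \<forall>b\<in>coeff_algebra G. \<epsilon> (a * b) = \<epsilon> a * \<epsilon> b) \<and>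
     (\<forall>a\<in>coeff_algebra G. \<exists>t\<in>tensor_span (coeff_algebra G) (coeff_algebra G).
        emb G t = comult G a \<and>
        tensor_lift (\<lambda>b c. \<epsilon> b *\<^sub>C c) t = a \<and>
        tensor_lift (\<lambda>b c. \<epsilon> c *\<^sub>C b) t = a \<and>
        tensor_lift (\<lambda>b c. S b * c) t = \<epsilon> a *\<^sub>C 1 \<and>
        tensor_lift (\<lambda>b c. b * S c) t = \<epsilon> a *\<^sub>C 1)"

text \<open>The coaction identities are compared after embedding the algebraic square of the
  C\<open>*\<close>-algebra into the minimal one, where \<open>comult G\<close> takes its values.\<close>

definition right_action ::
    "('a::cstar_algebra, 'aa::cstar_algebra, 'aaa::cstar_algebra) quantum_group \<Rightarrow> ('a \<Rightarrow> complex) \<Rightarrow>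
      ('d::star_algebra \<Rightarrow> 'd \<otimes> 'a) \<Rightarrow> bool" where
  "right_action G \<epsilon> \<alpha> \<longleftrightarrow> star_hom \<alpha> \<and> range \<alpha> \<subseteq> tensor_span UNIV (coeff_algebra G) \<and>
     (\<forall>d. tensor_map id (emb G) (assoc_right (tensor_map \<alpha> id (\<alpha> d)))
        = tensor_map id (comult G) (\<alpha> d)) \<and>
     (\<forall>d. tensor_lift (\<lambda>d' a. \<epsilon> a *\<^sub>C d') (\<alpha> d) = d)"

definition left_action ::
    "('a::cstar_algebra, 'aa::cstar_algebra, 'aaa::cstar_algebra) quantum_group \<Rightarrow> ('a \<Rightarrow> complex) \<Rightarrow>
      ('d::star_algebra \<Rightarrow> 'a \<otimes> 'd) \<Rightarrow> bool" where
  "left_action G \<epsilon> \<delta> \<longleftrightarrow> star_hom \<delta> \<and> range \<delta> \<subseteq> tensor_span (coeff_algebra G) UNIV \<and>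
     (\<forall>d. tensor_map (emb G) id (assoc_left (tensor_map id \<delta> (\<delta> d)))
        = tensor_map (comult G) id (\<delta> d)) \<and>
     (\<forall>d. tensor_lift (\<lambda>a d'. \<epsilon> a *\<^sub>C d') (\<delta> d) = d)"

text \<open>The algebra \<open>\<D> \<box> \<E>\<close> for a subalgebra \<open>\<D>\<close> of the algebra on which \<open>\<alpha>\<close> is defined.\<close>

definition box_product ::
    "'d::star_algebra set \<Rightarrow> ('d \<Rightarrow> 'd \<otimes> 'a::star_algebra) \<Rightarrow> ('e::star_algebra \<Rightarrow> 'a \<otimes> 'e) \<Rightarrow>
      ('d \<otimes> 'e) set" where
  "box_product D \<alpha> \<delta> =
     {t \<in> tensor_span D UNIV. tensor_map \<alpha> id t = assoc_left (tensor_map id \<delta> t)}"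


section \<open>Monoidal equivalences and link algebras\<close>

text \<open>\<open>\<Phi> xs ys\<close> is the action of the equivalence on morphisms. The condition \<open>\<phi>(1) = 1\<close> includes the
  identifications of \<open>H\<^sub>x \<otimes> H\<^sub>\<epsilon>\<close> and \<open>H\<^sub>\<epsilon> \<otimes> H\<^sub>x\<close> with \<open>H\<^sub>x\<close>: it is imposed on the identity matrix
  between any two words that agree up to occurrences of the trivial class.\<close>

definition monoidal_equivalence ::
    "('a::cstar_algebra, 'aa::cstar_algebra, 'aaa::cstar_algebra) quantum_group \<Rightarrow>
     ('b::cstar_algebra, 'bb::cstar_algebra, 'bbb::cstar_algebra) quantum_group \<Rightarrow>
     ('a mat set \<Rightarrow> 'b mat set) \<Rightarrow>
     ('a mat set list \<Rightarrow> 'a mat set list \<Rightarrow> complex mat \<Rightarrow> complex mat) \<Rightarrow> bool" where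
  "monoidal_equivalence G H \<phi> \<Phi> \<longleftrightarrow>
     bij_betw \<phi> (Irred G) (Irred H) \<and> \<phi> (triv G) = triv H \<and>
     (\<forall>xs\<in>words G. \<forall>ys\<in>words G.
        bij_betw (\<Phi> xs ys) (mor xs ys) (mor (map \<phi> xs) (map \<phi> ys)) \<and>
        (\<forall>S\<in>mor xs ys. \<forall>T\<in>mor xs ys. \<Phi> xs ys (S + T) = \<Phi> xs ys S + \<Phi> xs ys T) \<and>
        (\<forall>c. \<forall>S\<in>mor xs ys. \<Phi> xs ys (c \<cdot>\<^sub>m S) = c \<cdot>\<^sub>m \<Phi> xs ys S) \<and>
        (\<forall>S\<in>mor xs ys. \<Phi> ys xs (adj S) = adj (\<Phi> xs ys S))) \<and>
     (\<forall>xs\<in>words G. \<forall>ys\<in>words G.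
        filter (\<lambda>x. x \<noteq> triv G) xs = filter (\<lambda>x. x \<noteq> triv G) ys \<longrightarrow>
        \<Phi> xs ys (1\<^sub>m (dim_row (tensor_rep xs))) = 1\<^sub>m (dim_row (tensor_rep (map \<phi> xs)))) \<and>
     (\<forall>xs\<in>words G. \<forall>ys\<in>words G. \<forall>zs\<in>words G. \<forall>S\<in>mor xs ys. \<forall>T\<in>mor ys zs.
        \<Phi> xs zs (S * T) = \<Phi> xs ys S * \<Phi> ys zs T) \<and>
     (\<forall>xs\<in>words G. \<forall>ys\<in>words G. \<forall>xs'\<in>words G. \<forall>ys'\<in>words G.
        \<forall>S\<in>mor xs ys. \<forall>T\<in>mor xs' ys'.
        \<Phi> (xs @ xs') (ys @ ys') (kron S T) = kron (\<Phi> xs ys S) (\<Phi> xs' ys' T))"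

definition inverse_obj ::
    "('a::cstar_algebra, 'aa::cstar_algebra, 'aaa::cstar_algebra) quantum_group \<Rightarrow>
     ('a mat set \<Rightarrow> 'b mat set) \<Rightarrow> 'b mat set \<Rightarrow> 'a mat set" where
  "inverse_obj G \<phi> = inv_into (Irred G) \<phi>"

definition inverse_mor ::
    "('a::cstar_algebra, 'aa::cstar_algebra, 'aaa::cstar_algebra) quantum_group \<Rightarrow>
     ('a mat set \<Rightarrow> 'b mat set) \<Rightarrow>
     ('a mat set list \<Rightarrow> 'a mat set list \<Rightarrow> complex mat \<Rightarrow> complex mat) \<Rightarrow>
     'b mat set list \<Rightarrow> 'b mat set list \<Rightarrow> complex mat \<Rightarrow> complex mat" where
  "inverse_mor G \<phi> \<Phi> xs ys =
     (let xs' = map (inverse_obj G \<phi>) xs; ys' = map (inverse_obj G \<phi>) ys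
      in inv_into (mor xs' ys') (\<Phi> xs' ys'))"

text \<open>The link algebra is the whole type \<open>'c\<close>; \<open>X x\<close> is a unitary in
  \<open>\<L>(H\<^sub>x, H\<^sub>\<phi>\<^sub>(\<^sub>x\<^sub>)) \<otimes> \<B>\<close>.\<close>

definition link_algebra ::
    "('a::cstar_algebra, 'aa::cstar_algebra, 'aaa::cstar_algebra) quantum_group \<Rightarrow>
     ('a mat set \<Rightarrow> 'b mat set) \<Rightarrow>
     ('a mat set list \<Rightarrow> 'a mat set list \<Rightarrow> complex mat \<Rightarrow> complex mat) \<Rightarrow>
     ('c::star_algebra \<Rightarrow> complex) \<Rightarrow> ('a mat set \<Rightarrow> 'c mat) \<Rightarrow> bool" where
  "link_algebra G \<phi> \<Phi> \<omega> X \<longleftrightarrow>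
     faithful_state \<omega> \<and>
     (\<forall>x\<in>Irred G. X x \<in> carrier_mat (hdim (\<phi> x)) (hdim x) \<and> unitary_mat (X x)) \<and>
     (\<forall>x\<in>Irred G. \<forall>y\<in>Irred G. \<forall>z\<in>Irred G. \<forall>S\<in>mor [y, z] [x].
        kron (X y) (X z) * amp S = amp (\<Phi> [y, z] [x] S) * X x) \<and>
     (let I = {(x, i, j). x \<in> Irred G \<and> i < hdim (\<phi> x) \<and> j < hdim x};
          coeff = (\<lambda>(x, i, j). X x $$ (i, j))
      in inj_on coeff I \<and> cindependent (coeff ` I) \<and> cspan (coeff ` I) = UNIV) \<and>
     (\<forall>x\<in>Irred G. x \<noteq> triv G \<longrightarrow>
        (\<forall>i<hdim (\<phi> x). \<forall>j<hdim x. \<omega> (X x $$ (i, j)) = 0))"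

definition link_actions ::
    "('a::cstar_algebra, 'aa::cstar_algebra, 'aaa::cstar_algebra) quantum_group \<Rightarrow> ('a \<Rightarrow> complex) \<Rightarrow>
     ('b::cstar_algebra, 'bb::cstar_algebra, 'bbb::cstar_algebra) quantum_group \<Rightarrow> ('b \<Rightarrow> complex) \<Rightarrow>
     ('a mat set \<Rightarrow> 'b mat set) \<Rightarrow> ('a mat set \<Rightarrow> 'c::star_algebra mat) \<Rightarrow>
     ('c \<Rightarrow> 'b \<otimes> 'c) \<Rightarrow> ('c \<Rightarrow> 'c \<otimes> 'a) \<Rightarrow> bool" where
  "link_actions G \<epsilon> H \<epsilon>' \<phi> X \<delta>\<^sub>l \<delta>\<^sub>r \<longleftrightarrow>
     left_action H \<epsilon>' \<delta>\<^sub>l \<and> right_action G \<epsilon> \<delta>\<^sub>r \<and>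
     (\<forall>b. assoc_right (tensor_map \<delta>\<^sub>l id (\<delta>\<^sub>r b)) = tensor_map id \<delta>\<^sub>r (\<delta>\<^sub>l b)) \<and>
     {b. \<delta>\<^sub>l b = 1 \<otimes>\<^sub>t b} = range (\<lambda>c. c *\<^sub>C 1) \<and>
     {b. \<delta>\<^sub>r b = b \<otimes>\<^sub>t 1} = range (\<lambda>c. c *\<^sub>C 1) \<and>
     (\<forall>x\<in>Irred G. \<forall>i<hdim (\<phi> x). \<forall>j<hdim x.
        \<delta>\<^sub>l (X x $$ (i, j)) = (\<Sum>k<hdim (\<phi> x). irrep (\<phi> x) $$ (i, k) \<otimes>\<^sub>t X x $$ (k, j)) \<and>
        \<delta>\<^sub>r (X x $$ (i, j)) = (\<Sum>k<hdim x. X x $$ (i, k) \<otimes>\<^sub>t irrep x $$ (k, j)))"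

end

theory Submission
  imports Defs
begin

text \<open>Let \<open>u\<close> run through the coefficients of the irreducible representations \<open>U\<^sup>y\<close> of \<open>\<G>\<^sub>1\<close>. The map
  \<open>\<theta> : U\<^sup>y \<mapsto> X\<^sup>x\<^sub>1\<^sub>2 Y\<^sup>y\<^sub>1\<^sub>3\<close> with \<open>\<phi>(x) = y\<close> is a \<open>*\<close>-isomorphism from \<open>\<C>(\<G>\<^sub>1)\<close> onto the equalizer of
  \<open>\<delta>\<^sub>2 \<otimes> id\<close> and \<open>id \<otimes> \<gamma>\<^sub>2\<close> in \<open>\<B> \<otimes> \<B>'\<close>, where \<open>\<B>'\<close> is the link algebra of the inverse, and the
  isomorphism of the theorem is \<open>(id \<otimes> \<theta>) \<alpha>\<^sub>1\<close>. It is well defined because the coefficients \<open>u\<close> are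
  linearly independent, multiplicative because \<open>X\<close> and \<open>Y\<close> transform the intertwiners of tensor
  products by \<open>\<phi>\<close> and \<open>\<phi>\<^sup>-\<^sup>1\<close>, and compatible with \<open>*\<close> by unitarity. An element of the equalizer has
  coordinate matrices intertwining \<open>U\<^sup>x\<close> and \<open>U\<^sup>x\<^sup>'\<close> of \<open>\<G>\<^sub>2\<close>, so Schur's lemma puts it into the
  image of \<open>\<theta>\<close>. The remaining condition on \<open>(id \<otimes> \<theta>)(z)\<close> says \<open>(\<alpha>\<^sub>1 \<otimes> id)(z) = (id \<otimes> \<Delta>)(z)\<close>, and
  applying the counit to the last leg gives \<open>z = \<alpha>\<^sub>1((id \<otimes> \<epsilon>)(z))\<close>. No Haar state is used.\<close>

text \<open>Two obstacles shape the proof. The coefficient algebra is a subset of a type, so linear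
  maps such as \<open>\<theta>\<close> are prescribed on the coefficients and extended arbitrarily;
  their algebraic properties hold only for tensors with the relevant leg in
  \<open>coeff_algebra\<close>, and most identities are therefore checked on
  \<open>d \<otimes>\<^sub>t u y i j\<close>. The comultiplication takes values in the minimal
  tensor square; injectivity of \<open>emb\<close> carries its identities back to the algebraic one.
  Linear independence of the coefficients is obtained from linear algebra: the relations among
  finitely many coefficients are stable under slices of the comultiplication, and the orthogonal
  projection having them as kernel turns out to be the identity. Box products are equalizers of
  linear maps. Over a field, tensoring with the identity preserves injectivity and kernels, and this
  moves an equalizer condition from a tensor product to one of its legs.\<close>

section \<open>Linear maps and tensor products\<close>

text \<open>Below \<open>id\<close> occurs as an argument of \<open>tensor_map\<close>. There \<open>id_apply\<close> would turn it into
  \<open>\<lambda>x. x\<close>, to which the rewrite rules stated for \<open>id\<close> no longer apply.\<close>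

declare id_apply [simp del]

interpretation cvec: vector_space_pair
  "scaleC :: complex \<Rightarrow> 'a \<Rightarrow> 'a::complex_vector" "scaleC :: complex \<Rightarrow> 'b \<Rightarrow> 'b::complex_vector"
  by unfold_locales

lemma clinearI:
  assumes "\<And>x y. f (x + y) = f x + f y" "\<And>c x. f (c *\<^sub>C x) = c *\<^sub>C f x"
  shows "clinear f"
  using assms by unfold_locales auto

lemma clinear_simps:
  assumes "clinear f"
  shows clinear_add: "f (x + y) = f x + f y"
    and clinear_scale: "f (c *\<^sub>C x) = c *\<^sub>C f x"
    and clinear_0: "f 0 = 0"
    and clinear_diff: "f (x - y) = f x - f y"
    and clinear_sum: "f (\<Sum>i\<in>I. g i) = (\<Sum>i\<in>I. f (g i))"
  using cvec.linear_add[OF assms] cvec.linear_scale[OF assms] cvec.linear_0[OF assms]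
    cvec.linear_diff[OF assms] cvec.linear_sum[OF assms] by auto

lemma clinear_id [simp]: "clinear id" "clinear (\<lambda>x. x)"
  by (auto intro!: clinearI simp: id_apply)

lemma clinear_compose: "clinear f \<Longrightarrow> clinear g \<Longrightarrow> clinear (\<lambda>x. f (g x))"
  by (auto intro!: clinearI simp: clinear_simps)

lemma clinear_minus: "clinear f \<Longrightarrow> clinear g \<Longrightarrow> clinear (\<lambda>x. f x - g x)"
  by (auto intro!: clinearI simp: clinear_simps complex_vector.scale_right_diff_distrib)

lemma clinear_plus: "clinear f \<Longrightarrow> clinear g \<Longrightarrow> clinear (\<lambda>x. f x + g x)"
  by (auto intro!: clinearI simp: clinear_simps scaleC_add_right)

lemma clinear_eq_on_span:
  assumes "clinear f" "clinear g" "x \<in> cspan S" "\<And>y. y \<in> S \<Longrightarrow> f y = g y"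
  shows "f x = g x"
  using assms(3)
  by (induction rule: complex_vector.span_induct_alt)
    (simp_all add: clinear_simps[OF assms(1)] clinear_simps[OF assms(2)] assms(4))

lemma scaleC_simps [simp]: "1 *\<^sub>C x = x" "0 *\<^sub>C x = 0" "c *\<^sub>C 0 = (0::'a)"
  for x :: "'a::complex_vector"
  by (simp_all add: scaleC_one complex_vector.scale_zero_left complex_vector.scale_zero_right)

lemma tensor_zero [simp]: "0 \<otimes>\<^sub>t b = 0" "a \<otimes>\<^sub>t 0 = 0"
  using tensor_elem_bilin(3)[of 0 0 b] tensor_elem_bilin(4)[of a 0 0]
  by (simp_all only: scaleC_simps)

lemma clinear_tensor_elem: "clinear (\<lambda>a. a \<otimes>\<^sub>t b)" "clinear (\<lambda>b. a \<otimes>\<^sub>t b)"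
  by (auto intro!: clinearI simp: tensor_elem_bilin)

lemma tensor_sum_left: "(\<Sum>i\<in>I. f i) \<otimes>\<^sub>t b = (\<Sum>i\<in>I. f i \<otimes>\<^sub>t b)"
  and tensor_sum_right: "a \<otimes>\<^sub>t (\<Sum>i\<in>I. f i) = (\<Sum>i\<in>I. a \<otimes>\<^sub>t f i)"
  by (rule clinear_sum clinear_tensor_elem)+

lemma clinear_eq_tensor:
  assumes "clinear f" "clinear g" "\<And>a b. f (a \<otimes>\<^sub>t b) = g (a \<otimes>\<^sub>t b)"
  shows "f t = g t"
  by (induction t rule: tensor_induct)
    (simp_all add: clinear_simps[OF assms(1)] clinear_simps[OF assms(2)] assms(3))

lemma bilinI:
  assumes "\<And>b. clinear (\<lambda>a. f a b)" "\<And>a. clinear (\<lambda>b. f a b)"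
  shows "bilin id f"
  unfolding bilin_def using clinear_simps(1,2)[OF assms(1)] clinear_simps(1,2)[OF assms(2)] by (auto simp: id_apply)

lemma tensor_map:
  assumes "clinear f" "clinear g"
  shows clinear_tensor_map: "clinear (tensor_map f g)"
    and tensor_map_elem: "tensor_map f g (a \<otimes>\<^sub>t b) = f a \<otimes>\<^sub>t g b"
proof -
  have b: "bilin id (\<lambda>a b. f a \<otimes>\<^sub>t g b)"
    by (simp add: bilin_def clinear_simps[OF assms(1)] clinear_simps[OF assms(2)] tensor_elem_bilin id_apply)
  show "clinear (tensor_map f g)"
    unfolding tensor_map_def by (rule tensor_lift_linear[OF b])
  show "tensor_map f g (a \<otimes>\<^sub>t b) = f a \<otimes>\<^sub>t g b"
    unfolding tensor_map_def by (rule tensor_lift_gen(3)[OF conj_map_id b])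
qed

lemma tensor_map_id_elem:
  assumes "clinear f"
  shows "tensor_map id f (a \<otimes>\<^sub>t b) = a \<otimes>\<^sub>t f b" "tensor_map f id (b \<otimes>\<^sub>t a) = f b \<otimes>\<^sub>t a"
  by (simp_all only: tensor_map_elem[OF clinear_id(1) assms] tensor_map_elem[OF assms clinear_id(1)])
    (simp_all only: id_apply)

lemma tensor_map_compose:
  assumes "clinear f" "clinear g" "clinear h" "clinear k"
  shows "tensor_map f g (tensor_map h k t) = tensor_map (\<lambda>x. f (h x)) (\<lambda>x. g (k x)) t"
proof -
  note fh = clinear_compose[OF assms(1,3)] and gk = clinear_compose[OF assms(2,4)]
  show ?thesis
    by (rule clinear_eq_tensor[OF clinear_compose[OF clinear_tensor_map clinear_tensor_map]
          clinear_tensor_map, OF assms fh gk])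
      (simp only: tensor_map_elem[OF fh gk] tensor_map_elem assms)
qed

lemma tensor_map_compose_id:
  assumes "clinear f" "clinear h"
  shows "tensor_map id f (tensor_map id h t) = tensor_map id (\<lambda>x. f (h x)) t"
    and "tensor_map f id (tensor_map h id s) = tensor_map (\<lambda>x. f (h x)) id s"
  using tensor_map_compose[OF clinear_id(1) assms(1) clinear_id(1) assms(2), of t]
    tensor_map_compose[OF assms(1) clinear_id(1) assms(2) clinear_id(1), of s]
  \<comment> \<open>The composition rule leaves \<open>\<lambda>x. id (id x)\<close> on the
    untouched leg; it is folded back to \<open>id\<close> so that later rewriting still
    applies.\<close>
  by (simp_all only: id_apply id_def[symmetric])

lemma tensor_map_ident: "tensor_map id (\<lambda>x. x) t = t" "tensor_map (\<lambda>x. x) id s = s"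
  by (rule clinear_eq_tensor[OF clinear_tensor_map[OF clinear_id] clinear_id(2)]
        clinear_eq_tensor[OF clinear_tensor_map[OF clinear_id(2,1)] clinear_id(2)],
      simp add: tensor_map_id_elem)+

lemma tensor_lift_elem: "bilin id f \<Longrightarrow> tensor_lift f (a \<otimes>\<^sub>t b) = f a b"
  by (rule tensor_lift_gen(3)[OF conj_map_id])

text \<open>The associators are nested lifts. A lift is linear in the tensor by construction, but
  its linearity in the parameter \<open>a\<close> needs an induction on the tensor, since the lift
  is computed from an unspecified representative.\<close>

lemma bilin_lift:
  assumes "\<And>a. bilin id (f a)" "\<And>b c. clinear (\<lambda>a. f a b c)"
  shows "bilin id (\<lambda>a t. tensor_lift (f a) t)"
proof (rule bilinI)
  fix t
  show "clinear (\<lambda>a. tensor_lift (f a) t)"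
  proof (induction t rule: tensor_induct)
    case (elem a b)
    then show ?case by (simp only: tensor_lift_elem assms)
  next
    case (add s t)
    then show ?case
      by (intro clinearI) (simp_all only: clinear_simps[OF tensor_lift_linear[OF assms(1)]] scaleC_add_right
          clinear_simps[OF add(1)] clinear_simps[OF add(2)] add.assoc add.left_commute)
  qed
next
  fix a show "clinear (tensor_lift (f a))" by (rule tensor_lift_linear) (rule assms)
qed

lemma bilin_flip: "bilin id f \<Longrightarrow> bilin id (\<lambda>b a. f a b)"
  by (auto simp: bilin_def)

section \<open>Associativity of the tensor product\<close>

lemma assoc_left: 
  shows clinear_assoc_left: "clinear assoc_left"
    and assoc_left_elem: "assoc_left (a \<otimes>\<^sub>t b \<otimes>\<^sub>t c) = (a \<otimes>\<^sub>t b) \<otimes>\<^sub>t c"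
proof -
  have b1: "bilin id (\<lambda>b c. (a \<otimes>\<^sub>t b) \<otimes>\<^sub>t c)" for a
    by (auto simp: bilin_def tensor_elem_bilin id_apply)
  have b: "bilin id (\<lambda>a. tensor_lift (\<lambda>b c. (a \<otimes>\<^sub>t b) \<otimes>\<^sub>t c))"
    by (rule bilin_lift[OF b1]) (auto intro!: clinearI simp: tensor_elem_bilin)
  show "clinear assoc_left" unfolding assoc_left_def by (rule tensor_lift_linear[OF b])
  show "assoc_left (a \<otimes>\<^sub>t b \<otimes>\<^sub>t c) = (a \<otimes>\<^sub>t b) \<otimes>\<^sub>t c" for a b c
    unfolding assoc_left_def by (simp add: tensor_lift_elem b b1)
qed

lemma assoc_right: 
  shows clinear_assoc_right: "clinear assoc_right"
    and assoc_right_elem: "assoc_right ((a \<otimes>\<^sub>t b) \<otimes>\<^sub>t c) = a \<otimes>\<^sub>t b \<otimes>\<^sub>t c"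
proof -
  have b1: "bilin id (\<lambda>a b. a \<otimes>\<^sub>t b \<otimes>\<^sub>t c)" for c
    by (auto simp: bilin_def tensor_elem_bilin id_apply)
  \<comment> \<open>In \<open>assoc_right\<close> the inner tensor is the first argument of the
    outer lift, so bilinearity is shown with the arguments exchanged and then flipped.\<close>
  have "bilin id (\<lambda>c s. tensor_lift (\<lambda>a b. a \<otimes>\<^sub>t b \<otimes>\<^sub>t c) s)"
    by (rule bilin_lift[OF b1]) (intro clinear_compose[OF clinear_tensor_elem(2) clinear_tensor_elem(2)])
  then have b: "bilin id (\<lambda>s c. tensor_lift (\<lambda>a b. a \<otimes>\<^sub>t b \<otimes>\<^sub>t c) s)"
    by (rule bilin_flip)
  show "clinear assoc_right" unfolding assoc_right_def by (rule tensor_lift_linear[OF b])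
  show "assoc_right ((a \<otimes>\<^sub>t b) \<otimes>\<^sub>t c) = a \<otimes>\<^sub>t b \<otimes>\<^sub>t c" for a b c
    unfolding assoc_right_def by (simp add: tensor_lift_elem b b1)
qed

lemma clinear_eq_tensor3:
  assumes "clinear f" "clinear g" "\<And>a b c. f (a \<otimes>\<^sub>t b \<otimes>\<^sub>t c) = g (a \<otimes>\<^sub>t b \<otimes>\<^sub>t c)"
  shows "f t = g t"
proof (rule clinear_eq_tensor[OF assms(1,2)])
  fix a s
  show "f (a \<otimes>\<^sub>t s) = g (a \<otimes>\<^sub>t s)"
    using clinear_eq_tensor[OF clinear_compose[OF assms(1) clinear_tensor_elem(2)]
        clinear_compose[OF assms(2) clinear_tensor_elem(2)]] assms(3) .
qed

lemma clinear_eq_tensor3':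
  assumes "clinear f" "clinear g" "\<And>a b c. f ((a \<otimes>\<^sub>t b) \<otimes>\<^sub>t c) = g ((a \<otimes>\<^sub>t b) \<otimes>\<^sub>t c)"
  shows "f t = g t"
proof (rule clinear_eq_tensor[OF assms(1,2)])
  fix s c
  show "f (s \<otimes>\<^sub>t c) = g (s \<otimes>\<^sub>t c)"
    using clinear_eq_tensor[OF clinear_compose[OF assms(1) clinear_tensor_elem(1)]
        clinear_compose[OF assms(2) clinear_tensor_elem(1)]] assms(3) .
qed

lemma assoc_right_left [simp]: "assoc_right (assoc_left t) = t"
  by (rule clinear_eq_tensor3[OF clinear_compose[OF clinear_assoc_right clinear_assoc_left] clinear_id(2)])
    (simp add: assoc_left_elem assoc_right_elem)

lemma assoc_left_right [simp]: "assoc_left (assoc_right t) = t"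
  by (rule clinear_eq_tensor3'[OF clinear_compose[OF clinear_assoc_left clinear_assoc_right] clinear_id(2)])
    (simp add: assoc_left_elem assoc_right_elem)

lemma inj_assoc_left: "inj assoc_left"
  by (metis assoc_right_left injI)

section \<open>Star homomorphisms and tensor products\<close>

lemma star_homD:
  assumes "star_hom f"
  shows "clinear f" "f 1 = 1" "f (x * y) = f x * f y" "f (star x) = star (f x)"
  using assms by (auto simp: star_hom_def)

lemma star_zero [simp]: "star (0 :: 'a::star_algebra) = 0"
  using star_scaleC[of 0 "0::'a"] by simp

lemma star_sum: "star (\<Sum>i\<in>I. f i) = (\<Sum>i\<in>I. star (f i))" for f :: "_ \<Rightarrow> 'a::star_algebra"
  by (induction I rule: infinite_finite_induct) (simp_all add: star_add)

lemma star_one [simp]: "star (1 :: 'a::star_algebra) = 1"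
  by (metis mult_1_left mult_1_right star_mult star_star)

lemma star_hom_assoc_left: "star_hom (assoc_left :: 'a::star_algebra \<otimes> 'b::star_algebra \<otimes> 'c::star_algebra \<Rightarrow> _)"
proof -
  note l = clinear_simps[OF clinear_assoc_left]
  have m: "assoc_left (s * t) = assoc_left s * assoc_left t" for s t :: "'a \<otimes> 'b \<otimes> 'c"
  proof (rule clinear_eq_tensor3[where t = s])
    show "clinear (\<lambda>s. assoc_left (s * t))"
      by (rule clinearI) (simp_all add: l distrib_right scaleC_mult_left)
    show "clinear (\<lambda>s. assoc_left s * assoc_left t)"
      by (rule clinearI) (simp_all add: l distrib_right scaleC_mult_left)
    fix a b c
    show "assoc_left ((a \<otimes>\<^sub>t b \<otimes>\<^sub>t c) * t) = assoc_left (a \<otimes>\<^sub>t b \<otimes>\<^sub>t c) * assoc_left t"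
    proof (rule clinear_eq_tensor3[where t = t])
      show "clinear (\<lambda>t. assoc_left ((a \<otimes>\<^sub>t b \<otimes>\<^sub>t c) * t))"
        by (rule clinearI) (simp_all add: l distrib_left scaleC_mult_right)
      show "clinear (\<lambda>t. assoc_left (a \<otimes>\<^sub>t b \<otimes>\<^sub>t c) * assoc_left t)"
        by (rule clinearI) (simp_all add: l distrib_left scaleC_mult_right)
    qed (simp add: tensor_elem_mult assoc_left_elem)
  qed
  have s: "assoc_left (star t) = star (assoc_left t)" for t :: "'a \<otimes> 'b \<otimes> 'c"
  proof (induction t rule: tensor_induct)
    case (elem a t)
    show ?case 
      by (induction t rule: tensor_induct)
       (simp_all add: l star_add tensor_elem_bilin assoc_left_elem tensor_elem_star)
  qed (simp add: l star_add)
  show ?thesis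
    using m s by (auto simp: star_hom_def clinear_assoc_left tensor_one assoc_left_elem)
qed

lemma tensor_span_UNIV [simp]: "tensor_span UNIV UNIV = UNIV"
proof -
  have "t \<in> tensor_span UNIV UNIV" for t :: "'a \<otimes> 'b"
    unfolding tensor_span_def
    by (induction t rule: tensor_induct) (blast intro: complex_vector.span_base complex_vector.span_add)+
  then show ?thesis by auto
qed

text \<open>The intended \<open>f\<close> is \<open>\<theta>\<close>, which is multiplicative only
  on the coefficient algebra, whence the restriction of the second legs to \<open>A\<close>. By
  linearity in each factor separately, elementary tensors suffice.\<close>

lemma tensor_map_hom_on:
  fixes f :: "'a::star_algebra \<Rightarrow> 'b::star_algebra"
  assumes lin: "clinear f" and mult: "\<And>a b. a \<in> A \<Longrightarrow> b \<in> A \<Longrightarrow> f (a * b) = f a * f b"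
    and star: "\<And>a. a \<in> A \<Longrightarrow> f (star a) = star (f a)"
    and s: "s \<in> tensor_span (UNIV :: 'd::star_algebra set) A" and t: "t \<in> tensor_span UNIV A"
  shows "tensor_map id f (s * t) = tensor_map id f s * tensor_map id f t"
    and "tensor_map id f (star s) = star (tensor_map id f s)"
proof -
  note l = clinear_simps[OF clinear_tensor_map[OF clinear_id(1) lin]]
  note e = tensor_map_id_elem(1)[OF lin]
  show "tensor_map id f (s * t) = tensor_map id f s * tensor_map id f t"
    using s unfolding tensor_span_def
  proof (induction rule: complex_vector.span_induct_alt)
    case (step c x y)
    then obtain v a where x: "x = v \<otimes>\<^sub>t a" "a \<in> A" by auto
    have "tensor_map id f (x * t) = tensor_map id f x * tensor_map id f t"
      using t unfolding tensor_span_def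
    proof (induction rule: complex_vector.span_induct_alt)
      case (step c x y)
      then show ?case 
        using x by (auto simp: l distrib_left scaleC_mult_right e tensor_elem_mult mult)
    qed (simp add: l)
    with step show ?case by (simp add: l distrib_right scaleC_mult_left)
  qed (simp add: l)
  show "tensor_map id f (star s) = star (tensor_map id f s)"
    using s unfolding tensor_span_def
  proof (induction rule: complex_vector.span_induct_alt)
    case (step c x y)
    then show ?case by (auto simp: l e star_add star_scaleC tensor_elem_star star)
  qed (simp add: l)
qed

section \<open>Extension of linear maps; injectivity and kernels after tensoring\<close>

lemma clinear_extend:
  assumes "inj_on v I" "cindependent (v ` I)"
  obtains f where "clinear f" "\<And>s. s \<in> I \<Longrightarrow> f (v s) = g s"
proof -
  obtain f where "clinear f" "\<forall>x\<in>v ` I. f x = g (inv_into I v x)"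
    using cvec.linear_independent_extend[OF assms(2), of "\<lambda>x. g (inv_into I v x)"] by blast
  then show ?thesis using assms(1) that by simp
qed

text \<open>A nonzero \<open>x\<close> is independent, so some functional takes the value 1 at it.
  This permits an identity in an algebra to be proved one scalar slice at a time.\<close>

lemma functional_separates:
  fixes x :: "'a::complex_vector"
  assumes "\<And>f :: 'a \<Rightarrow> complex. clinear f \<Longrightarrow> f x = 0"
  shows "x = 0"
proof (rule ccontr)
  assume "x \<noteq> 0"
  then have "cindependent {x}" by simp
  then obtain f where "clinear f" "f x = (1::complex)"
    using cvec.linear_independent_extend[of "{x}" "\<lambda>_. 1"] by auto
  then show False using assms by force
qed

lemma clinear_left_inverse:
  assumes "clinear f" "inj f"
  obtains g where "clinear g" "\<And>x. g (f x) = x"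
proof -
  obtain g where "clinear g" "g \<circ> f = id"
    using cvec.linear_injective_left_inverse[OF assms] by blast
  then show ?thesis using that[of g] by (simp only: fun_eq_iff o_apply id_apply)
qed

text \<open>Over a field an injective linear map has a linear left inverse, and tensoring both with
  the identity preserves this.\<close>

lemma inj_tensor_map_id:
  assumes "clinear f" "inj f"
  shows "inj (tensor_map (id :: 'd::complex_vector \<Rightarrow> 'd) f)" "inj (tensor_map f (id :: 'd::complex_vector \<Rightarrow> 'd))"
proof -
  obtain g where g: "clinear g" "\<And>x. g (f x) = x" using clinear_left_inverse[OF assms] by blast
  have "tensor_map id g (tensor_map id f t) = t" for t :: "'d \<otimes> 'a"
    by (simp add: tensor_map_compose_id assms g tensor_map_ident)
  then show "inj (tensor_map (id :: 'd \<Rightarrow> 'd) f)" by (metis injI)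
  have "tensor_map g id (tensor_map f id t) = t" for t :: "'a \<otimes> 'd"
    by (simp add: tensor_map_compose_id assms g tensor_map_ident)
  then show "inj (tensor_map f (id :: 'd \<Rightarrow> 'd))" by (metis injI)
qed

text \<open>With such a \<open>g\<close>, the map \<open>x \<mapsto> x - g (f x)\<close> is a projection onto the kernel of \<open>f\<close>. Applied to
  one leg it computes kernels of \<open>f \<otimes> id\<close> without a normal form of tensors.\<close>

lemma kernel_projection:
  assumes "clinear f"
  obtains g where "clinear g" "\<And>x. f (g (f x)) = f x"
proof -
  obtain B where B: "B \<subseteq> range f" "cindependent B" "range f \<subseteq> cspan B"
    using complex_vector.maximal_independent_subset[of "range f"] by blast
  \<comment> \<open>\<open>g\<close> sends each vector of the basis \<open>B\<close> of the range to
    a chosen preimage, so \<open>f\<close> after \<open>g\<close> is the identity on the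
    range.\<close>
  obtain g where g: "clinear g" "\<forall>b\<in>B. g b = inv_into UNIV f b"
    using cvec.linear_independent_extend[OF B(2), of "inv_into UNIV f"] by auto
  have "f (g y) = y" if "y \<in> range f" for y
  proof (rule clinear_eq_on_span[where S = B and f = "\<lambda>y. f (g y)" and g = "\<lambda>y. y"])
    show "y \<in> cspan B" using that B(3) by auto
    show "clinear (\<lambda>y. f (g y))" by (rule clinear_compose[OF assms g(1)])
    fix b assume "b \<in> B"
    then show "f (g b) = b" using g(2) B(1) by (auto simp: f_inv_into_f)
  qed simp
  then show ?thesis using that g(1) by blast
qed

text \<open>The splitting \<open>x = (x - g (f x)) + g (f x)\<close>, applied to one leg, leaves
  only the part in the kernel. For \<open>f\<close> the difference of two maps the kernel is their
  equalizer: the first form yields membership in the inner box product, the second brings the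
  \<open>\<delta>\<^sub>2\<close>-\<open>\<gamma>\<^sub>2\<close> condition down to the last two
  legs.\<close>

lemma kernel_tensor_map:
  fixes f :: "'a::complex_vector \<Rightarrow> 'b::complex_vector"
  assumes f: "clinear f"
  shows "tensor_map f (id :: 'd::complex_vector \<Rightarrow> 'd) t = 0 \<Longrightarrow> t \<in> tensor_span {x. f x = 0} UNIV"
    and "tensor_map (id :: 'd::complex_vector \<Rightarrow> 'd) f s = 0 \<Longrightarrow> s \<in> tensor_span UNIV {x. f x = 0}"
proof -
  obtain g where g: "clinear g" "\<And>x. f (g (f x)) = f x" using kernel_projection[OF f] by blast
  define p where "p x = x - g (f x)" for x
  have p: "f (p x) = 0" for x by (simp add: p_def clinear_simps[OF f] g)
  have pl: "clinear p"
    unfolding p_def by (intro clinear_minus clinear_compose[OF g(1)] f clinear_id)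
  have *: "x = p x + g (f x)" for x by (simp add: p_def)
  assume t: "tensor_map f (id :: 'd \<Rightarrow> 'd) t = 0"
  have "t = tensor_map p id t + tensor_map g id (tensor_map f id t)"
  proof (rule clinear_eq_tensor[where f = "\<lambda>t. t"])
    fix a and b :: 'd show "a \<otimes>\<^sub>t b = tensor_map p id (a \<otimes>\<^sub>t b) + tensor_map g id (tensor_map f id (a \<otimes>\<^sub>t b))"
      by (simp only: tensor_map_id_elem f g pl tensor_elem_bilin(1)[symmetric] *[symmetric])
  qed (intro clinear_id clinear_plus clinear_compose[OF clinear_tensor_map clinear_tensor_map]
      clinear_tensor_map f g pl)+
  also have "\<dots> = tensor_map p id t" by (simp add: t clinear_simps[OF clinear_tensor_map[OF g(1)]])
  finally have "t = tensor_map p id t" .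
  moreover have "tensor_map p id t \<in> tensor_span {x. f x = 0} UNIV" for t :: "'a \<otimes> 'd"
    unfolding tensor_span_def
  proof (induction t rule: tensor_induct)
    case (elem a b)
    then show ?case using p by (auto intro!: complex_vector.span_base simp: tensor_map_id_elem pl)
  qed (auto intro!: complex_vector.span_add simp: clinear_simps[OF clinear_tensor_map] pl)
  ultimately show "t \<in> tensor_span {x. f x = 0} UNIV" by metis
next
  obtain g where g: "clinear g" "\<And>x. f (g (f x)) = f x" using kernel_projection[OF f] by blast
  define p where "p x = x - g (f x)" for x
  have p: "f (p x) = 0" for x by (simp add: p_def clinear_simps[OF f] g)
  have pl: "clinear p"
    unfolding p_def by (intro clinear_minus clinear_compose[OF g(1)] f clinear_id)
  have *: "x = p x + g (f x)" for x by (simp add: p_def)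
  assume t: "tensor_map (id :: 'd \<Rightarrow> 'd) f s = 0"
  have "s = tensor_map id p s + tensor_map id g (tensor_map id f s)"
  proof (rule clinear_eq_tensor[where f = "\<lambda>t. t"])
    fix a and b :: 'd show "b \<otimes>\<^sub>t a = tensor_map id p (b \<otimes>\<^sub>t a) + tensor_map id g (tensor_map id f (b \<otimes>\<^sub>t a))"
      by (simp only: tensor_map_id_elem f g pl tensor_elem_bilin(2)[symmetric] *[symmetric])
  qed (intro clinear_id clinear_plus clinear_compose[OF clinear_tensor_map clinear_tensor_map]
      clinear_tensor_map f g pl)+
  also have "\<dots> = tensor_map id p s" by (simp add: t clinear_simps[OF clinear_tensor_map[OF _ g(1)]])
  finally have "s = tensor_map id p s" .
  moreover have "tensor_map id p t \<in> tensor_span UNIV {x. f x = 0}" for t :: "'d \<otimes> 'a"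
    unfolding tensor_span_def
  proof (induction t rule: tensor_induct)
    case (elem a b)
    then show ?case using p by (auto intro!: complex_vector.span_base simp: tensor_map_id_elem pl)
  qed (auto intro!: complex_vector.span_add simp: clinear_simps[OF clinear_tensor_map] pl)
  ultimately show "s \<in> tensor_span UNIV {x. f x = 0}" by metis
qed

section \<open>Linear relations and orthogonal projections\<close>

lemma sum_delta_scale:
  "finite I \<Longrightarrow> s \<in> I \<Longrightarrow> (\<Sum>t\<in>I. (if s = t then 1 else 0) *\<^sub>C v t) = v s"
  "finite I \<Longrightarrow> s \<in> I \<Longrightarrow> (\<Sum>t\<in>I. (if t = s then 1 else 0) *\<^sub>C v t) = v s"
  for v :: "_ \<Rightarrow> 'a::complex_vector"
  by (simp_all add: if_distrib[where f = "\<lambda>c. c *\<^sub>C _"] cong: if_cong)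

text \<open>\<open>P\<close> is a hermitian idempotent matrix fixing the column vector
  \<open>v\<close>. Relations are row vectors \<open>c\<close> with \<open>c v = 0\<close>. The
  projection aimed at also satisfies \<open>c P = 0\<close> for all of them: acting on rows, it is
  the orthogonal projection whose kernel is the space of relations.\<close>

definition fixing_projection :: "'i set \<Rightarrow> ('i \<Rightarrow> 'a::complex_vector) \<Rightarrow> ('i \<Rightarrow> 'i \<Rightarrow> complex) \<Rightarrow> bool" where
  "fixing_projection I v P \<longleftrightarrow> (\<forall>s\<in>I. \<forall>t\<in>I. P t s = cnj (P s t)) \<and>
    (\<forall>s\<in>I. \<forall>t\<in>I. (\<Sum>u\<in>I. P s u * P u t) = P s t) \<and> (\<forall>s\<in>I. (\<Sum>t\<in>I. P s t *\<^sub>C v t) = v s)"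

text \<open>A relation \<open>c\<close> not yet annihilated by the projection \<open>P\<close> is removed by replacing \<open>P\<close> with
  \<open>P - d\<^sup>* d / \<parallel>d\<parallel>\<^sup>2\<close>, where \<open>d = c P\<close>.\<close>

lemma fixing_projection_step:
  fixes v :: "'i \<Rightarrow> 'a::complex_vector" and P :: "'i \<Rightarrow> 'i \<Rightarrow> complex"
  assumes I: "finite I" and P: "fixing_projection I v P"
    and c: "(\<Sum>s\<in>I. c s *\<^sub>C v s) = 0"
  obtains Q where "fixing_projection I v Q"
    and "\<And>t. t \<in> I \<Longrightarrow> (\<Sum>s\<in>I. c s * Q s t) = 0"
    and "\<And>b t. (\<And>t. t \<in> I \<Longrightarrow> (\<Sum>s\<in>I. b s * P s t) = 0) \<Longrightarrow> t \<in> I \<Longrightarrow> (\<Sum>s\<in>I. b s * Q s t) = 0"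
proof (cases "\<forall>t\<in>I. (\<Sum>s\<in>I. c s * P s t) = 0")
  case True
  show ?thesis by (rule that[OF P]) (use True in blast)+
next
  case False
  have herm: "P t s = cnj (P s t)" and idem: "(\<Sum>u\<in>I. P s u * P u t) = P s t"
    and fixed: "(\<Sum>t\<in>I. P s t *\<^sub>C v t) = v s" if "s \<in> I" "t \<in> I" for s t
    using P that unfolding fixing_projection_def by blast+
  define d where "d t = (\<Sum>s\<in>I. c s * P s t)" for t
  define N where "N = (\<Sum>t\<in>I. d t * cnj (d t))"
  have Nr: "N = complex_of_real (\<Sum>t\<in>I. (cmod (d t))\<^sup>2)"
    by (simp add: N_def complex_mult_cnj cmod_power2)
  obtain t0 where t0: "t0 \<in> I" "d t0 \<noteq> 0" using False by (auto simp: d_def)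
  have "0 < (\<Sum>t\<in>I. (cmod (d t))\<^sup>2)"
    using t0 by (intro sum_pos2[OF I t0(1)]) auto
  then have N0: "N \<noteq> 0" unfolding Nr by (metis of_real_eq_0_iff less_irrefl)
  have cN: "cnj N = N" by (simp add: Nr)
  \<comment> \<open>\<open>d\<close> is fixed by \<open>P\<close> from the right because
    \<open>P\<close> is idempotent, and then \<open>d\<^sup>*\<close> from the left because
    \<open>P\<close> is hermitian. This makes the corrected matrix idempotent.\<close>
  have dP: "(\<Sum>t\<in>I. d t * P t u) = d u" if "u \<in> I" for u
  proof -
    have "(\<Sum>t\<in>I. d t * P t u) = (\<Sum>t\<in>I. \<Sum>s\<in>I. c s * (P s t * P t u))"
      by (simp add: d_def sum_distrib_right mult.assoc)
    also have "\<dots> = (\<Sum>s\<in>I. c s * (\<Sum>t\<in>I. P s t * P t u))"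
      by (subst sum.swap) (simp add: sum_distrib_left)
    also have "\<dots> = d u" unfolding d_def by (intro sum.cong refl) (simp add: idem that)
    finally show ?thesis .
  qed
  have Pd: "(\<Sum>t\<in>I. P s t * cnj (d t)) = cnj (d s)" if "s \<in> I" for s
  proof -
    have "(\<Sum>t\<in>I. P s t * cnj (d t)) = cnj (\<Sum>t\<in>I. d t * P t s)"
      unfolding cnj_sum using that by (intro sum.cong refl) (simp add: herm[of s] mult.commute)
    then show ?thesis by (simp add: dP that)
  qed
  \<comment> \<open>As \<open>P\<close> fixes \<open>d\<^sup>*\<close>, the pairing of
    \<open>b\<close> with \<open>d\<^sup>*\<close> depends only on \<open>b P\<close>. Hence rows
    already killed by \<open>P\<close> stay killed, and for \<open>b = c\<close> the pairing is
    \<open>N\<close>, which makes the correction cancel \<open>c P\<close>.\<close>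
  have bd: "(\<Sum>s\<in>I. b s * cnj (d s)) = (\<Sum>t\<in>I. (\<Sum>s\<in>I. b s * P s t) * cnj (d t))" for b
  proof -
    have "(\<Sum>s\<in>I. b s * cnj (d s)) = (\<Sum>s\<in>I. \<Sum>t\<in>I. b s * (P s t * cnj (d t)))"
      by (intro sum.cong refl) (simp add: Pd flip: sum_distrib_left)
    also have "\<dots> = (\<Sum>t\<in>I. (\<Sum>s\<in>I. b s * P s t) * cnj (d t))"
      by (subst sum.swap) (simp add: sum_distrib_right mult.assoc)
    finally show ?thesis .
  qed
  define Q where "Q s t = P s t - cnj (d s) * d t / N" for s t
  have bQ: "(\<Sum>s\<in>I. b s * Q s t) = (\<Sum>s\<in>I. b s * P s t) - (\<Sum>s\<in>I. b s * cnj (d s)) * d t / N" for b t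
    by (simp add: Q_def right_diff_distrib sum_subtractf sum_distrib_right sum_divide_distrib mult.assoc)
  have Qherm: "Q t s = cnj (Q s t)" if "s \<in> I" "t \<in> I" for s t
    using that by (simp add: Q_def herm[of s t] cN mult.commute)
  have Qidem: "(\<Sum>u\<in>I. Q s u * Q u t) = Q s t" if st: "s \<in> I" "t \<in> I" for s t
  proof -
    have 1: "(\<Sum>u\<in>I. d u * Q u t) = 0"
      unfolding bQ using N0 st by (simp add: dP flip: N_def)
    have 2: "(\<Sum>u\<in>I. P s u * Q u t) = Q s t"
      unfolding bQ using st by (simp add: idem Pd Q_def)
    have "(\<Sum>u\<in>I. Q s u * Q u t) = (\<Sum>u\<in>I. P s u * Q u t) - cnj (d s) / N * (\<Sum>u\<in>I. d u * Q u t)"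
      by (subst Q_def) (simp add: left_diff_distrib sum_subtractf sum_distrib_left mult.assoc)
    then show ?thesis by (simp add: 1 2)
  qed
  have Qv: "(\<Sum>t\<in>I. Q s t *\<^sub>C v t) = v s" if s: "s \<in> I" for s
  proof -
    have "(\<Sum>t\<in>I. d t *\<^sub>C v t) = (\<Sum>t\<in>I. \<Sum>s\<in>I. c s *\<^sub>C P s t *\<^sub>C v t)"
      by (simp add: d_def complex_vector.scale_sum_left scaleC_scaleC)
    also have "\<dots> = (\<Sum>s\<in>I. c s *\<^sub>C v s)"
      by (subst sum.swap) (intro sum.cong refl, simp only: fixed flip: complex_vector.scale_sum_right)
    finally have dv: "(\<Sum>t\<in>I. d t *\<^sub>C v t) = 0" using c by simp
    have "(\<Sum>t\<in>I. Q s t *\<^sub>C v t) = (\<Sum>t\<in>I. P s t *\<^sub>C v t) - (cnj (d s) / N) *\<^sub>C (\<Sum>t\<in>I. d t *\<^sub>C v t)"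
      by (simp add: Q_def complex_vector.scale_left_diff_distrib sum_subtractf scaleC_scaleC
          complex_vector.scale_sum_right)
    then show ?thesis by (simp add: dv fixed[OF s s])
  qed
  show ?thesis
  proof (rule that[of Q])
    show "fixing_projection I v Q"
      unfolding fixing_projection_def using Qherm Qidem Qv by blast
    have "(\<Sum>s\<in>I. c s * cnj (d s)) = N"
      by (subst bd) (simp only: N_def flip: d_def)
    then show "(\<Sum>s\<in>I. c s * Q s t) = 0" for t unfolding bQ using N0 by (simp flip: d_def)
    show "(\<Sum>s\<in>I. b s * Q s t) = 0" if "\<And>t. t \<in> I \<Longrightarrow> (\<Sum>s\<in>I. b s * P s t) = 0" "t \<in> I" for b t
      unfolding bQ by (subst bd) (simp add: that)
  qed
qed

text \<open>Induction on a set \<open>J\<close> containing the support of the relations considered.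
  Modulo relations supported in \<open>J\<close>, those supported in \<open>insert j J\<close> form
  a space of dimension at most one, so a single correction step with one relation nonzero at
  \<open>j\<close> suffices.\<close>

lemma relation_projection:
  fixes v :: "'i \<Rightarrow> 'a::complex_vector"
  assumes I: "finite I"
  obtains P :: "'i \<Rightarrow> 'i \<Rightarrow> complex"
    where "\<And>s t. s \<in> I \<Longrightarrow> t \<in> I \<Longrightarrow> P t s = cnj (P s t)"
    and "\<And>s. s \<in> I \<Longrightarrow> (\<Sum>t\<in>I. P s t *\<^sub>C v t) = v s"
    and "\<And>c t. (\<Sum>s\<in>I. c s *\<^sub>C v s) = 0 \<Longrightarrow> t \<in> I \<Longrightarrow> (\<Sum>s\<in>I. c s * P s t) = 0"
proof -
  have "\<exists>P. fixing_projection I v P \<and> (\<forall>c. (\<forall>s\<in>I - J. c s = 0) \<longrightarrow> (\<Sum>s\<in>I. c s *\<^sub>C v s) = 0 \<longrightarrow>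
     (\<forall>t\<in>I. (\<Sum>s\<in>I. c s * P s t) = 0))" if "finite J" "J \<subseteq> I" for J
    using that
  proof (induction J rule: finite_induct)
    case empty
    have "fixing_projection I v (\<lambda>s t. if s = t then 1 else 0)"
      using I by (auto simp: fixing_projection_def sum_delta_scale if_distrib[where f = "\<lambda>x. x * _"] cong: if_cong)
    then show ?case by (intro exI[of _ "\<lambda>s t. if s = t then 1 else 0"]) auto
  next
    case (insert j J)
    obtain P where P: "fixing_projection I v P" and kill: "\<And>c t. (\<forall>s\<in>I - J. c s = 0) \<Longrightarrow> (\<Sum>s\<in>I. c s *\<^sub>C v s) = 0 \<Longrightarrow>
        t \<in> I \<Longrightarrow> (\<Sum>s\<in>I. c s * P s t) = 0"
      using insert.IH insert.prems by auto
    show ?case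
    proof (cases "\<exists>c. (\<forall>s\<in>I - insert j J. c s = 0) \<and> (\<Sum>s\<in>I. c s *\<^sub>C v s) = 0 \<and> c j \<noteq> 0")
      case True
      then obtain c where c: "\<forall>s\<in>I - insert j J. c s = 0" "(\<Sum>s\<in>I. c s *\<^sub>C v s) = 0" "c j \<noteq> 0"
        by blast
      obtain Q where Q: "fixing_projection I v Q" "\<And>t. t \<in> I \<Longrightarrow> (\<Sum>s\<in>I. c s * Q s t) = 0"
        "\<And>b t. (\<And>t. t \<in> I \<Longrightarrow> (\<Sum>s\<in>I. b s * P s t) = 0) \<Longrightarrow> t \<in> I \<Longrightarrow> (\<Sum>s\<in>I. b s * Q s t) = 0"
        using fixing_projection_step[OF I P c(2)] by blast
      have "(\<Sum>s\<in>I. b s * Q s t) = 0"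
        if b: "\<forall>s\<in>I - insert j J. b s = 0" "(\<Sum>s\<in>I. b s *\<^sub>C v s) = 0" "t \<in> I" for b t
      proof -
        \<comment> \<open>Subtracting the multiple of \<open>c\<close> that cancels the coordinate
          \<open>j\<close> leaves a relation supported in \<open>J\<close>, to which the induction
          hypothesis applies.\<close>
        define e where "e s = b s - b j / c j * c s" for s
        have "e s = 0" if "s \<in> I - J" for s
          by (cases "s = j") (use b(1) c(1,3) that in \<open>auto simp: e_def\<close>)
        then have "\<forall>s\<in>I - J. e s = 0" by blast
        moreover have "(\<Sum>s\<in>I. e s *\<^sub>C v s) = 0"
        proof -
          have "(\<Sum>s\<in>I. e s *\<^sub>C v s) = (\<Sum>s\<in>I. b s *\<^sub>C v s) - (b j / c j) *\<^sub>C (\<Sum>s\<in>I. c s *\<^sub>C v s)"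
            by (simp add: e_def complex_vector.scale_left_diff_distrib sum_subtractf
                complex_vector.scale_sum_right scaleC_scaleC)
          then show ?thesis by (simp add: b c)
        qed
        ultimately have "(\<Sum>s\<in>I. e s * Q s t) = 0" by (intro Q(3) kill that)
        moreover have "(\<Sum>s\<in>I. b s * Q s t) = (\<Sum>s\<in>I. e s * Q s t) + b j / c j * (\<Sum>s\<in>I. c s * Q s t)"
          by (simp add: e_def left_diff_distrib sum_subtractf sum_distrib_left mult.assoc)
        ultimately show ?thesis using Q(2) that by simp
      qed
      then show ?thesis using Q(1) by blast
    next
      case False
      have "(\<Sum>s\<in>I. b s * P s t) = 0"
        if b: "\<forall>s\<in>I - insert j J. b s = 0" "(\<Sum>s\<in>I. b s *\<^sub>C v s) = 0" "t \<in> I" for b t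
      proof (rule kill[OF _ b(2,3)])
        show "\<forall>s\<in>I - J. b s = 0" using b False by auto
      qed
      then show ?thesis using P by blast
    qed
  qed
  from this[OF I order_refl] obtain P where "fixing_projection I v P" "\<And>c t. (\<Sum>s\<in>I. c s *\<^sub>C v s) = 0 \<Longrightarrow>
     t \<in> I \<Longrightarrow> (\<Sum>s\<in>I. c s * P s t) = 0"
    by auto
  then show ?thesis using that[of P] unfolding fixing_projection_def by blast
qed

text \<open>Relations indexed by positions rather than by vectors also force injectivity: equal
  vectors at two positions would satisfy the relation with coefficients 1 and -1.\<close>

lemma independent_familyI:
  fixes v :: "'i \<Rightarrow> 'a::complex_vector"
  assumes "\<And>F c s. finite F \<Longrightarrow> F \<subseteq> I \<Longrightarrow> (\<Sum>s\<in>F. c s *\<^sub>C v s) = 0 \<Longrightarrow> s \<in> F \<Longrightarrow> c s = 0"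
  shows "inj_on v I" "cindependent (v ` I)"
proof -
  show inj: "inj_on v I"
  proof (rule inj_onI, rule ccontr)
    fix s t assume st: "s \<in> I" "t \<in> I" "v s = v t" "s \<noteq> t"
    then have "(\<Sum>r\<in>{s, t}. (if r = s then 1 else -1) *\<^sub>C v r) = 0"
      by (simp add: complex_vector.scale_minus_left)
    from assms[OF _ _ this, of s] st show False by auto
  qed
  show "cindependent (v ` I)"
    unfolding complex_vector.independent_explicit_module
  proof (intro allI impI)
    fix T c w assume T: "finite T" "T \<subseteq> v ` I" "(\<Sum>w\<in>T. c w *\<^sub>C w) = 0" "w \<in> T"
    define F where "F = I \<inter> v -` T"
    have inj': "inj_on v F" using inj by (auto simp: F_def inj_on_def)
    have vF: "v ` F = T" using T(2) by (auto simp: F_def)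
    have "finite F" using T(1) vF inj' finite_imageD by metis
    moreover have "(\<Sum>s\<in>F. c (v s) *\<^sub>C v s) = 0"
      using T(3) unfolding vF[symmetric] by (simp add: sum.reindex[OF inj'])
    moreover obtain s where "s \<in> F" "v s = w" using T(4) vF by blast
    moreover have "F \<subseteq> I" by (simp add: F_def)
    ultimately show "c w = 0"
      using assms[of F "\<lambda>s. c (v s)" s] by simp
  qed
qed

section \<open>Schur's lemma\<close>

instance cstar_algebra \<subseteq> ring_1 ..

lemma mult_mat_index:
  assumes "A \<in> carrier_mat n k" "B \<in> carrier_mat k m" "i < n" "j < m"
  shows "(A * B) $$ (i, j) = (\<Sum>l<k. A $$ (i, l) * B $$ (l, j))"
  using assms by (auto simp: scalar_prod_def lessThan_atLeast0 intro!: sum.cong)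

lemma adj_carrier: "U \<in> carrier_mat n m \<Longrightarrow> adj U \<in> carrier_mat m n"
  by (auto simp: adj_def)

lemma adj_index: "U \<in> carrier_mat n m \<Longrightarrow> i < m \<Longrightarrow> j < n \<Longrightarrow> adj U $$ (i, j) = star (U $$ (j, i))"
  by (auto simp: adj_def)

lemma unitary_mat_iff:
  assumes U: "U \<in> carrier_mat n m"
  shows "unitary_mat U \<longleftrightarrow>
    (\<forall>j<m. \<forall>l<m. (\<Sum>k<n. star (U $$ (k, j)) * U $$ (k, l)) = (if j = l then 1 else 0)) \<and>
    (\<forall>i<n. \<forall>k<n. (\<Sum>j<m. U $$ (i, j) * star (U $$ (k, j))) = (if i = k then 1 else 0))"
proof -
  have 1: "(adj U * U) $$ (j, l) = (\<Sum>k<n. star (U $$ (k, j)) * U $$ (k, l))" if "j < m" "l < m" for j l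
    using that by (simp add: mult_mat_index[OF adj_carrier[OF U] U] adj_index[OF U])
  have 2: "(U * adj U) $$ (i, k) = (\<Sum>j<m. U $$ (i, j) * star (U $$ (k, j)))" if "i < n" "k < n" for i k
    using that by (simp add: mult_mat_index[OF U adj_carrier[OF U]] adj_index[OF U])
  have "unitary_mat U \<longleftrightarrow> (\<forall>j<m. \<forall>l<m. (adj U * U) $$ (j, l) = 1\<^sub>m m $$ (j, l)) \<and>
     (\<forall>i<n. \<forall>k<n. (U * adj U) $$ (i, k) = 1\<^sub>m n $$ (i, k))"
    unfolding unitary_mat_def mat_eq_iff using U adj_carrier[OF U] by simp
  then show ?thesis by (simp add: 1 2)
qed

lemma unitary_matD:
  assumes "unitary_mat U" "U \<in> carrier_mat n m"
  shows "j < m \<Longrightarrow> l < m \<Longrightarrow> (\<Sum>k<n. star (U $$ (k, j)) * U $$ (k, l)) = (if j = l then 1 else 0)"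
    and "i < n \<Longrightarrow> k < n \<Longrightarrow> (\<Sum>j<m. U $$ (i, j) * star (U $$ (k, j))) = (if i = k then 1 else 0)"
  using assms(1) unfolding unitary_mat_iff[OF assms(2)] by auto

text \<open>The matrix is a function of two indices, so that coordinates arising in a computation
  can be fed to Schur's lemma directly; \<open>Mor_iff\<close> translates to
  \<open>Mor\<close>.\<close>

definition intertwines :: "'a::cstar_algebra mat \<Rightarrow> 'a mat \<Rightarrow> (nat \<Rightarrow> nat \<Rightarrow> complex) \<Rightarrow> bool" where
  "intertwines U V T \<longleftrightarrow> (\<forall>i<dim_row U. \<forall>j<dim_row V.
     (\<Sum>k<dim_row U. T k j *\<^sub>C U $$ (i, k)) = (\<Sum>k<dim_row V. T i k *\<^sub>C V $$ (k, j)))"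

lemma amp_carrier: "T \<in> carrier_mat n m \<Longrightarrow> amp T \<in> carrier_mat n m"
  by (simp add: amp_def)

lemma mult_amp_index:
  fixes U :: "'a::star_algebra mat"
  assumes "U \<in> carrier_mat n k" "T \<in> carrier_mat k m" "i < n" "j < m"
  shows "(U * amp T) $$ (i, j) = (\<Sum>l<k. T $$ (l, j) *\<^sub>C U $$ (i, l))"
  using assms by (subst mult_mat_index[OF assms(1) amp_carrier])
    (auto intro!: sum.cong simp: amp_def scaleC_mult_right)

lemma amp_mult_index:
  fixes U :: "'a::star_algebra mat"
  assumes "T \<in> carrier_mat n k" "U \<in> carrier_mat k m" "i < n" "j < m"
  shows "(amp T * U) $$ (i, j) = (\<Sum>l<k. T $$ (i, l) *\<^sub>C U $$ (l, j))"
  using assms by (subst mult_mat_index[OF amp_carrier assms(2)])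
    (auto intro!: sum.cong simp: amp_def scaleC_mult_left)

lemma Mor_iff:
  assumes U: "U \<in> carrier_mat n n" and V: "V \<in> carrier_mat m m"
  shows "T \<in> Mor U V \<longleftrightarrow> T \<in> carrier_mat n m \<and> intertwines U V (\<lambda>i j. T $$ (i, j))"
proof -
  have [simp]: "dim_row U = n" "dim_row V = m" using U V by auto
  have "U * amp T = amp T * V \<longleftrightarrow> intertwines U V (\<lambda>i j. T $$ (i, j))"
    if T: "T \<in> carrier_mat n m"
  proof -
    have dims: "dim_row (U * amp T) = n" "dim_col (U * amp T) = m"
      "dim_row (amp T * V) = n" "dim_col (amp T * V) = m"
      using U V T by (auto simp: amp_def)
    show ?thesis
      unfolding mat_eq_iff intertwines_def dims
      by (simp add: mult_amp_index[OF U T] amp_mult_index[OF T V])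
  qed
  then show ?thesis by (auto simp: Mor_def)
qed

text \<open>Multiplying \<open>U T = T V\<close> by \<open>U\<^sup>*\<close> from the left and by
  \<open>V\<^sup>*\<close> from the right gives \<open>T V\<^sup>* = U\<^sup>* T\<close>; taking
  adjoints gives the claim.\<close>

lemma intertwines_adj:
  assumes U: "U \<in> carrier_mat n n" "unitary_mat U" and V: "V \<in> carrier_mat m m" "unitary_mat V"
    and T: "intertwines U V T"
  shows "intertwines V U (\<lambda>i j. cnj (T j i))"
proof -
  have [simp]: "dim_row U = n" "dim_row V = m" using U V by auto
  have "(\<Sum>k<m. cnj (T j k) *\<^sub>C V $$ (i, k)) = (\<Sum>k<n. cnj (T k i) *\<^sub>C U $$ (k, j))" if ij: "i < m" "j < n" for i j
  proof -
    have "(\<Sum>k<n. T k i *\<^sub>C star (U $$ (k, j)))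
        = (\<Sum>k<n. star (U $$ (k, j)) * (\<Sum>l<m. T k l *\<^sub>C (\<Sum>p<m. V $$ (l, p) * star (V $$ (i, p)))))"
      by (intro sum.cong refl)
        (simp add: unitary_matD(2)[OF V(2,1)] ij scaleC_mult_right if_distrib[where f = "\<lambda>x. _ *\<^sub>C x"] cong: if_cong)
    also have "\<dots> = (\<Sum>k<n. star (U $$ (k, j)) * (\<Sum>p<m. (\<Sum>l<m. T k l *\<^sub>C V $$ (l, p)) * star (V $$ (i, p))))"
      by (rule sum.cong[OF refl], rule arg_cong2[where f = "(*)", OF refl],
          simp only: complex_vector.scale_sum_right, subst sum.swap,
          simp add: sum_distrib_right scaleC_mult_left)
    also have "\<dots> = (\<Sum>k<n. star (U $$ (k, j)) * (\<Sum>p<m. (\<Sum>l<n. T l p *\<^sub>C U $$ (k, l)) * star (V $$ (i, p))))"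
      using T by (simp add: intertwines_def)
    also have "\<dots> = (\<Sum>p<m. (\<Sum>l<n. T l p *\<^sub>C (\<Sum>k<n. star (U $$ (k, j)) * U $$ (k, l))) * star (V $$ (i, p)))"
      by (simp only: sum_distrib_left, subst sum.swap, rule sum.cong[OF refl],
          simp only: sum_distrib_right complex_vector.scale_sum_right sum_distrib_left, subst sum.swap,
          simp only: scaleC_mult_left scaleC_mult_right mult.assoc)
    also have "\<dots> = (\<Sum>p<m. T j p *\<^sub>C star (V $$ (i, p)))"
      by (intro sum.cong refl)
        (simp add: unitary_matD(1)[OF U(2,1)] ij scaleC_mult_left if_distrib[where f = "\<lambda>x. _ *\<^sub>C x"] cong: if_cong)
    finally have "star (\<Sum>k<n. T k i *\<^sub>C star (U $$ (k, j))) = star (\<Sum>p<m. T j p *\<^sub>C star (V $$ (i, p)))"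
      by simp
    then show ?thesis by (simp add: star_sum star_scaleC star_star)
  qed
  then show ?thesis by (simp add: intertwines_def)
qed

lemma intertwines_compose:
  assumes T: "intertwines U V T" and R: "intertwines V W R"
  shows "intertwines U W (\<lambda>i j. \<Sum>k<dim_row V. T i k * R k j)"
  unfolding intertwines_def
proof (intro allI impI)
  fix i j assume ij: "i < dim_row U" "j < dim_row W"
  let ?n = "dim_row U" and ?m = "dim_row V" and ?l = "dim_row W"
  have "(\<Sum>k<?n. (\<Sum>p<?m. T k p * R p j) *\<^sub>C U $$ (i, k))
      = (\<Sum>p<?m. R p j *\<^sub>C (\<Sum>k<?n. T k p *\<^sub>C U $$ (i, k)))"
    by (simp only: complex_vector.scale_sum_left complex_vector.scale_sum_right,
        subst sum.swap, simp add: scaleC_scaleC mult.commute)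
  also have "\<dots> = (\<Sum>p<?m. R p j *\<^sub>C (\<Sum>q<?m. T i q *\<^sub>C V $$ (q, p)))"
    using T ij by (simp add: intertwines_def)
  also have "\<dots> = (\<Sum>q<?m. T i q *\<^sub>C (\<Sum>p<?m. R p j *\<^sub>C V $$ (q, p)))"
    by (simp only: complex_vector.scale_sum_right,
        subst sum.swap, simp add: scaleC_scaleC mult.commute)
  also have "\<dots> = (\<Sum>q<?m. T i q *\<^sub>C (\<Sum>r<?l. R q r *\<^sub>C W $$ (r, j)))"
    using R ij by (simp add: intertwines_def)
  also have "\<dots> = (\<Sum>r<?l. (\<Sum>q<?m. T i q * R q r) *\<^sub>C W $$ (r, j))"
    by (simp only: complex_vector.scale_sum_left complex_vector.scale_sum_right,
        subst sum.swap, simp add: scaleC_scaleC)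
  finally show "(\<Sum>k<?n. (\<Sum>p<?m. T k p * R p j) *\<^sub>C U $$ (i, k)) = (\<Sum>r<?l. (\<Sum>q<?m. T i q * R q r) *\<^sub>C W $$ (r, j))" .
qed

lemma irreducible_repD:
  assumes "irreducible_rep G U"
  shows "U \<in> carrier_mat (dim_row U) (dim_row U)" "square_mat U" "unitary_mat U" "0 < dim_row U"
    "unitary_rep G U"
  using assms by (auto simp: irreducible_rep_def unitary_rep_def)

lemma intertwines_irreducible:
  assumes U: "irreducible_rep G U" and T: "intertwines U U T"
  obtains c where "\<And>i j. i < dim_row U \<Longrightarrow> j < dim_row U \<Longrightarrow> T i j = (if i = j then c else 0)"
proof -
  let ?n = "dim_row U"
  let ?T = "mat ?n ?n (\<lambda>(i, j). T i j)"
  have "intertwines U U (\<lambda>i j. ?T $$ (i, j))"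
    using T by (auto simp: intertwines_def)
  then have "?T \<in> Mor U U" using Mor_iff[OF irreducible_repD(1)[OF U] irreducible_repD(1)[OF U], of ?T] by simp
  then obtain c where c: "?T = c \<cdot>\<^sub>m 1\<^sub>m ?n" using U by (auto simp: irreducible_rep_def)
  have "T i j = (if i = j then c else 0)" if "i < ?n" "j < ?n" for i j
  proof -
    have "T i j = ?T $$ (i, j)" using that by simp
    then show ?thesis unfolding c using that by simp
  qed
  then show ?thesis using that by blast
qed

text \<open>\<open>T T\<^sup>*\<close> and \<open>T\<^sup>* T\<close> intertwine irreducible
  representations with themselves, so they are scalars \<open>c\<close> and \<open>c'\<close>. The
  scalars agree and are positive because \<open>T\<close> is nonzero, and rescaling makes
  \<open>T\<close> unitary.\<close>

lemma intertwines_irreducible_unitary: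
  assumes U: "irreducible_rep G U" and V: "irreducible_rep G V" and T: "intertwines U V T"
    and nz: "i0 < dim_row U" "j0 < dim_row V" "T i0 j0 \<noteq> 0"
  shows "\<exists>R\<in>Mor U V. unitary_mat R"
proof -
  let ?n = "dim_row U" and ?m = "dim_row V"
  note T' = intertwines_adj[OF irreducible_repD(1,3)[OF U] irreducible_repD(1,3)[OF V] T]
  obtain c where c: "\<And>i j. i < ?n \<Longrightarrow> j < ?n \<Longrightarrow> (\<Sum>k<?m. T i k * cnj (T j k)) = (if i = j then c else 0)"
    using intertwines_irreducible[OF U intertwines_compose[OF T T']] by blast
  obtain c' where c': "\<And>i j. i < ?m \<Longrightarrow> j < ?m \<Longrightarrow> (\<Sum>k<?n. cnj (T k i) * T k j) = (if i = j then c' else 0)"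
    using intertwines_irreducible[OF V intertwines_compose[OF T' T]] by blast
  define r where "r = (\<Sum>k<?m. (cmod (T i0 k))\<^sup>2)"
  have r: "c = complex_of_real r"
    using c[OF nz(1) nz(1)] by (simp add: r_def complex_mult_cnj cmod_power2)
  have r0: "0 < r"
    unfolding r_def using nz by (intro sum_pos2[where i = j0]) auto
  \<comment> \<open>The entry of \<open>T T\<^sup>* T\<close> at the nonzero position, computed with
    both bracketings, shows \<open>c = c'\<close>.\<close>
  have "c * T i0 j0 = (\<Sum>l<?n. (\<Sum>k<?m. T i0 k * cnj (T l k)) * T l j0)"
    using nz by (simp add: c if_distrib[where f = "\<lambda>x. x * _"] cong: if_cong)
  also have "\<dots> = (\<Sum>k<?m. T i0 k * (\<Sum>l<?n. cnj (T l k) * T l j0))"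
    by (simp only: sum_distrib_left sum_distrib_right, subst sum.swap, simp add: mult.assoc)
  also have "\<dots> = T i0 j0 * c'"
    using nz by (simp add: c' if_distrib[where f = "\<lambda>x. _ * x"] cong: if_cong)
  finally have cc: "c' = c" using nz by simp
  define R where "R = mat ?n ?m (\<lambda>(i, j). T i j / sqrt r)"
  have R: "R \<in> carrier_mat ?n ?m" by (simp add: R_def)
  have sr: "complex_of_real (sqrt r) * complex_of_real (sqrt r) = c"
    using r0 by (simp add: r flip: of_real_mult)
  have c0: "c \<noteq> 0" using r0 r by simp
  have "intertwines U V (\<lambda>i j. R $$ (i, j))"
    unfolding intertwines_def
  proof (intro allI impI)
    fix i j assume ij: "i < ?n" "j < ?m"
    have "(\<Sum>k<?n. R $$ (k, j) *\<^sub>C U $$ (i, k)) = (1 / sqrt r) *\<^sub>C (\<Sum>k<?n. T k j *\<^sub>C U $$ (i, k))"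
      using ij by (simp add: R_def complex_vector.scale_sum_right scaleC_scaleC)
    also have "\<dots> = (1 / sqrt r) *\<^sub>C (\<Sum>k<?m. T i k *\<^sub>C V $$ (k, j))"
      using T ij by (simp add: intertwines_def)
    also have "\<dots> = (\<Sum>k<?m. R $$ (i, k) *\<^sub>C V $$ (k, j))"
      using ij by (simp add: R_def complex_vector.scale_sum_right scaleC_scaleC)
    finally show "(\<Sum>k<?n. R $$ (k, j) *\<^sub>C U $$ (i, k)) = (\<Sum>k<?m. R $$ (i, k) *\<^sub>C V $$ (k, j))" .
  qed
  then have "R \<in> Mor U V" using Mor_iff[OF irreducible_repD(1)[OF U] irreducible_repD(1)[OF V], of R] R by simp
  moreover have "unitary_mat R"
    unfolding unitary_mat_iff[OF R]
  proof (intro conjI allI impI)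
    fix j l assume jl: "j < ?m" "l < ?m"
    have "(\<Sum>k<?n. star (R $$ (k, j)) * R $$ (k, l)) = (\<Sum>k<?n. cnj (T k j) * T k l) / c"
      using jl by (simp add: R_def star_complex_def sr sum_divide_distrib)
    then show "(\<Sum>k<?n. star (R $$ (k, j)) * R $$ (k, l)) = (if j = l then 1 else 0)"
      using jl c0 by (simp add: c' cc)
  next
    fix i k assume ik: "i < ?n" "k < ?n"
    have "(\<Sum>j<?m. R $$ (i, j) * star (R $$ (k, j))) = (\<Sum>j<?m. T i j * cnj (T k j)) / c"
      using ik by (simp add: R_def star_complex_def sr sum_divide_distrib)
    then show "(\<Sum>j<?m. R $$ (i, j) * star (R $$ (k, j))) = (if i = k then 1 else 0)"
      using ik c0 by (simp add: c)
  qed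
  ultimately show ?thesis by blast
qed

section \<open>Unitary equivalence and the chosen representatives\<close>

lemma adj_mult:
  assumes "A \<in> carrier_mat n k" "B \<in> carrier_mat k m"
  shows "adj (A * B) = adj B * adj (A :: complex mat)"
proof (rule eq_matI)
  fix i j assume "i < dim_row (adj B * adj A)" "j < dim_col (adj B * adj A)"
  then have ij: "i < m" "j < n" using assms by (auto simp: adj_def)
  show "adj (A * B) $$ (i, j) = (adj B * adj A) $$ (i, j)"
    using ij by (simp add: adj_index[OF mult_carrier_mat[OF assms]] mult_mat_index[OF assms]
        mult_mat_index[OF adj_carrier[OF assms(2)] adj_carrier[OF assms(1)]] adj_index[OF assms(1)]
        adj_index[OF assms(2)] star_sum star_mult)
qed (use assms in \<open>auto simp: adj_def\<close>)

lemma unitary_mat_mult: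
  assumes A: "A \<in> carrier_mat n k" "unitary_mat A" and B: "B \<in> carrier_mat k m" "unitary_mat (B :: complex mat)"
  shows "unitary_mat (A * B)"
proof -
  note a = adj_carrier[OF A(1)] and b = adj_carrier[OF B(1)]
  have A': "adj A * A = 1\<^sub>m k" "A * adj A = 1\<^sub>m n" and B': "adj B * B = 1\<^sub>m m" "B * adj B = 1\<^sub>m k"
    using A B by (auto simp: unitary_mat_def)
  have "adj B * adj A * (A * B) = adj B * (adj A * A * B)"
    using assoc_mult_mat[OF b a, of "A * B" m] assoc_mult_mat[OF a A(1) B(1)] A(1) B(1) by simp
  moreover have "A * B * (adj B * adj A) = A * (B * adj B * adj A)"
    using assoc_mult_mat[OF A(1) B(1), of "adj B * adj A" n] assoc_mult_mat[OF B(1) b a] a b by simp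
  ultimately show ?thesis
    using A B a b A' B' by (simp add: unitary_mat_def adj_mult[OF A(1) B(1)])
qed

lemma intertwines_Mor_carrier:
  assumes "irreducible_rep G U" "irreducible_rep G V"
  shows "T \<in> Mor U V \<longleftrightarrow> T \<in> carrier_mat (dim_row U) (dim_row V) \<and> intertwines U V (\<lambda>i j. T $$ (i, j))"
  using Mor_iff[OF irreducible_repD(1)[OF assms(1)] irreducible_repD(1)[OF assms(2)]] .

lemma intertwines_cong:
  assumes "intertwines U V T" "\<And>i j. i < dim_row U \<Longrightarrow> j < dim_row V \<Longrightarrow> R i j = T i j"
  shows "intertwines U V R"
  using assms by (simp add: intertwines_def)

text \<open>The classes in \<open>Irred\<close> are a quotient; being an equivalence makes them
  nonempty, so that \<open>irrep\<close> picks a member, and lets a unitary intertwiner between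
  representatives identify two classes.\<close>

lemma equiv_rep_equiv: "equiv {U. irreducible_rep G U} (rep_equiv G)"
proof (rule equivI)
  show "rep_equiv G \<subseteq> {U. irreducible_rep G U} \<times> {U. irreducible_rep G U}"
    by (auto simp: rep_equiv_def)
  show "refl_on {U. irreducible_rep G U} (rep_equiv G)"
  proof (rule refl_onI)
    fix U assume "U \<in> {U. irreducible_rep G U}"
    then have U: "irreducible_rep G U" by simp
    have "1\<^sub>m (dim_row U) \<in> Mor U U"
      unfolding intertwines_Mor_carrier[OF U U] intertwines_def
      by (auto simp: if_distrib[where f = "\<lambda>x. x *\<^sub>C _"] cong: if_cong)
    moreover have "unitary_mat (1\<^sub>m (dim_row U) :: complex mat)"
      by (subst unitary_mat_iff[OF one_carrier_mat])
        (auto simp: star_complex_def if_distrib[where f = cnj] if_distrib[where f = "\<lambda>x. x * _"] cong: if_cong)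
    ultimately show "(U, U) \<in> rep_equiv G" using U by (auto simp: rep_equiv_def)
  qed
  show "sym (rep_equiv G)"
  proof (rule symI)
    fix U V assume "(U, V) \<in> rep_equiv G"
    then obtain T where U: "irreducible_rep G U" and V: "irreducible_rep G V" and T: "T \<in> Mor U V" "unitary_mat T"
      by (auto simp: rep_equiv_def)
    have Tc: "T \<in> carrier_mat (dim_row U) (dim_row V)" and Ti: "intertwines U V (\<lambda>i j. T $$ (i, j))"
      using T(1) unfolding intertwines_Mor_carrier[OF U V] by auto
    have "adj T \<in> Mor V U"
      unfolding intertwines_Mor_carrier[OF V U]
      using intertwines_adj[OF irreducible_repD(1,3)[OF U] irreducible_repD(1,3)[OF V] Ti] adj_carrier[OF Tc]
      by (auto elim!: intertwines_cong simp: adj_index[OF Tc] star_complex_def)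
    moreover have "unitary_mat (adj T)"
    proof -
      have "adj (adj T) = T" by (rule eq_matI) (auto simp: adj_def star_star)
      then show ?thesis using T(2) by (auto simp: unitary_mat_def adj_def)
    qed
    ultimately show "(V, U) \<in> rep_equiv G" using U V by (auto simp: rep_equiv_def)
  qed
  show "trans (rep_equiv G)"
  proof (rule transI)
    fix U V W assume "(U, V) \<in> rep_equiv G" "(V, W) \<in> rep_equiv G"
    then obtain T R where U: "irreducible_rep G U" and V: "irreducible_rep G V" and W: "irreducible_rep G W"
      and T: "T \<in> Mor U V" "unitary_mat T" and R: "R \<in> Mor V W" "unitary_mat R"
      by (auto simp: rep_equiv_def)
    have Tc: "T \<in> carrier_mat (dim_row U) (dim_row V)" and Ti: "intertwines U V (\<lambda>i j. T $$ (i, j))"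
      using T(1) unfolding intertwines_Mor_carrier[OF U V] by auto
    have Rc: "R \<in> carrier_mat (dim_row V) (dim_row W)" and Ri: "intertwines V W (\<lambda>i j. R $$ (i, j))"
      using R(1) unfolding intertwines_Mor_carrier[OF V W] by auto
    have "T * R \<in> Mor U W"
      unfolding intertwines_Mor_carrier[OF U W]
      using intertwines_compose[OF Ti Ri] mult_carrier_mat[OF Tc Rc]
      by (auto elim!: intertwines_cong simp: mult_mat_index[OF Tc Rc])
    then show "(U, W) \<in> rep_equiv G"
      using U W unitary_mat_mult[OF Tc T(2) Rc R(2)] by (auto simp: rep_equiv_def)
  qed
qed

lemma irrep_in: "x \<in> Irred G \<Longrightarrow> irrep x \<in> x"
  unfolding irrep_def Irred_def using in_quotient_imp_non_empty[OF equiv_rep_equiv] some_in_eq by metis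

lemma irreducible_irrep: "x \<in> Irred G \<Longrightarrow> irreducible_rep G (irrep x)"
  using irrep_in[of x G] in_quotient_imp_subset[OF equiv_rep_equiv, of x G] by (auto simp: Irred_def)

lemma Irred_eqI:
  assumes "x \<in> Irred G" "y \<in> Irred G" "T \<in> Mor (irrep x) (irrep y)" "unitary_mat T"
  shows "x = y"
proof (rule quotient_eqI[OF equiv_rep_equiv])
  show "(irrep x, irrep y) \<in> rep_equiv G"
    using assms irreducible_irrep by (auto simp: rep_equiv_def)
qed (use assms irrep_in in \<open>auto simp: Irred_def\<close>)

text \<open>A nonzero intertwiner can be rescaled to a unitary one, which would make the two classes
  equal; within one class irreducibility leaves only scalars.\<close>

lemma
  assumes "x \<in> Irred G" "y \<in> Irred G"
    and T: "\<And>i j. i < hdim x \<Longrightarrow> j < hdim y \<Longrightarrow>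
      (\<Sum>k<hdim x. T k j *\<^sub>C irrep x $$ (i, k)) = (\<Sum>k<hdim y. T i k *\<^sub>C irrep y $$ (k, j))"
  shows Schur_distinct: "x \<noteq> y \<Longrightarrow> i < hdim x \<Longrightarrow> j < hdim y \<Longrightarrow> T i j = 0"
    and Schur_equal: "x = y \<Longrightarrow> \<exists>c. \<forall>i<hdim x. \<forall>j<hdim x. T i j = (if i = j then c else 0)"
proof -
  have i: "intertwines (irrep x) (irrep y) T"
    using T by (simp add: intertwines_def hdim_def)
  note ir = irreducible_irrep[OF assms(1)] irreducible_irrep[OF assms(2)]
  show "T i j = 0" if "x \<noteq> y" "i < hdim x" "j < hdim y"
    using intertwines_irreducible_unitary[OF ir i] Irred_eqI[OF assms(1,2)] that by (auto simp: hdim_def)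
  show "\<exists>c. \<forall>i<hdim x. \<forall>j<hdim x. T i j = (if i = j then c else 0)" if "x = y"
  proof -
    from i that have "intertwines (irrep x) (irrep x) T" by simp
    from intertwines_irreducible[OF ir(1) this] show ?thesis unfolding hdim_def by metis
  qed
qed

definition coeff_index ::
    "('a::cstar_algebra, 'aa::cstar_algebra, 'aaa::cstar_algebra) quantum_group \<Rightarrow> ('a mat set \<times> nat \<times> nat) set" where
  "coeff_index G = {(x, i, j). x \<in> Irred G \<and> i < hdim x \<and> j < hdim x}"

text \<open>Sums over index triples suit the abstract linear algebra of families, nested sums the
  matrix calculations.\<close>

lemma sum_blocks:
  assumes "finite F"
  shows "finite {(x, i, j). x \<in> F \<and> i < n x \<and> j < m x}"
    and "(\<Sum>s\<in>{(x, i, j). x \<in> F \<and> i < n x \<and> j < m x}. f s) = (\<Sum>x\<in>F. \<Sum>i<n x. \<Sum>j<(m x :: nat). f (x, i :: nat, j))"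
proof -
  have "{(x, i, j). x \<in> F \<and> i < n x \<and> j < m x} = Sigma F (\<lambda>x. {..<n x} \<times> {..<m x})" by auto
  then show "finite {(x, i, j). x \<in> F \<and> i < n x \<and> j < m x}"
    "(\<Sum>s\<in>{(x, i, j). x \<in> F \<and> i < n x \<and> j < m x}. f s) = (\<Sum>x\<in>F. \<Sum>i<n x. \<Sum>j<m x. f (x, i, j))"
    using assms by (simp_all add: sum.Sigma[symmetric, where g = "\<lambda>x y. f (x, y)", simplified] sum.cartesian_product split_def)
qed

lemma sum_reverse3:
  fixes g :: "nat \<Rightarrow> nat \<Rightarrow> nat \<Rightarrow> 'b::comm_monoid_add"
  shows "(\<Sum>k<n. \<Sum>j<m. \<Sum>i<l. g i j k) = (\<Sum>i<l. \<Sum>j<m. \<Sum>k<n. g i j k)"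
proof -
  have "(\<Sum>k<n. \<Sum>j<m. \<Sum>i<l. g i j k) = (\<Sum>k<n. \<Sum>i<l. \<Sum>j<m. g i j k)"
    by (rule sum.cong[OF refl], rule sum.swap)
  also have "\<dots> = (\<Sum>i<l. \<Sum>j<m. \<Sum>k<n. g i j k)"
    by (subst sum.swap, rule sum.cong[OF refl], rule sum.swap)
  finally show ?thesis .
qed

section \<open>Matrix coefficients of irreducible representations\<close>

locale hopf_quantum_group =
  fixes G :: "('a::cstar_algebra, 'aa::cstar_algebra, 'aaa::cstar_algebra) quantum_group"
    and \<epsilon> :: "'a \<Rightarrow> complex" and S :: "'a \<Rightarrow> 'a"
  assumes cqg: "compact_quantum_group G" and hopf: "hopf_star_algebra G \<epsilon> S"
begin

abbreviation u :: "'a mat set \<Rightarrow> nat \<Rightarrow> nat \<Rightarrow> 'a" where "u x i j \<equiv> irrep x $$ (i, j)"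

lemma star_hom_emb: "star_hom (emb G)" and inj_emb: "inj (emb G)"
  using cqg by (simp_all add: compact_quantum_group_def min_tensor_def)

lemmas clinear_emb = star_homD(1)[OF star_hom_emb]

lemma star_hom_comult: "star_hom (comult G)"
  using cqg by (simp add: compact_quantum_group_def)

lemmas clinear_comult = star_homD(1)[OF star_hom_comult]

lemma clinear_counit: "clinear \<epsilon>" and clinear_antipode: "clinear S"
  using hopf by (simp_all add: hopf_star_algebra_def)

lemma carrier_u: "x \<in> Irred G \<Longrightarrow> irrep x \<in> carrier_mat (hdim x) (hdim x)"
  using irreducible_repD(1)[OF irreducible_irrep] by (simp add: hdim_def)

lemma unitary_u:
  assumes "x \<in> Irred G" "i < hdim x" "j < hdim x"
  shows "(\<Sum>k<hdim x. star (u x k i) * u x k j) = (if i = j then 1 else 0)"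
    and "(\<Sum>k<hdim x. u x i k * star (u x j k)) = (if i = j then 1 else 0)"
  using unitary_matD[OF irreducible_repD(3)[OF irreducible_irrep[OF assms(1)]] carrier_u[OF assms(1)]] assms(2,3)
  by auto

lemma comult_u:
  assumes "x \<in> Irred G" "i < hdim x" "j < hdim x"
  shows "comult G (u x i j) = emb G (\<Sum>k<hdim x. u x i k \<otimes>\<^sub>t u x k j)"
  using irreducible_repD(5)[OF irreducible_irrep[OF assms(1)]] assms(2,3)
  by (auto simp: unitary_rep_def hdim_def clinear_sum[OF clinear_emb])

lemma u_in_coeff: "x \<in> Irred G \<Longrightarrow> i < hdim x \<Longrightarrow> j < hdim x \<Longrightarrow> u x i j \<in> coeff_algebra G"
  unfolding coeff_algebra_def by (rule complex_vector.span_base) auto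

text \<open>The Hopf axioms on a matrix coefficient read \<open>\<epsilon>(U) U = U\<close> and
  \<open>S(U) U = \<epsilon>(U)\<close>. Since \<open>U\<close> is invertible with inverse
  \<open>U\<^sup>*\<close>, the first gives \<open>\<epsilon>(U) = 1\<close> and the second then
  \<open>S(U) = U\<^sup>*\<close>.\<close>

lemma counit_antipode_u:
  assumes x: "x \<in> Irred G" and ij: "i < hdim x" "j < hdim x"
  shows "\<epsilon> (u x i j) = (if i = j then 1 else 0)" and "S (u x i j) = star (u x j i)"
proof -
  let ?n = "hdim x"
  have b: "bilin id (\<lambda>b c. \<epsilon> b *\<^sub>C c)" "bilin id (\<lambda>b c. S b * c)"
    by (auto simp: bilin_def id_apply clinear_simps[OF clinear_counit] clinear_simps[OF clinear_antipode] scaleC_add_left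
        scaleC_add_right scaleC_scaleC scaleC_complex_def distrib_left distrib_right scaleC_mult_left scaleC_mult_right
        mult.commute)
  have *: "(\<Sum>k<?n. \<epsilon> (u x i k) *\<^sub>C u x k j) = u x i j"
    "(\<Sum>k<?n. S (u x i k) * u x k j) = \<epsilon> (u x i j) *\<^sub>C 1" if ij: "i < ?n" "j < ?n" for i j
  proof -
    obtain t where t: "emb G t = comult G (u x i j)" "tensor_lift (\<lambda>b c. \<epsilon> b *\<^sub>C c) t = u x i j"
      "tensor_lift (\<lambda>b c. S b * c) t = \<epsilon> (u x i j) *\<^sub>C 1"
      using hopf u_in_coeff[OF x ij] unfolding hopf_star_algebra_def by blast
    \<comment> \<open>The Hopf axiom provides merely some \<open>t\<close>; injectivity of
      \<open>emb\<close> identifies it with the matrix formula for the comultiplication.\<close>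
    have "t = (\<Sum>k<?n. u x i k \<otimes>\<^sub>t u x k j)"
      using t(1) comult_u[OF x ij] inj_emb by (simp add: inj_eq)
    then show "(\<Sum>k<?n. \<epsilon> (u x i k) *\<^sub>C u x k j) = u x i j"
      "(\<Sum>k<?n. S (u x i k) * u x k j) = \<epsilon> (u x i j) *\<^sub>C 1"
      using t(2,3) by (simp_all add: clinear_sum[OF tensor_lift_linear[OF b(1)]] tensor_lift_elem[OF b(1)]
          clinear_sum[OF tensor_lift_linear[OF b(2)]] tensor_lift_elem[OF b(2)])
  qed
  have \<epsilon>: "\<epsilon> (u x i j) = (if i = j then 1 else 0)" if ij: "i < ?n" "j < ?n" for i j
  proof -
    have "(\<Sum>l<?n. u x i l * star (u x j l)) = (\<Sum>l<?n. (\<Sum>k<?n. \<epsilon> (u x i k) *\<^sub>C u x k l) * star (u x j l))"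
      using ij by (simp add: *)
    also have "\<dots> = (\<Sum>k<?n. \<epsilon> (u x i k) *\<^sub>C (\<Sum>l<?n. u x k l * star (u x j l)))"
      by (simp only: sum_distrib_right complex_vector.scale_sum_right, subst sum.swap, simp add: scaleC_mult_left)
    also have "\<dots> = \<epsilon> (u x i j) *\<^sub>C 1"
      using ij by (simp add: unitary_u[OF x] if_distrib[where f = "\<lambda>y. _ *\<^sub>C y"] cong: if_cong)
    finally have "\<epsilon> (u x i j) *\<^sub>C 1 = (if i = j then 1 else 0) *\<^sub>C (1::'a)"
      using ij by (cases "i = j") (simp_all add: unitary_u[OF x])
    then show ?thesis by (simp only: complex_vector.scale_cancel_right) simp
  qed
  then show "\<epsilon> (u x i j) = (if i = j then 1 else 0)" using ij .
  have "star (u x j i) = (\<Sum>l<?n. (\<Sum>k<?n. S (u x i k) * u x k l) * star (u x j l))"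
    using ij by (simp add: * \<epsilon> if_distrib[where f = "\<lambda>x. x *\<^sub>C _"] if_distrib[where f = "\<lambda>x. x * _"] cong: if_cong)
  also have "\<dots> = (\<Sum>k<?n. S (u x i k) * (\<Sum>l<?n. u x k l * star (u x j l)))"
    by (simp only: sum_distrib_right sum_distrib_left, subst sum.swap, simp add: mult.assoc)
  also have "\<dots> = S (u x i j)"
    using ij by (simp add: unitary_u[OF x] if_distrib[where f = "\<lambda>y. _ * y"] cong: if_cong)
  finally show "S (u x i j) = star (u x j i)" by simp
qed

text \<open>The comultiplication of a relation is zero in the algebraic tensor square, and applying
  \<open>f\<close> to the first leg leaves another relation among the same coefficients, with
  coefficient row \<open>c f(U)\<close>.\<close>

lemma coefficient_relation_slice:
  assumes F: "finite F" "F \<subseteq> Irred G"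
    and c: "(\<Sum>x\<in>F. \<Sum>i<hdim x. \<Sum>j<hdim x. c x i j *\<^sub>C u x i j) = 0" and f: "clinear f"
  shows "(\<Sum>x\<in>F. \<Sum>k<hdim x. \<Sum>j<hdim x. (\<Sum>i<hdim x. c x i j * f (u x i k)) *\<^sub>C u x k j) = 0"
proof -
  have b: "bilin id (\<lambda>a b. f a *\<^sub>C b)"
    by (auto simp: bilin_def id_apply clinear_simps[OF f] scaleC_add_left
        scaleC_add_right scaleC_scaleC scaleC_complex_def mult.commute)
  let ?w = "\<Sum>x\<in>F. \<Sum>i<hdim x. \<Sum>j<hdim x. c x i j *\<^sub>C (\<Sum>k<hdim x. u x i k \<otimes>\<^sub>t u x k j)"
  have "emb G ?w = comult G (\<Sum>x\<in>F. \<Sum>i<hdim x. \<Sum>j<hdim x. c x i j *\<^sub>C u x i j)"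
    using F(2) by (auto simp: clinear_sum[OF clinear_comult] clinear_scale[OF clinear_comult] clinear_scale[OF clinear_emb]
        clinear_sum[OF clinear_emb] comult_u intro!: sum.cong)
  then have "emb G ?w = emb G 0"
    by (simp add: c clinear_0[OF clinear_comult] clinear_0[OF clinear_emb])
  then have "?w = 0" using inj_emb by (simp only: inj_eq)
  then have "tensor_lift (\<lambda>a b. f a *\<^sub>C b) ?w = 0"
    by (simp add: clinear_0[OF tensor_lift_linear[OF b]])
  moreover have "tensor_lift (\<lambda>a b. f a *\<^sub>C b) ?w =
      (\<Sum>x\<in>F. \<Sum>i<hdim x. \<Sum>j<hdim x. \<Sum>k<hdim x. (c x i j * f (u x i k)) *\<^sub>C u x k j)"
    by (simp add: clinear_sum[OF tensor_lift_linear[OF b]] clinear_scale[OF tensor_lift_linear[OF b]]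
        tensor_lift_elem[OF b] complex_vector.scale_sum_right scaleC_scaleC)
  moreover have "(\<Sum>x\<in>F. \<Sum>k<hdim x. \<Sum>j<hdim x. (\<Sum>i<hdim x. c x i j * f (u x i k)) *\<^sub>C u x k j) =
      (\<Sum>x\<in>F. \<Sum>i<hdim x. \<Sum>j<hdim x. \<Sum>k<hdim x. (c x i j * f (u x i k)) *\<^sub>C u x k j)"
    by (rule sum.cong[OF refl], simp only: complex_vector.scale_sum_left, rule sum_reverse3)
  ultimately show ?thesis by (simp only:)
qed

text \<open>The projection of \<open>relation_projection\<close> for the matrix coefficients commutes with left
  multiplication by the representations: applying the comultiplication to its relations gives
  \<open>(1 - P) U P = 0\<close>, and the antipode turns this into \<open>(1 - P) U\<^sup>* P = 0\<close>. So \<open>P\<close> is scalar in the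
  row indices by Schur's lemma, and \<open>P = 1\<close> because it fixes the coefficients. This is Burnside's
  theorem in the form of a double commutant argument.\<close>

lemma coefficients_independent_finite:
  assumes F: "finite F" "F \<subseteq> Irred G"
    and c: "(\<Sum>x\<in>F. \<Sum>i<hdim x. \<Sum>j<hdim x. c x i j *\<^sub>C u x i j) = 0"
    and xij: "x \<in> F" "i < hdim x" "j < hdim x"
  shows "c x i j = 0"
proof -
  define I where "I = {(x, i, j). x \<in> F \<and> i < hdim x \<and> j < hdim (x :: 'a mat set)}"
  have I: "finite I" unfolding I_def by (rule sum_blocks(1)[OF F(1)])
  have sumI: "(\<Sum>s\<in>I. f s) = (\<Sum>x\<in>F. \<Sum>i<hdim x. \<Sum>j<hdim x. f (x, i, j))" for f :: "_ \<Rightarrow> 'e::comm_monoid_add"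
    unfolding I_def by (rule sum_blocks(2)[OF F(1)])
  define v where "v = (\<lambda>(x, i, j). u x i j)"
  obtain P where herm: "\<And>s t. s \<in> I \<Longrightarrow> t \<in> I \<Longrightarrow> P t s = cnj (P s t)"
    and Pv: "\<And>s. s \<in> I \<Longrightarrow> (\<Sum>t\<in>I. P s t *\<^sub>C v t) = v s"
    and kill: "\<And>c t. (\<Sum>s\<in>I. c s *\<^sub>C v s) = 0 \<Longrightarrow> t \<in> I \<Longrightarrow> (\<Sum>s\<in>I. c s * P s t) = 0"
    using relation_projection[OF I, of v] by blast
  \<comment> \<open>In matrix notation this is \<open>c U P = 0\<close>, with \<open>U\<close>
    acting on the row index of each triple: for every functional \<open>f\<close> the row
    \<open>c f(U)\<close> is again a relation and is killed by \<open>P\<close>.\<close>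
  have K: "(\<Sum>x\<in>F. \<Sum>i<hdim x. \<Sum>j<hdim x. c (x, i, j) *\<^sub>C (\<Sum>k<hdim x. P (x, k, j) t *\<^sub>C u x i k)) = 0"
    if rel: "(\<Sum>s\<in>I. c s *\<^sub>C v s) = 0" and t: "t \<in> I" for c t
  proof (rule functional_separates)
    fix f :: "'a \<Rightarrow> complex" assume f: "clinear f"
    have "(\<Sum>x\<in>F. \<Sum>i<hdim x. \<Sum>j<hdim x. c (x, i, j) *\<^sub>C u x i j) = 0"
      using rel by (simp add: sumI v_def)
    from coefficient_relation_slice[OF F this f]
    have "(\<Sum>s\<in>I. (case s of (x, k, j) \<Rightarrow> \<Sum>i<hdim x. c (x, i, j) * f (u x i k)) *\<^sub>C v s) = 0"
      by (simp add: sumI v_def)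
    from kill[OF this t]
    have 0: "(\<Sum>x\<in>F. \<Sum>k<hdim x. \<Sum>j<hdim x. (\<Sum>i<hdim x. c (x, i, j) * f (u x i k)) * P (x, k, j) t) = 0"
      by (simp add: sumI)
    have "f (\<Sum>x\<in>F. \<Sum>i<hdim x. \<Sum>j<hdim x. c (x, i, j) *\<^sub>C (\<Sum>k<hdim x. P (x, k, j) t *\<^sub>C u x i k))
      = (\<Sum>x\<in>F. \<Sum>i<hdim x. \<Sum>j<hdim x. \<Sum>k<hdim x. c (x, i, j) * f (u x i k) * P (x, k, j) t)"
      by (simp add: clinear_sum[OF f] clinear_scale[OF f] scaleC_complex_def sum_distrib_left ac_simps)
    also have "\<dots> = (\<Sum>x\<in>F. \<Sum>k<hdim x. \<Sum>j<hdim x. (\<Sum>i<hdim x. c (x, i, j) * f (u x i k)) * P (x, k, j) t)"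
      by (rule sum.cong[OF refl], simp only: sum_distrib_right, rule sum_reverse3[symmetric])
    also note 0
    finally show "f (\<Sum>x\<in>F. \<Sum>i<hdim x. \<Sum>j<hdim x. c (x, i, j) *\<^sub>C (\<Sum>k<hdim x. P (x, k, j) t *\<^sub>C u x i k)) = 0" .
  qed
  \<comment> \<open>The rows of \<open>1 - P\<close> are relations because \<open>P\<close> fixes
    \<open>v\<close>.\<close>
  have row: "(\<Sum>s\<in>I. ((if s0 = s then 1 else 0) - P s0 s) *\<^sub>C v s) = 0" if "s0 \<in> I" for s0
    using that I by (simp add: complex_vector.scale_left_diff_distrib sum_subtractf Pv sum_delta_scale)
  have delta: "(\<Sum>x\<in>F. \<Sum>i<hdim x. \<Sum>j<hdim x. (if s0 = (x, i, j) then 1 else 0) *\<^sub>C f x i j)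
      = (case s0 of (x, i, j) \<Rightarrow> f x i j)" if "s0 \<in> I" for s0 and f :: "_ \<Rightarrow> _ \<Rightarrow> _ \<Rightarrow> 'a"
    using sum_delta_scale(1)[OF I that, of "\<lambda>(x, i, j). f x i j"] by (simp add: sumI)
  \<comment> \<open>For \<open>c\<close> a row of \<open>1 - P\<close> this gives
    \<open>P U P = U P\<close>. The linear map \<open>g\<close> is applied entrywise in order to use
    both the identity and the antipode.\<close>
  have E1: "(\<Sum>x\<in>F. \<Sum>i<hdim x. \<Sum>j<hdim x. P s0 (x, i, j) *\<^sub>C (\<Sum>k<hdim x. P (x, k, j) t *\<^sub>C g (u x i k)))
     = (case s0 of (x, i, j) \<Rightarrow> (\<Sum>k<hdim x. P (x, k, j) t *\<^sub>C g (u x i k)))"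
    if s0: "s0 \<in> I" and t: "t \<in> I" and g: "clinear g" for s0 t and g :: "'a \<Rightarrow> 'a"
  proof -
    have "g (\<Sum>x\<in>F. \<Sum>i<hdim x. \<Sum>j<hdim x. ((if s0 = (x, i, j) then 1 else 0) - P s0 (x, i, j)) *\<^sub>C
        (\<Sum>k<hdim x. P (x, k, j) t *\<^sub>C u x i k)) = 0"
      by (simp only: K[OF row[OF s0] t] clinear_0[OF g])
    then show ?thesis
      by (simp add: clinear_sum[OF g] clinear_scale[OF g] clinear_diff[OF g]
          complex_vector.scale_left_diff_distrib sum_subtractf delta[OF s0])
        (cases s0, simp add: clinear_sum[OF g] clinear_scale[OF g])
  qed
  \<comment> \<open>The antipode version of \<open>E1\<close> is
    \<open>P U\<^sup>* P = U\<^sup>* P\<close>. Its adjoint, with \<open>P\<close> hermitian, is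
    \<open>P U P = P U\<close>.\<close>
  have E2: "(\<Sum>x\<in>F. \<Sum>k<hdim x. \<Sum>j<hdim x. P t (x, k, j) *\<^sub>C (\<Sum>i<hdim x. P (x, i, j) (y, l, m) *\<^sub>C u x k i))
     = (\<Sum>k<hdim y. P t (y, k, m) *\<^sub>C u y k l)"
    if s0: "(y, l, m) \<in> I" and t: "t \<in> I" for y l m t
  proof -
    have FI: "x \<in> Irred G" if "x \<in> F" for x using F(2) that by auto
    have y: "y \<in> Irred G" "l < hdim y" using s0 FI by (auto simp: I_def)
    have "(\<Sum>x\<in>F. \<Sum>i<hdim x. \<Sum>j<hdim x. P (y, l, m) (x, i, j) *\<^sub>C (\<Sum>k<hdim x. P (x, k, j) t *\<^sub>C star (u x k i)))
      = (\<Sum>k<hdim y. P (y, k, m) t *\<^sub>C star (u y k l))"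
      using E1[OF s0 t clinear_antipode] y FI by (simp add: counit_antipode_u)
    then have "star (\<Sum>x\<in>F. \<Sum>i<hdim x. \<Sum>j<hdim x. P (y, l, m) (x, i, j) *\<^sub>C (\<Sum>k<hdim x. P (x, k, j) t *\<^sub>C star (u x k i)))
      = star (\<Sum>k<hdim y. P (y, k, m) t *\<^sub>C star (u y k l))" by (rule arg_cong)
    then have "(\<Sum>x\<in>F. \<Sum>i<hdim x. \<Sum>j<hdim x. cnj (P (y, l, m) (x, i, j)) *\<^sub>C (\<Sum>k<hdim x. cnj (P (x, k, j) t) *\<^sub>C u x k i))
      = (\<Sum>k<hdim y. cnj (P (y, k, m) t) *\<^sub>C u y k l)"
      by (simp add: star_sum star_scaleC star_star)
    moreover have "cnj (P (x, k, j) t) = P t (x, k, j)" if "x \<in> F" "k < hdim x" "j < hdim x" for x k j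
      using herm[OF _ t, of "(x, k, j)"] that by (simp add: I_def)
    moreover have "cnj (P (y, l, m) (x, k, j)) = P (x, k, j) (y, l, m)" if "x \<in> F" "k < hdim x" "j < hdim x" for x k j
      using herm[OF s0, of "(x, k, j)"] that by (simp add: I_def)
    ultimately have e: "(\<Sum>x\<in>F. \<Sum>i<hdim x. \<Sum>j<hdim x. P (x, i, j) (y, l, m) *\<^sub>C (\<Sum>k<hdim x. P t (x, k, j) *\<^sub>C u x k i))
      = (\<Sum>k<hdim y. P t (y, k, m) *\<^sub>C u y k l)"
      using s0 by (simp add: I_def)
    have sw: "(\<Sum>i<n. \<Sum>j<n. p i j *\<^sub>C (\<Sum>k<n. q k j *\<^sub>C w k i)) = (\<Sum>k<n. \<Sum>j<n. q k j *\<^sub>C (\<Sum>i<n. p i j *\<^sub>C w k i))"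
      for n :: nat and p q and w :: "nat \<Rightarrow> nat \<Rightarrow> 'a"
    proof -
      have "(\<Sum>i<n. \<Sum>j<n. p i j *\<^sub>C (\<Sum>k<n. q k j *\<^sub>C w k i)) = (\<Sum>i<n. \<Sum>j<n. \<Sum>k<n. (p i j * q k j) *\<^sub>C w k i)"
        by (simp only: complex_vector.scale_sum_right scaleC_scaleC)
      also have "\<dots> = (\<Sum>k<n. \<Sum>j<n. \<Sum>i<n. (q k j * p i j) *\<^sub>C w k i)"
        by (subst sum_reverse3) (simp only: mult.commute)
      also have "\<dots> = (\<Sum>k<n. \<Sum>j<n. q k j *\<^sub>C (\<Sum>i<n. p i j *\<^sub>C w k i))"
        by (simp only: complex_vector.scale_sum_right scaleC_scaleC)
      finally show ?thesis .
    qed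
    show ?thesis
      by (rule trans[OF _ e], rule sum.cong[OF refl], rule sw[symmetric])
  qed
  \<comment> \<open>Comparing the two identities gives \<open>U P = P U\<close>: for fixed column
    indices \<open>j\<close> and \<open>m\<close>, the entries of \<open>P\<close> intertwine
    \<open>irrep x\<close> and \<open>irrep y\<close>.\<close>
  have T: "(\<Sum>k<hdim x. P (x, k, j) (y, l, m) *\<^sub>C u x i k) = (\<Sum>k<hdim y. P (x, i, j) (y, k, m) *\<^sub>C u y k l)"
    if s: "(x, i, j) \<in> I" and t: "(y, l, m) \<in> I" for x i j y l m
    using E1[OF s t clinear_id(2)] E2[OF t s] by simp
  have P1: "P (x, i, j) (y, l, m) = 0" if s: "(x, i, j) \<in> I" and t: "(y, l, m) \<in> I" and xy: "x \<noteq> y" for x i j y l m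
    using s t F(2) Schur_distinct[of x G y "\<lambda>i l. P (x, i, j) (y, l, m)" i l] T xy by (auto simp: I_def)
  have P2: "\<exists>p. \<forall>i<hdim x. \<forall>l<hdim x. P (x, i, j) (x, l, m) = (if i = l then p else 0)"
    if "x \<in> F" "j < hdim x" "m < hdim x" for x j m
  proof (rule Schur_equal[of x G x "\<lambda>i l. P (x, i, j) (x, l, m)"])
    show "(\<Sum>k<hdim x. P (x, k, j) (x, l, m) *\<^sub>C u x i k) = (\<Sum>k<hdim x. P (x, i, j) (x, k, m) *\<^sub>C u x k l)"
      if "i < hdim x" "l < hdim x" for i l
      using T[of x i j x l m] that \<open>x \<in> F\<close> \<open>j < hdim x\<close> \<open>m < hdim x\<close> by (simp add: I_def)
  qed (use that F(2) in auto)
  have P3: "P (x, i, j) (y, l, m) = (if (x, i, j) = (y, l, m) then 1 else 0)" if s: "(x, i, j) \<in> I" and t: "(y, l, m) \<in> I" for x i j y l m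
  proof (cases "x = y")
    case True
    have x: "x \<in> F" "x \<in> Irred G" "i < hdim x" "j < hdim x" "l < hdim x" "m < hdim x"
      using s t True F(2) by (auto simp: I_def)
    obtain p where p: "\<And>m i l. m < hdim x \<Longrightarrow> i < hdim x \<Longrightarrow> l < hdim x \<Longrightarrow> P (x, i, j) (x, l, m) = (if i = l then p m else 0)"
      using P2[OF x(1,4)] by metis
    \<comment> \<open>After Schur's lemma only the numbers \<open>p m\<close> remain. That
      \<open>P\<close> fixes the coefficients is now a relation within a single row of
      \<open>irrep x\<close>, which unitarity solves for \<open>p\<close>.\<close>
    have fix_u: "(\<Sum>m<hdim x. p m *\<^sub>C u x i m) = u x i j" if i: "i < hdim x" for i
    proof -
      have s: "(x, i, j) \<in> I" using x i by (simp add: I_def)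
      have "u x i j = (\<Sum>y\<in>F. \<Sum>l<hdim y. \<Sum>m<hdim y. P (x, i, j) (y, l, m) *\<^sub>C u y l m)"
        using Pv[OF s] by (simp add: sumI v_def)
      also have "\<dots> = (\<Sum>y\<in>F. if x = y then (\<Sum>l<hdim y. \<Sum>m<hdim y. P (x, i, j) (y, l, m) *\<^sub>C u y l m) else 0)"
        using P1[OF s] by (auto simp: I_def intro!: sum.cong sum.neutral)
      also have "\<dots> = (\<Sum>l<hdim x. \<Sum>m<hdim x. P (x, i, j) (x, l, m) *\<^sub>C u x l m)"
        using F(1) x(1) by simp
      also have "\<dots> = (\<Sum>l<hdim x. if i = l then (\<Sum>m<hdim x. p m *\<^sub>C u x l m) else 0)"
        by (rule sum.cong[OF refl]) (use p i in \<open>simp cong: sum.cong_simp\<close>)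
      also have "\<dots> = (\<Sum>m<hdim x. p m *\<^sub>C u x i m)" using i by simp
      finally show ?thesis by simp
    qed
    have "p m = (if m = j then 1 else 0)"
    proof -
      have "(\<Sum>i<hdim x. star (u x i m) * (\<Sum>l<hdim x. p l *\<^sub>C u x i l))
        = (\<Sum>l<hdim x. p l *\<^sub>C (\<Sum>i<hdim x. star (u x i m) * u x i l))"
        by (simp only: sum_distrib_left complex_vector.scale_sum_right, subst sum.swap, simp only: scaleC_mult_right)
      also have "\<dots> = p m *\<^sub>C 1"
        using x by (simp add: unitary_u if_distrib[where f = "\<lambda>y. _ *\<^sub>C y"] cong: if_cong)
      finally have "p m *\<^sub>C (1::'a) = (\<Sum>i<hdim x. star (u x i m) * u x i j)"
        using fix_u by simp
      also have "\<dots> = (if m = j then 1 else 0) *\<^sub>C 1" using x by (simp add: unitary_u)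
      finally show ?thesis by (simp only: complex_vector.scale_cancel_right) simp
    qed
    then show ?thesis using p x True by auto
  next
    case False
    then show ?thesis using P1[OF s t] by auto
  qed
  have s: "(x, i, j) \<in> I" using xij by (simp add: I_def)
  have "(\<Sum>s\<in>I. (case s of (x, i, j) \<Rightarrow> c x i j) * P s (x, i, j)) = 0"
    by (rule kill[OF _ s]) (use c in \<open>simp add: sumI v_def\<close>)
  also have "(\<Sum>s\<in>I. (case s of (x, i, j) \<Rightarrow> c x i j) * P s (x, i, j)) =
      (\<Sum>s\<in>I. if s = (x, i, j) then c x i j else 0)"
  proof (rule sum.cong[OF refl])
    fix t assume t: "t \<in> I"
    obtain y l m where y: "t = (y, l, m)" by (cases t)
    show "(case t of (x, i, j) \<Rightarrow> c x i j) * P t (x, i, j) = (if t = (x, i, j) then c x i j else 0)"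
      using P3[OF t[unfolded y] s] unfolding y by simp
  qed
  finally show ?thesis using I s by simp
qed

end

section \<open>Complete reducibility\<close>

lemma div_mod_less_mult: "p < n * m \<Longrightarrow> p div m < n" "p < n * m \<Longrightarrow> p mod m < (m::nat)"
  by (auto simp: less_mult_imp_div_less intro!: mod_less_divisor gr0I)

lemma sum_div_mod:
  "(\<Sum>p<n * m. f (p div m) (p mod m)) = (\<Sum>i<n. \<Sum>k<m. f i k)"
  for f :: "nat \<Rightarrow> nat \<Rightarrow> 'b::comm_monoid_add"
proof -
  have "(\<Sum>p<n * m. f (p div m) (p mod m)) = (\<Sum>(i, k)\<in>{..<n} \<times> {..<m}. f i k)"
  proof (rule sum.reindex_bij_witness[where j = "\<lambda>p. (p div m, p mod m)" and i = "\<lambda>(i, k). i * m + k"])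
    fix a assume "a \<in> {..<n} \<times> {..<m}"
    then obtain i k where a: "a = (i, k)" "i < n" "k < m" by auto
    have "Suc i * m \<le> n * m" using a by (intro mult_right_mono) auto
    then show "(case a of (i, k) \<Rightarrow> i * m + k) \<in> {..<n * m}" using a by auto
    show "((case a of (i, k) \<Rightarrow> i * m + k) div m, (case a of (i, k) \<Rightarrow> i * m + k) mod m) = a"
      using a by auto
  qed (auto simp: div_mod_less_mult)
  then show ?thesis by (simp add: sum.cartesian_product)
qed

lemma kron_carrier: "U \<in> carrier_mat a b \<Longrightarrow> V \<in> carrier_mat c d \<Longrightarrow> kron U V \<in> carrier_mat (a * c) (b * d)"
  by (auto simp: kron_def)

lemma kron_index:
  assumes "U \<in> carrier_mat a b" "V \<in> carrier_mat c d" "p < a * c" "q < b * d"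
  shows "kron U V $$ (p, q) = U $$ (p div c, q div d) * V $$ (p mod c, q mod d)"
  using assms by (auto simp: kron_def)

lemma kron_one_right: "kron U (1\<^sub>m 1) = (U :: 'a::star_algebra mat)"
  by (rule eq_matI) (auto simp: kron_def)

lemma tensor_rep_simps:
  "tensor_rep [x] = irrep x" "tensor_rep [x, y] = kron (irrep x) (irrep y)"
  by (simp_all add: tensor_rep_def kron_one_right[simplified])

context hopf_quantum_group
begin

text \<open>A relation over an arbitrary finite set of index triples is padded with zero
  coefficients to full matrix blocks, where the finite version applies.\<close>

lemma coefficients_independent:
  "inj_on (\<lambda>(x, i, j). u x i j) (coeff_index G)" "cindependent ((\<lambda>(x, i, j). u x i j) ` coeff_index G)"
proof -
  have *: "c s = 0" if F: "finite F" "F \<subseteq> coeff_index G" "(\<Sum>s\<in>F. c s *\<^sub>C (case s of (x, i, j) \<Rightarrow> u x i j)) = 0"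
    and s: "s \<in> F" for F c s
  proof -
    define B where "B = fst ` F"
    have B: "finite B" "B \<subseteq> Irred G" using F by (auto simp: B_def coeff_index_def)
    define I where "I = {(x, i, j). x \<in> B \<and> i < hdim x \<and> j < hdim (x :: 'a mat set)}"
    have FI: "F \<subseteq> I" using F(2) by (force simp: I_def B_def coeff_index_def)
    have "(\<Sum>s\<in>I. (if s \<in> F then c s else 0) *\<^sub>C (case s of (x, i, j) \<Rightarrow> u x i j)) =
        (\<Sum>s\<in>F. (if s \<in> F then c s else 0) *\<^sub>C (case s of (x, i, j) \<Rightarrow> u x i j))"
      unfolding I_def by (rule sum.mono_neutral_right[OF sum_blocks(1)[OF B(1)] FI[unfolded I_def]]) auto
    also have "\<dots> = 0" using F(3) by simp
    finally have 0: "(\<Sum>s\<in>I. (if s \<in> F then c s else 0) *\<^sub>C (case s of (x, i, j) \<Rightarrow> u x i j)) = 0" .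
    have 0: "(\<Sum>x\<in>B. \<Sum>i<hdim x. \<Sum>j<hdim x. (if (x, i, j) \<in> F then c (x, i, j) else 0) *\<^sub>C u x i j) = 0"
      using 0[unfolded I_def sum_blocks(2)[OF B(1)]] by simp
    obtain x i j where sx: "s = (x, i, j)" "x \<in> B" "i < hdim x" "j < hdim x"
      using s FI by (auto simp: I_def)
    show ?thesis using coefficients_independent_finite[OF B 0 sx(2-4)] s sx(1) by simp
  qed
  show "inj_on (\<lambda>(x, i, j). u x i j) (coeff_index G)" "cindependent ((\<lambda>(x, i, j). u x i j) ` coeff_index G)"
    by (rule independent_familyI, rule *, assumption+)+
qed

lemma coefficient_extend:
  obtains f where "clinear f" "\<And>x i j. x \<in> Irred G \<Longrightarrow> i < hdim x \<Longrightarrow> j < hdim x \<Longrightarrow> f (u x i j) = g x i j"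
proof -
  obtain f where f: "clinear f" "\<And>s. s \<in> coeff_index G \<Longrightarrow> f (case s of (x, i, j) \<Rightarrow> u x i j) = (case s of (x, i, j) \<Rightarrow> g x i j)"
    using clinear_extend[OF coefficients_independent] by blast
  show ?thesis
    by (rule that[OF f(1)]) (use f(2) in \<open>force simp: coeff_index_def\<close>)
qed

lemma clinear_eq_on_coeff:
  assumes "clinear f" "clinear g" "a \<in> coeff_algebra G"
    and "\<And>x i j. x \<in> Irred G \<Longrightarrow> i < hdim x \<Longrightarrow> j < hdim x \<Longrightarrow> f (u x i j) = g (u x i j)"
  shows "f a = g a"
  by (rule clinear_eq_on_span[OF assms(1,2) assms(3)[unfolded coeff_algebra_def]]) (use assms(4) in auto)

text \<open>A linear \<open>\<Delta>\<close> with values in the algebraic tensor square lets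
  coaction identities be stated without \<open>emb\<close>; it is tied to \<open>comult\<close> on
  the coefficient algebra only.\<close>

lemma algebraic_comult:
  obtains \<Delta> where "clinear \<Delta>"
    and "\<And>x i j. x \<in> Irred G \<Longrightarrow> i < hdim x \<Longrightarrow> j < hdim x \<Longrightarrow> \<Delta> (u x i j) = (\<Sum>k<hdim x. u x i k \<otimes>\<^sub>t u x k j)"
    and "\<And>a. a \<in> coeff_algebra G \<Longrightarrow> emb G (\<Delta> a) = comult G a"
proof -
  obtain \<Delta> where D: "clinear \<Delta>"
    "\<And>x i j. x \<in> Irred G \<Longrightarrow> i < hdim x \<Longrightarrow> j < hdim x \<Longrightarrow> \<Delta> (u x i j) = (\<Sum>k<hdim x. u x i k \<otimes>\<^sub>t u x k j)"
    using coefficient_extend[of "\<lambda>x i j. \<Sum>k<hdim x. u x i k \<otimes>\<^sub>t u x k j"] by blast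
  moreover have "emb G (\<Delta> a) = comult G a" if "a \<in> coeff_algebra G" for a
    by (rule clinear_eq_on_coeff[OF clinear_compose[OF clinear_emb D(1)] clinear_comult that])
      (simp add: D comult_u)
  ultimately show ?thesis using that by blast
qed

text \<open>The expansion is asserted for every finite \<open>F\<close> above some \<open>B\<close>:
  elements can then be added during the induction, and finitely many elements can later be expanded
  over one common set of blocks.\<close>

lemma coordinate_expansion:
  assumes e: "\<And>x a b. clinear (e x a b)"
    "\<And>x a b y i j. y \<in> Irred G \<Longrightarrow> i < hdim y \<Longrightarrow> j < hdim y \<Longrightarrow> e x a b (u y i j) = (if (x, a, b) = (y, i, j) then 1 else 0)"
    and v: "v \<in> coeff_algebra G"
  shows "\<exists>B. finite B \<and> B \<subseteq> Irred G \<and> (\<forall>F. finite F \<longrightarrow> F \<subseteq> Irred G \<longrightarrow> B \<subseteq> F \<longrightarrow>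
     v = (\<Sum>x\<in>F. \<Sum>a<hdim x. \<Sum>b<hdim x. e x a b v *\<^sub>C u x a b))"
    using v unfolding coeff_algebra_def
  proof (induction rule: complex_vector.span_induct_alt)
    case base
    show ?case by (intro exI[of _ "{}"]) (auto simp: clinear_0[OF e(1)])
  next
    case (step c w v)
    then obtain y i j where w: "w = u y i j" "y \<in> Irred G" "i < hdim y" "j < hdim y" by auto
    obtain B where B: "finite B" "B \<subseteq> Irred G" "\<And>F. finite F \<Longrightarrow> F \<subseteq> Irred G \<Longrightarrow> B \<subseteq> F \<Longrightarrow>
      v = (\<Sum>x\<in>F. \<Sum>a<hdim x. \<Sum>b<hdim x. e x a b v *\<^sub>C u x a b)"
      using step.IH by blast
    have "c *\<^sub>C w + v = (\<Sum>x\<in>F. \<Sum>a<hdim x. \<Sum>b<hdim x. e x a b (c *\<^sub>C w + v) *\<^sub>C u x a b)"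
      if F: "finite F" "F \<subseteq> Irred G" "insert y B \<subseteq> F" for F
    proof -
      have "(\<Sum>b<hdim x. e x a b w *\<^sub>C u x a b) = (if x = y \<and> a = i then w else 0)" for x a
      proof (cases "x = y \<and> a = i")
        case True
        then show ?thesis using w(4) unfolding w(1)
          by (simp add: e(2)[OF w(2-4)] if_distrib[where f = "\<lambda>c. c *\<^sub>C _"] cong: if_cong)
      next
        case False
        then have "(x, a, b) \<noteq> (y, i, j)" for b by blast
        then have "e x a b w = 0" for b unfolding w(1) e(2)[OF w(2-4)] by (simp only: if_False)
        then show ?thesis using False by (simp del: de_Morgan_conj)
      qed
      then have "(\<Sum>a<hdim x. \<Sum>b<hdim x. e x a b w *\<^sub>C u x a b) = (if x = y then w else 0)" for x
        using w(3) by (cases "x = y") simp_all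
      then have "(\<Sum>x\<in>F. \<Sum>a<hdim x. \<Sum>b<hdim x. e x a b w *\<^sub>C u x a b) = (\<Sum>x\<in>F. if x = y then w else 0)"
        by simp
      also have "\<dots> = w" using F by simp
      finally have ew: "(\<Sum>x\<in>F. \<Sum>a<hdim x. \<Sum>b<hdim x. e x a b w *\<^sub>C u x a b) = w" .
      have pt: "e x a b (c *\<^sub>C w + v) *\<^sub>C u x a b = c *\<^sub>C e x a b w *\<^sub>C u x a b + e x a b v *\<^sub>C u x a b" for x a b
        by (simp add: clinear_add[OF e(1)] clinear_scale[OF e(1)] scaleC_add_left scaleC_complex_def scaleC_scaleC)
      have "(\<Sum>x\<in>F. \<Sum>a<hdim x. \<Sum>b<hdim x. e x a b (c *\<^sub>C w + v) *\<^sub>C u x a b) =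
          c *\<^sub>C w + (\<Sum>x\<in>F. \<Sum>a<hdim x. \<Sum>b<hdim x. e x a b v *\<^sub>C u x a b)"
        by (simp only: pt sum.distrib ew flip: complex_vector.scale_sum_right)
      then show ?thesis using B(3)[of F] F by simp
    qed
    then show ?case using B(1,2) w(2) by (intro exI[of _ "insert y B"]) blast
  qed

text \<open>The columns of the coordinate matrices \<open>A\<close> of a representation \<open>w\<close> are intertwiners, and they
  span because \<open>\<epsilon> w = 1\<close>. This replaces the complete reducibility of \<open>w\<close>.\<close>

lemma representation_decomposition:
  fixes w :: "nat \<Rightarrow> nat \<Rightarrow> 'a"
  assumes w: "\<And>q r. q < n \<Longrightarrow> r < n \<Longrightarrow> w q r \<in> coeff_algebra G"
    and comult: "\<And>q r. q < n \<Longrightarrow> r < n \<Longrightarrow> comult G (w q r) = emb G (\<Sum>p<n. w q p \<otimes>\<^sub>t w p r)"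
    and counit: "\<And>q r. q < n \<Longrightarrow> r < n \<Longrightarrow> \<epsilon> (w q r) = (if q = r then 1 else 0)"
  obtains B and A :: "'a mat set \<Rightarrow> nat \<Rightarrow> nat \<Rightarrow> nat \<Rightarrow> nat \<Rightarrow> complex" where "finite B" "B \<subseteq> Irred G"
    and "\<And>x a b q p. x \<in> B \<Longrightarrow> a < hdim x \<Longrightarrow> b < hdim x \<Longrightarrow> q < n \<Longrightarrow> p < n \<Longrightarrow>
       (\<Sum>r<n. A x a b r p *\<^sub>C w q r) = (\<Sum>c<hdim x. A x c b q p *\<^sub>C u x c a)"
    and "\<And>q r. q < n \<Longrightarrow> r < n \<Longrightarrow> (\<Sum>x\<in>B. \<Sum>a<hdim x. A x a a q r) = (if q = r then 1 else 0)"
proof -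
  have "\<exists>f. clinear f \<and> (\<forall>y\<in>Irred G. \<forall>i<hdim y. \<forall>j<hdim y. f (u y i j) = (if (x, a, b) = (y, i, j) then 1 else 0 :: complex))" for x a b
    using coefficient_extend[of "\<lambda>y i j. if (x, a, b) = (y, i, j) then 1 else 0 :: complex"] by metis
  then obtain e where e: "\<And>x a b. clinear (e x a b)"
    "\<And>x a b y i j. y \<in> Irred G \<Longrightarrow> i < hdim y \<Longrightarrow> j < hdim y \<Longrightarrow> e x a b (u y i j) = (if (x, a, b) = (y, i, j) then 1 else 0 :: complex)"
    by metis
  obtain \<Delta> where D: "clinear \<Delta>"
    "\<And>x i j. x \<in> Irred G \<Longrightarrow> i < hdim x \<Longrightarrow> j < hdim x \<Longrightarrow> \<Delta> (u x i j) = (\<Sum>k<hdim x. u x i k \<otimes>\<^sub>t u x k j)"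
    "\<And>a. a \<in> coeff_algebra G \<Longrightarrow> emb G (\<Delta> a) = comult G a"
    using algebraic_comult by blast
  have Dw: "\<Delta> (w q r) = (\<Sum>p<n. w q p \<otimes>\<^sub>t w p r)" if "q < n" "r < n" for q r
    using D(3)[OF w[OF that]] comult[OF that] inj_emb by (simp only: inj_eq)
  define Q where "Q q r B \<longleftrightarrow> finite B \<and> B \<subseteq> Irred G \<and> (\<forall>F. finite F \<longrightarrow> F \<subseteq> Irred G \<longrightarrow> B \<subseteq> F \<longrightarrow>
     w q r = (\<Sum>x\<in>F. \<Sum>a<hdim x. \<Sum>b<hdim x. e x a b (w q r) *\<^sub>C u x a b))" for q r B
  have "\<exists>B. Q q r B" if "q < n" "r < n" for q r
    unfolding Q_def by (rule coordinate_expansion[OF e w[OF that]])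
  then obtain C where C: "\<And>q r. q < n \<Longrightarrow> r < n \<Longrightarrow> Q q r (C q r)" by metis
  define B where "B = (\<Union>q<n. \<Union>r<n. C q r)"
  have B: "finite B" "B \<subseteq> Irred G" using C by (auto simp: B_def Q_def)
  have exp: "w q r = (\<Sum>x\<in>B. \<Sum>a<hdim x. \<Sum>b<hdim x. e x a b (w q r) *\<^sub>C u x a b)" if "q < n" "r < n" for q r
  proof -
    have "C q r \<subseteq> B" using that by (auto simp: B_def)
    then show ?thesis using C[OF that] B unfolding Q_def by blast
  qed
  show ?thesis
  \<comment> \<open>\<open>A x a b\<close> collects the coordinates of the entries of
    \<open>w\<close> at the coefficient \<open>u x a b\<close>.\<close>
  proof (rule that[OF B, of "\<lambda>x a b q p. e x a b (w q p)"])
    fix x a b q p assume x: "x \<in> B" "a < hdim x" "b < hdim x" and qp: "q < n" "p < n"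
    then have xI: "x \<in> Irred G" using B by auto
    have b: "bilin id (\<lambda>s t. e x a b t *\<^sub>C s)"
      by (auto simp: bilin_def id_apply clinear_simps[OF e(1)] scaleC_add_left
        scaleC_add_right scaleC_scaleC scaleC_complex_def mult.commute)
    note l = tensor_lift_linear[OF b]
    \<comment> \<open>Slicing the second leg of \<open>\<Delta> v\<close> with a coordinate
      functional gives an expression linear in \<open>v\<close>, so the formula need only be checked
      on coefficients. Taking \<open>v = w q p\<close> yields the intertwining relation.\<close>
    have "tensor_lift (\<lambda>s t. e x a b t *\<^sub>C s) (\<Delta> v) = (\<Sum>c<hdim x. e x c b v *\<^sub>C u x c a)"
      if v: "v \<in> coeff_algebra G" for v
    proof (rule clinear_eq_on_coeff[OF clinear_compose[OF l D(1)] _ v])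
      show "clinear (\<lambda>v. \<Sum>c<hdim x. e x c b v *\<^sub>C u x c a)"
        by (rule clinearI) (simp_all add: clinear_simps[OF e(1)] scaleC_add_left sum.distrib
           scaleC_complex_def complex_vector.scale_sum_right scaleC_scaleC)
      fix y i j assume y: "y \<in> Irred G" "i < hdim y" "j < hdim y"
      have "tensor_lift (\<lambda>s t. e x a b t *\<^sub>C s) (\<Delta> (u y i j)) = (\<Sum>k<hdim y. e x a b (u y k j) *\<^sub>C u y i k)"
        using y by (simp add: D clinear_sum[OF l] tensor_lift_elem[OF b])
      also have "\<dots> = (if x = y \<and> b = j then u x i a else 0)"
      proof (cases "x = y \<and> b = j")
        case True
        then show ?thesis using y x
          by (simp add: e(2) if_distrib[where f = "\<lambda>c. c *\<^sub>C _"] cong: if_cong)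
      next
        case False
        then have "(x, a, b) \<noteq> (y, k, j)" for k by blast
        then have "e x a b (u y k j) = 0" if "k < hdim y" for k
          unfolding e(2)[OF y(1) that y(3)] by (simp only: if_False)
        then show ?thesis using False by (simp del: de_Morgan_conj)
      qed
      also have "\<dots> = (\<Sum>c<hdim x. e x c b (u y i j) *\<^sub>C u x c a)"
      proof (cases "x = y \<and> b = j")
        case True
        then show ?thesis using y x
          by (simp add: e(2) if_distrib[where f = "\<lambda>c. c *\<^sub>C _"] cong: if_cong)
      next
        case False
        then have "(x, c, b) \<noteq> (y, i, j)" for c by blast
        then have "e x c b (u y i j) = 0" for c
          unfolding e(2)[OF y] by (simp only: if_False)
        then show ?thesis using False by (simp del: de_Morgan_conj)
      qed
      finally show "tensor_lift (\<lambda>s t. e x a b t *\<^sub>C s) (\<Delta> (u y i j)) = (\<Sum>c<hdim x. e x c b (u y i j) *\<^sub>C u x c a)" .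
    qed
    from this[OF w[OF qp]] show "(\<Sum>r<n. e x a b (w r p) *\<^sub>C w q r) = (\<Sum>c<hdim x. e x c b (w q p) *\<^sub>C u x c a)"
      by (simp add: Dw[OF qp] clinear_sum[OF l] tensor_lift_elem[OF b])
  next
    fix q r assume qr: "q < n" "r < n"
    \<comment> \<open>The counit keeps exactly the diagonal coordinates, so these sum to the
      identity matrix.\<close>
    have "\<epsilon> (w q r) = \<epsilon> (\<Sum>x\<in>B. \<Sum>a<hdim x. \<Sum>b<hdim x. e x a b (w q r) *\<^sub>C u x a b)"
      by (subst exp[OF qr]) (rule refl)
    also have "\<dots> = (\<Sum>x\<in>B. \<Sum>a<hdim x. \<Sum>b<hdim x. e x a b (w q r) * (if a = b then 1 else 0))"
      using B(2) by (auto simp: clinear_sum[OF clinear_counit] clinear_scale[OF clinear_counit] scaleC_complex_def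
          counit_antipode_u intro!: sum.cong)
    also have "\<dots> = (\<Sum>x\<in>B. \<Sum>a<hdim x. e x a a (w q r))"
      by (intro sum.cong refl) (simp add: if_distrib[where f = "\<lambda>c. _ * c"] cong: if_cong)
    finally show "(\<Sum>x\<in>B. \<Sum>a<hdim x. e x a a (w q r)) = (if q = r then 1 else 0)"
      using counit[OF qr] by simp
  qed
qed

text \<open>The entries of the tensor product of two representations, with pairs of indices coded by
  \<open>div\<close> and \<open>mod\<close>, satisfy the hypotheses of the decomposition because the
  comultiplication and the counit are multiplicative on coefficients.\<close>

lemma kron_decomposition:
  assumes y: "y \<in> Irred G" and z: "z \<in> Irred G"
  obtains B and A :: "'a mat set \<Rightarrow> nat \<Rightarrow> nat \<Rightarrow> nat \<Rightarrow> nat \<Rightarrow> complex" where "finite B" "B \<subseteq> Irred G"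
    and "\<And>x b p. x \<in> B \<Longrightarrow> b < hdim x \<Longrightarrow> p < hdim y * hdim z \<Longrightarrow>
       mat (hdim y * hdim z) (hdim x) (\<lambda>(q, a). A x a b q p) \<in> mor [y, z] [x]"
    and "\<And>q r. q < hdim y * hdim z \<Longrightarrow> r < hdim y * hdim z \<Longrightarrow>
       (\<Sum>x\<in>B. \<Sum>a<hdim x. A x a a q r) = (if q = r then 1 else 0)"
proof -
  let ?n = "hdim y * hdim z" and ?m = "hdim z"
  define w where "w q r = u y (q div ?m) (r div ?m) * u z (q mod ?m) (r mod ?m)" for q r
  note dm = div_mod_less_mult
  have 1: "w q r \<in> coeff_algebra G" if "q < ?n" "r < ?n" for q r
    unfolding w_def using hopf u_in_coeff[OF y dm(1)[OF that(1)] dm(1)[OF that(2)]]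
      u_in_coeff[OF z dm(2)[OF that(1)] dm(2)[OF that(2)]] by (simp add: hopf_star_algebra_def)
  have 2: "\<epsilon> (w q r) = (if q = r then 1 else 0)" if "q < ?n" "r < ?n" for q r
  proof -
    have "\<epsilon> (w q r) = \<epsilon> (u y (q div ?m) (r div ?m)) * \<epsilon> (u z (q mod ?m) (r mod ?m))"
      unfolding w_def using hopf u_in_coeff[OF y dm(1)[OF that(1)] dm(1)[OF that(2)]]
        u_in_coeff[OF z dm(2)[OF that(1)] dm(2)[OF that(2)]] by (simp add: hopf_star_algebra_def)
    also have "\<dots> = (if q div ?m = r div ?m \<and> q mod ?m = r mod ?m then 1 else 0)"
      by (simp add: counit_antipode_u y z dm[OF that(1)] dm[OF that(2)])
    also have "(q div ?m = r div ?m \<and> q mod ?m = r mod ?m) \<longleftrightarrow> q = r"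
      by (metis div_mult_mod_eq)
    finally show ?thesis .
  qed
  have 3: "comult G (w q r) = emb G (\<Sum>p<?n. w q p \<otimes>\<^sub>t w p r)" if "q < ?n" "r < ?n" for q r
  proof -
    have "comult G (w q r) = emb G ((\<Sum>i<hdim y. u y (q div ?m) i \<otimes>\<^sub>t u y i (r div ?m)) *
        (\<Sum>k<?m. u z (q mod ?m) k \<otimes>\<^sub>t u z k (r mod ?m)))"
      by (simp add: w_def star_homD(3)[OF star_hom_comult] star_homD(3)[OF star_hom_emb] comult_u y z dm[OF that(1)] dm[OF that(2)])
    also have "(\<Sum>i<hdim y. u y (q div ?m) i \<otimes>\<^sub>t u y i (r div ?m)) *
        (\<Sum>k<?m. u z (q mod ?m) k \<otimes>\<^sub>t u z k (r mod ?m)) = (\<Sum>i<hdim y. \<Sum>k<?m.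
        (u y (q div ?m) i * u z (q mod ?m) k) \<otimes>\<^sub>t (u y i (r div ?m) * u z k (r mod ?m)))"
      by (simp add: sum_product tensor_elem_mult)
    also have "\<dots> = (\<Sum>p<?n. w q p \<otimes>\<^sub>t w p r)"
      unfolding w_def by (rule sum_div_mod[symmetric])
    finally show ?thesis .
  qed
  obtain B A where BA: "finite B" "B \<subseteq> Irred G"
     "\<And>x a b q p. x \<in> B \<Longrightarrow> a < hdim x \<Longrightarrow> b < hdim x \<Longrightarrow> q < ?n \<Longrightarrow> p < ?n \<Longrightarrow>
       (\<Sum>r<?n. A x a b r p *\<^sub>C w q r) = (\<Sum>c<hdim x. A x c b q p *\<^sub>C u x c a)"
     "\<And>q r. q < ?n \<Longrightarrow> r < ?n \<Longrightarrow> (\<Sum>x\<in>B. \<Sum>a<hdim x. A x a a q r) = (if q = r then 1 else 0)"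
    using representation_decomposition[of ?n w, OF 1 3 2] by blast
  show ?thesis
  proof (rule that[of B A, OF BA(1,2) _ BA(4)])
    fix x b p assume x: "x \<in> B" "b < hdim x" and p: "p < ?n"
    then have xI: "x \<in> Irred G" using BA by auto
    have k: "kron (irrep y) (irrep z) \<in> carrier_mat ?n ?n"
      by (rule kron_carrier[OF carrier_u[OF y] carrier_u[OF z]])
    have "intertwines (kron (irrep y) (irrep z)) (irrep x) (\<lambda>i j. mat ?n (hdim x) (\<lambda>(q, a). A x a b q p) $$ (i, j))"
      using k carrier_u[OF xI] BA(3)[OF x(1) _ x(2) _ p]
      by (simp add: intertwines_def kron_index[OF carrier_u[OF y] carrier_u[OF z]] flip: w_def)
    then show "mat ?n (hdim x) (\<lambda>(q, a). A x a b q p) \<in> mor [y, z] [x]"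
      by (simp add: mor_def tensor_rep_simps Mor_iff[OF k carrier_u[OF xI]])
  qed assumption+
qed

end

context hopf_quantum_group
begin

lemma mor_pair:
  assumes "y \<in> Irred G" "z \<in> Irred G" "x \<in> Irred G"
  shows "T \<in> mor [y, z] [x] \<longleftrightarrow> T \<in> carrier_mat (hdim y * hdim z) (hdim x) \<and>
    (\<forall>q<hdim y * hdim z. \<forall>a<hdim x.
      (\<Sum>r<hdim y * hdim z. T $$ (r, a) *\<^sub>C (u y (q div hdim z) (r div hdim z) * u z (q mod hdim z) (r mod hdim z)))
      = (\<Sum>c<hdim x. T $$ (q, c) *\<^sub>C u x c a))"
proof -
  have k: "kron (irrep y) (irrep z) \<in> carrier_mat (hdim y * hdim z) (hdim y * hdim z)"
    by (rule kron_carrier[OF carrier_u[OF assms(1)] carrier_u[OF assms(2)]])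
  show ?thesis
    unfolding mor_def tensor_rep_simps Mor_iff[OF k carrier_u[OF assms(3)]]
    using k carrier_u[OF assms(3)]
    by (simp add: intertwines_def kron_index[OF carrier_u[OF assms(1)] carrier_u[OF assms(2)]])
qed

section \<open>The trivial representation\<close>

lemma irreducible_trivial: "irreducible_rep G (1\<^sub>m 1)"
proof -
  have one: "(1\<^sub>m 1 :: 'a mat) \<in> carrier_mat 1 1" by simp
  have "comult G 1 = emb G (1 \<otimes>\<^sub>t 1)"
    using star_homD(2)[OF star_hom_comult] star_homD(2)[OF star_hom_emb] by (simp add: tensor_one)
  then have "unitary_rep G (1\<^sub>m 1)"
    using unitary_mat_iff[OF one] by (auto simp: unitary_rep_def)
  moreover have "Mor (1\<^sub>m 1 :: 'a mat) (1\<^sub>m 1) = {c \<cdot>\<^sub>m 1\<^sub>m 1 | c. True}"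
  proof -
    have "T \<in> Mor (1\<^sub>m 1 :: 'a mat) (1\<^sub>m 1) \<longleftrightarrow> T \<in> carrier_mat 1 1" for T
      unfolding Mor_iff[OF one one] by (simp add: intertwines_def)
    moreover have "T \<in> carrier_mat 1 1 \<longleftrightarrow> (\<exists>c. T = c \<cdot>\<^sub>m 1\<^sub>m 1)" for T :: "complex mat"
      by (auto intro!: exI[of _ "T $$ (0, 0)"] eq_matI)
    ultimately show ?thesis by auto
  qed
  ultimately show ?thesis by (simp add: irreducible_rep_def)
qed

lemma triv_in: "triv G \<in> Irred G"
  unfolding triv_def Irred_def using irreducible_trivial by (intro quotientI) simp

text \<open>The chosen representative of the trivial class is a priori only equivalent to the matrix
  1. A unitary with one row has one column, and conjugation by a scalar of modulus one changes
  nothing.\<close>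

lemma hdim_triv: "hdim (triv G) = 1" and u_triv: "u (triv G) 0 0 = 1"
proof -
  have "irrep (triv G) \<in> triv G" by (rule irrep_in[OF triv_in])
  then obtain T where T: "T \<in> Mor (1\<^sub>m 1) (irrep (triv G))" "unitary_mat T"
    unfolding triv_def by (auto simp: rep_equiv_def)
  let ?n = "hdim (triv G)"
  have Tc: "T \<in> carrier_mat 1 ?n" and Ti: "intertwines (1\<^sub>m 1) (irrep (triv G)) (\<lambda>i j. T $$ (i, j))"
    using T(1) Mor_iff[OF one_carrier_mat carrier_u[OF triv_in], of T] by auto
  have n0: "0 < ?n"
    using irreducible_repD(4)[OF irreducible_irrep[OF triv_in]] by (simp add: hdim_def)
  have un: "cnj (T $$ (0, j)) * T $$ (0, l) = (if j = l then 1 else 0)" if "j < ?n" "l < ?n" for j l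
    using unitary_matD(1)[OF T(2) Tc that] by (simp add: star_complex_def)
  show n1: "?n = 1"
  proof (rule ccontr)
    assume "?n \<noteq> 1"
    then have 1: "1 < ?n" using n0 by simp
    \<comment> \<open>With a second column, two nonzero numbers in the single row would have to be
      orthogonal.\<close>
    show False using un[OF n0 n0] un[OF 1 1] un[OF n0 1] by auto
  qed
  have "T $$ (0, 0) *\<^sub>C (1::'a) = T $$ (0, 0) *\<^sub>C u (triv G) 0 0"
    using Ti n1 carrier_u[OF triv_in] by (auto simp: intertwines_def)
  then show "u (triv G) 0 0 = 1"
    using un[OF n0 n0] by (auto simp: complex_vector.scale_cancel_left)
qed

end

section \<open>The link algebras\<close>

text \<open>The index set is again fixed only up to enlargement, so that both legs of a tensor, and
  sums of tensors, can share finite index sets.\<close>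

lemma basis_expansion:
  fixes v :: "'i \<Rightarrow> 'a::complex_vector" and e :: "'i \<Rightarrow> 'a \<Rightarrow> complex"
  assumes e: "\<And>s. clinear (e s)" "\<And>s t. s \<in> I \<Longrightarrow> t \<in> I \<Longrightarrow> e s (v t) = (if s = t then 1 else 0)"
    and b: "b \<in> cspan (v ` I)"
  shows "\<exists>F0. finite F0 \<and> F0 \<subseteq> I \<and> (\<forall>F. finite F \<longrightarrow> F0 \<subseteq> F \<longrightarrow> F \<subseteq> I \<longrightarrow> b = (\<Sum>s\<in>F. e s b *\<^sub>C v s))"
  using b
proof (induction rule: complex_vector.span_induct_alt)
  case base
  show ?case by (intro exI[of _ "{}"]) (auto simp: clinear_0[OF e(1)])
next
  case (step c w b)
  then obtain t where t: "w = v t" "t \<in> I" by auto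
  obtain F0 where F0: "finite F0" "F0 \<subseteq> I" "\<And>F. finite F \<Longrightarrow> F0 \<subseteq> F \<Longrightarrow> F \<subseteq> I \<Longrightarrow> b = (\<Sum>s\<in>F. e s b *\<^sub>C v s)"
    using step.IH by blast
  have "c *\<^sub>C w + b = (\<Sum>s\<in>F. e s (c *\<^sub>C w + b) *\<^sub>C v s)" if F: "finite F" "insert t F0 \<subseteq> F" "F \<subseteq> I" for F
  proof -
    have pt: "e s (c *\<^sub>C w + b) *\<^sub>C v s = c *\<^sub>C e s w *\<^sub>C v s + e s b *\<^sub>C v s" for s
      by (simp add: clinear_add[OF e(1)] clinear_scale[OF e(1)] scaleC_add_left scaleC_complex_def scaleC_scaleC)
    have "(\<Sum>s\<in>F. e s w *\<^sub>C v s) = (\<Sum>s\<in>F. (if s = t then 1 else 0) *\<^sub>C v s)"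
      using F(3) t by (intro sum.cong refl) (auto simp: e(2))
    also have "\<dots> = w" using F t by (simp add: sum_delta_scale)
    finally have "(\<Sum>s\<in>F. e s w *\<^sub>C v s) = w" .
    then show ?thesis
      using F0(3)[OF F(1) _ F(3)] F(2) by (simp only: pt sum.distrib flip: complex_vector.scale_sum_right) simp
  qed
  then show ?case using F0(1,2) t(2) by (intro exI[of _ "insert t F0"]) blast
qed

lemma dual_family:
  fixes v :: "'i \<Rightarrow> 'a::complex_vector"
  assumes "inj_on v I" "cindependent (v ` I)"
  obtains e :: "'i \<Rightarrow> 'a \<Rightarrow> complex"
  where "\<And>s. clinear (e s)" "\<And>s t. s \<in> I \<Longrightarrow> t \<in> I \<Longrightarrow> e s (v t) = (if s = t then 1 else 0)"
proof -
  define Q where "Q s f \<longleftrightarrow> clinear f \<and> (\<forall>t\<in>I. f (v t) = (if s = t then 1 else 0 :: complex))" for s f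
  have "\<exists>f. Q s f" for s
  proof -
    obtain f where "clinear f" "\<And>t. t \<in> I \<Longrightarrow> f (v t) = (if s = t then 1 else 0 :: complex)"
      using clinear_extend[OF assms, of "\<lambda>t. if s = t then 1 else 0 :: complex"] by auto
    then show ?thesis unfolding Q_def by blast
  qed
  then obtain e where e: "\<And>s. Q s (e s)" by metis
  show ?thesis
    by (rule that[of e]) (use e in \<open>simp_all add: Q_def\<close>)
qed

locale link_algebras =
  G1: hopf_quantum_group G\<^sub>1 \<epsilon>\<^sub>1 S\<^sub>1 + G2: hopf_quantum_group G\<^sub>2 \<epsilon>\<^sub>2 S\<^sub>2
  for G\<^sub>1 :: "('a1::cstar_algebra, 'aa1::cstar_algebra, 'aaa1::cstar_algebra) quantum_group"
    and \<epsilon>\<^sub>1 S\<^sub>1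
    and G\<^sub>2 :: "('a2::cstar_algebra, 'aa2::cstar_algebra, 'aaa2::cstar_algebra) quantum_group"
    and \<epsilon>\<^sub>2 S\<^sub>2 +
  fixes \<phi> :: "'a2 mat set \<Rightarrow> 'a1 mat set"
    and \<Phi> :: "'a2 mat set list \<Rightarrow> 'a2 mat set list \<Rightarrow> complex mat \<Rightarrow> complex mat"
    and \<omega> :: "'b::star_algebra \<Rightarrow> complex" and X :: "'a2 mat set \<Rightarrow> 'b mat"
    and \<delta>\<^sub>1 :: "'b \<Rightarrow> 'a1 \<otimes> 'b" and \<delta>\<^sub>2 :: "'b \<Rightarrow> 'b \<otimes> 'a2"
    and \<omega>' :: "'c::star_algebra \<Rightarrow> complex" and Y :: "'a1 mat set \<Rightarrow> 'c mat"
    and \<gamma>\<^sub>2 :: "'c \<Rightarrow> 'a2 \<otimes> 'c" and \<gamma>\<^sub>1 :: "'c \<Rightarrow> 'c \<otimes> 'a1"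
  assumes mon: "monoidal_equivalence G\<^sub>2 G\<^sub>1 \<phi> \<Phi>"
    and link_X: "link_algebra G\<^sub>2 \<phi> \<Phi> \<omega> X"
    and act_X: "link_actions G\<^sub>2 \<epsilon>\<^sub>2 G\<^sub>1 \<epsilon>\<^sub>1 \<phi> X \<delta>\<^sub>1 \<delta>\<^sub>2"
    and link_Y: "link_algebra G\<^sub>1 (inverse_obj G\<^sub>2 \<phi>) (inverse_mor G\<^sub>2 \<phi> \<Phi>) \<omega>' Y"
    and act_Y: "link_actions G\<^sub>1 \<epsilon>\<^sub>1 G\<^sub>2 \<epsilon>\<^sub>2 (inverse_obj G\<^sub>2 \<phi>) Y \<gamma>\<^sub>2 \<gamma>\<^sub>1"
begin

text \<open>Everything is indexed by classes of \<open>G\<^sub>1\<close>, so that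
  \<open>X' y\<close> and \<open>Y' y\<close> have matching middle dimension \<open>dim' y\<close>
  and their product carries the outer indices of \<open>irrep y\<close>.\<close>

abbreviation \<psi> :: "'a1 mat set \<Rightarrow> 'a2 mat set" where "\<psi> \<equiv> inverse_obj G\<^sub>2 \<phi>"
abbreviation u :: "'a1 mat set \<Rightarrow> nat \<Rightarrow> nat \<Rightarrow> 'a1" where "u y i j \<equiv> irrep y $$ (i, j)"
abbreviation u' :: "'a1 mat set \<Rightarrow> nat \<Rightarrow> nat \<Rightarrow> 'a2" where "u' y i j \<equiv> irrep (\<psi> y) $$ (i, j)"
abbreviation X' :: "'a1 mat set \<Rightarrow> nat \<Rightarrow> nat \<Rightarrow> 'b" where "X' y i j \<equiv> X (\<psi> y) $$ (i, j)"
abbreviation Y' :: "'a1 mat set \<Rightarrow> nat \<Rightarrow> nat \<Rightarrow> 'c" where "Y' y i j \<equiv> Y y $$ (i, j)"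
abbreviation dim' :: "'a1 mat set \<Rightarrow> nat" where "dim' y \<equiv> hdim (\<psi> y)"

lemma bij_\<phi>: "bij_betw \<phi> (Irred G\<^sub>2) (Irred G\<^sub>1)" and \<phi>_triv: "\<phi> (triv G\<^sub>2) = triv G\<^sub>1"
  using mon by (simp_all add: monoidal_equivalence_def)

lemma \<psi>_in: "y \<in> Irred G\<^sub>1 \<Longrightarrow> \<psi> y \<in> Irred G\<^sub>2"
  and \<phi>_\<psi>: "y \<in> Irred G\<^sub>1 \<Longrightarrow> \<phi> (\<psi> y) = y"
  and \<phi>_in: "x \<in> Irred G\<^sub>2 \<Longrightarrow> \<phi> x \<in> Irred G\<^sub>1"
  and \<psi>_\<phi>: "x \<in> Irred G\<^sub>2 \<Longrightarrow> \<psi> (\<phi> x) = x"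
  using bij_\<phi> unfolding inverse_obj_def bij_betw_def
  by (auto simp: inv_into_into f_inv_into_f)

lemma \<psi>_triv: "\<psi> (triv G\<^sub>1) = triv G\<^sub>2"
  using \<psi>_\<phi>[OF G2.triv_in] by (simp add: \<phi>_triv)

lemma \<psi>_eq_iff: "y \<in> Irred G\<^sub>1 \<Longrightarrow> z \<in> Irred G\<^sub>1 \<Longrightarrow> \<psi> y = \<psi> z \<longleftrightarrow> y = z"
  using \<phi>_\<psi> by metis

lemma carrier_X: "y \<in> Irred G\<^sub>1 \<Longrightarrow> X (\<psi> y) \<in> carrier_mat (hdim y) (dim' y)"
  and carrier_Y: "y \<in> Irred G\<^sub>1 \<Longrightarrow> Y y \<in> carrier_mat (dim' y) (hdim y)"
  and unitary_X: "y \<in> Irred G\<^sub>1 \<Longrightarrow> unitary_mat (X (\<psi> y))"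
  and unitary_Y: "y \<in> Irred G\<^sub>1 \<Longrightarrow> unitary_mat (Y y)"
  using link_X link_Y \<psi>_in \<phi>_\<psi> unfolding link_algebra_def by metis+

definition ix_X where "ix_X = {(y, i, j). y \<in> Irred G\<^sub>1 \<and> i < hdim y \<and> j < dim' y}"
definition ix_Y where "ix_Y = {(y, i, j). y \<in> Irred G\<^sub>1 \<and> i < dim' y \<and> j < hdim y}"

lemma basis_X:
  "inj_on (\<lambda>(y, i, j). X' y i j) ix_X" "cindependent ((\<lambda>(y, i, j). X' y i j) ` ix_X)"
  "cspan ((\<lambda>(y, i, j). X' y i j) ` ix_X) = UNIV"
proof -
  let ?I = "{(x, i, j). x \<in> Irred G\<^sub>2 \<and> i < hdim (\<phi> x) \<and> j < hdim x}"
  let ?f = "\<lambda>(x, i, j). X x $$ (i, j)"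
  have f: "inj_on ?f ?I" "cindependent (?f ` ?I)" "cspan (?f ` ?I) = UNIV"
    using link_X by (simp_all add: link_algebra_def Let_def)
  let ?g = "\<lambda>(y, i, j). (\<psi> y, i, j)"
  have g: "?g ` ix_X = ?I"
  proof (intro equalityI subsetI)
    fix s assume "s \<in> ?g ` ix_X"
    then show "s \<in> ?I" using \<psi>_in \<phi>_\<psi> by (auto simp: ix_X_def)
  next
    fix s assume "s \<in> ?I"
    then obtain x i j where s: "s = (x, i, j)" "x \<in> Irred G\<^sub>2" "i < hdim (\<phi> x)" "j < hdim x" by auto
    then have in_ix: "(\<phi> x, i, j) \<in> ix_X" using \<phi>_in \<psi>_\<phi> by (auto simp: ix_X_def)
    have "s = ?g (\<phi> x, i, j)" using s \<psi>_\<phi> by simp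
    then show "s \<in> ?g ` ix_X" by (rule image_eqI[OF _ in_ix])
  qed
  have gi: "inj_on ?g ix_X"
  proof (rule inj_onI)
    fix s t assume "s \<in> ix_X" "t \<in> ix_X" "?g s = ?g t"
    then show "s = t" unfolding ix_X_def
      by (cases s, cases t) (simp add: \<psi>_eq_iff)
  qed
  have fg: "(\<lambda>(y, i, j). X' y i j) = ?f \<circ> ?g" by (auto simp: fun_eq_iff)
  have im: "(\<lambda>(y, i, j). X' y i j) ` ix_X = ?f ` ?I" unfolding fg image_comp[symmetric] g ..
  show "inj_on (\<lambda>(y, i, j). X' y i j) ix_X"
    unfolding fg using comp_inj_on[OF gi] f(1) g by simp
  show "cindependent ((\<lambda>(y, i, j). X' y i j) ` ix_X)" "cspan ((\<lambda>(y, i, j). X' y i j) ` ix_X) = UNIV"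
    unfolding im by (rule f)+
qed

lemma basis_Y:
  "inj_on (\<lambda>(y, i, j). Y' y i j) ix_Y" "cindependent ((\<lambda>(y, i, j). Y' y i j) ` ix_Y)"
  "cspan ((\<lambda>(y, i, j). Y' y i j) ` ix_Y) = UNIV"
  using link_Y by (simp_all add: link_algebra_def Let_def ix_Y_def)

lemma clinear_actions: "clinear \<delta>\<^sub>1" "clinear \<delta>\<^sub>2" "clinear \<gamma>\<^sub>1" "clinear \<gamma>\<^sub>2"
  using act_X act_Y by (auto simp: link_actions_def left_action_def right_action_def star_hom_def)

lemma action_X:
  assumes "y \<in> Irred G\<^sub>1" "i < hdim y" "j < dim' y"
  shows "\<delta>\<^sub>1 (X' y i j) = (\<Sum>k<hdim y. u y i k \<otimes>\<^sub>t X' y k j)" "\<delta>\<^sub>2 (X' y i j) = (\<Sum>k<dim' y. X' y i k \<otimes>\<^sub>t u' y k j)"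
  using act_X assms \<psi>_in[OF assms(1)] \<phi>_\<psi>[OF assms(1)] by (auto simp: link_actions_def)

lemma action_Y:
  assumes "y \<in> Irred G\<^sub>1" "i < dim' y" "j < hdim y"
  shows "\<gamma>\<^sub>2 (Y' y i j) = (\<Sum>k<dim' y. u' y i k \<otimes>\<^sub>t Y' y k j)" "\<gamma>\<^sub>1 (Y' y i j) = (\<Sum>k<hdim y. Y' y i k \<otimes>\<^sub>t u y k j)"
  using act_Y assms by (auto simp: link_actions_def)

text \<open>One matrix \<open>R\<close> serves both link algebras. It is the preimage of
  \<open>T\<close> under \<open>\<Phi>\<close>, so the relation of \<open>X\<close> at
  \<open>R\<close> contains \<open>T\<close>; and the inverse equivalence sends \<open>T\<close> to
  this same preimage, so the relation of \<open>Y\<close> at \<open>T\<close> contains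
  \<open>R\<close>.\<close>

lemma link_relation:
  assumes x: "x \<in> Irred G\<^sub>1" and y: "y \<in> Irred G\<^sub>1" and z: "z \<in> Irred G\<^sub>1" and T: "T \<in> mor [y, z] [x]"
  shows "\<exists>R. R \<in> mor [\<psi> y, \<psi> z] [\<psi> x] \<and> \<Phi> [\<psi> y, \<psi> z] [\<psi> x] R = T \<and>
    (\<forall>q<hdim y * hdim z. \<forall>b<dim' x.
      (\<Sum>s<dim' y * dim' z. R $$ (s, b) *\<^sub>C (X' y (q div hdim z) (s div dim' z) * X' z (q mod hdim z) (s mod dim' z)))
      = (\<Sum>c<hdim x. T $$ (q, c) *\<^sub>C X' x c b)) \<and>
    (\<forall>s<dim' y * dim' z. \<forall>a<hdim x.
      (\<Sum>r<hdim y * hdim z. T $$ (r, a) *\<^sub>C (Y' y (s div dim' z) (r div hdim z) * Y' z (s mod dim' z) (r mod hdim z)))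
      = (\<Sum>b<dim' x. R $$ (s, b) *\<^sub>C Y' x b a))"
proof -
  define R where "R = inverse_mor G\<^sub>2 \<phi> \<Phi> [y, z] [x] T"
  have w: "[\<psi> y, \<psi> z] \<in> words G\<^sub>2" "[\<psi> x] \<in> words G\<^sub>2"
    using x y z \<psi>_in by (auto simp: words_def)
  have "\<forall>xs\<in>words G\<^sub>2. \<forall>ys\<in>words G\<^sub>2. bij_betw (\<Phi> xs ys) (mor xs ys) (mor (map \<phi> xs) (map \<phi> ys))"
    using mon unfolding monoidal_equivalence_def by blast
  from this[rule_format, OF w] have b: "bij_betw (\<Phi> [\<psi> y, \<psi> z] [\<psi> x]) (mor [\<psi> y, \<psi> z] [\<psi> x]) (mor [y, z] [x])"
    by (simp add: \<phi>_\<psi> x y z)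
  have R: "R \<in> mor [\<psi> y, \<psi> z] [\<psi> x]" "\<Phi> [\<psi> y, \<psi> z] [\<psi> x] R = T"
    using bij_betw_apply[OF bij_betw_inv_into[OF b] T] bij_betw_inv_into_right[OF b T]
    by (simp_all add: R_def inverse_mor_def Let_def)
  have Tc: "T \<in> carrier_mat (hdim y * hdim z) (hdim x)" using T G1.mor_pair[OF y z x] by simp
  have Rc: "R \<in> carrier_mat (dim' y * dim' z) (dim' x)"
    using R(1) G2.mor_pair[OF \<psi>_in[OF y] \<psi>_in[OF z] \<psi>_in[OF x]] by simp
  have kX: "kron (X (\<psi> y)) (X (\<psi> z)) \<in> carrier_mat (hdim y * hdim z) (dim' y * dim' z)"
    by (rule kron_carrier[OF carrier_X[OF y] carrier_X[OF z]])
  have kY: "kron (Y y) (Y z) \<in> carrier_mat (dim' y * dim' z) (hdim y * hdim z)"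
    by (rule kron_carrier[OF carrier_Y[OF y] carrier_Y[OF z]])
  have "\<forall>x\<in>Irred G\<^sub>2. \<forall>y\<in>Irred G\<^sub>2. \<forall>z\<in>Irred G\<^sub>2. \<forall>S\<in>mor [y, z] [x].
      kron (X y) (X z) * amp S = amp (\<Phi> [y, z] [x] S) * X x"
    using link_X unfolding link_algebra_def by (elim conjE)
  from this[rule_format, OF \<psi>_in[OF x] \<psi>_in[OF y] \<psi>_in[OF z] R(1)]
  have eX: "kron (X (\<psi> y)) (X (\<psi> z)) * amp R = amp T * X (\<psi> x)"
    unfolding R(2) .
  have "\<forall>x\<in>Irred G\<^sub>1. \<forall>y\<in>Irred G\<^sub>1. \<forall>z\<in>Irred G\<^sub>1. \<forall>S\<in>mor [y, z] [x].
      kron (Y y) (Y z) * amp S = amp (inverse_mor G\<^sub>2 \<phi> \<Phi> [y, z] [x] S) * Y x"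
    using link_Y unfolding link_algebra_def by (elim conjE)
  from this[rule_format, OF x y z T]
  have eY: "kron (Y y) (Y z) * amp T = amp R * Y x"
    unfolding R_def .
  show ?thesis
  proof (intro exI[of _ R] conjI R allI impI)
    fix q b assume qb: "q < hdim y * hdim z" "b < dim' x"
    show "(\<Sum>s<dim' y * dim' z. R $$ (s, b) *\<^sub>C (X' y (q div hdim z) (s div dim' z) * X' z (q mod hdim z) (s mod dim' z)))
      = (\<Sum>c<hdim x. T $$ (q, c) *\<^sub>C X' x c b)"
      using arg_cong[OF eX, of "\<lambda>M. M $$ (q, b)"]
      by (simp add: mult_amp_index[OF kX Rc qb] amp_mult_index[OF Tc carrier_X[OF x] qb]
          kron_index[OF carrier_X[OF y] carrier_X[OF z] qb(1)])
  next
    fix s a assume sa: "s < dim' y * dim' z" "a < hdim x"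
    show "(\<Sum>r<hdim y * hdim z. T $$ (r, a) *\<^sub>C (Y' y (s div dim' z) (r div hdim z) * Y' z (s mod dim' z) (r mod hdim z)))
      = (\<Sum>b<dim' x. R $$ (s, b) *\<^sub>C Y' x b a)"
      using arg_cong[OF eY, of "\<lambda>M. M $$ (s, a)"]
      by (simp add: mult_amp_index[OF kY Tc sa] amp_mult_index[OF Rc carrier_Y[OF x] sa]
          kron_index[OF carrier_Y[OF y] carrier_Y[OF z] sa(1)])
  qed
qed

section \<open>The homomorphism \<open>\<theta>\<close> on the coefficient algebra\<close>

definition Z :: "'a1 mat set \<Rightarrow> nat \<Rightarrow> nat \<Rightarrow> 'b \<otimes> 'c" where
  "Z y i j = (\<Sum>k<dim' y. X' y i k \<otimes>\<^sub>t Y' y k j)"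

text \<open>Linear independence makes the prescription on coefficients consistent. Outside
  \<open>coeff_algebra G\<^sub>1\<close> the values are arbitrary, which is why later facts carry
  membership conditions.\<close>

definition \<theta> :: "'a1 \<Rightarrow> 'b \<otimes> 'c" where
  "\<theta> = (SOME f. clinear f \<and> (\<forall>y\<in>Irred G\<^sub>1. \<forall>i<hdim y. \<forall>j<hdim y. f (u y i j) = Z y i j))"

lemma clinear_\<theta>: "clinear \<theta>"
  and \<theta>_u: "y \<in> Irred G\<^sub>1 \<Longrightarrow> i < hdim y \<Longrightarrow> j < hdim y \<Longrightarrow> \<theta> (u y i j) = Z y i j"
proof -
  have "\<exists>f. clinear f \<and> (\<forall>y\<in>Irred G\<^sub>1. \<forall>i<hdim y. \<forall>j<hdim y. f (u y i j) = Z y i j)"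
    using G1.coefficient_extend[of Z] by metis
  from someI_ex[OF this] show "clinear \<theta>"
    "y \<in> Irred G\<^sub>1 \<Longrightarrow> i < hdim y \<Longrightarrow> j < hdim y \<Longrightarrow> \<theta> (u y i j) = Z y i j"
    unfolding \<theta>_def[symmetric] by auto
qed

text \<open>Both sides of the claimed identity, as matrices, take each intertwiner \<open>T\<close> from \<open>U\<^sup>x\<close> to
  \<open>U\<^sup>y \<otimes> U\<^sup>z\<close> to \<open>T Z\<^sup>x\<close>, and such \<open>T\<close> are jointly surjective.\<close>

lemma \<theta>_mult_u:
  assumes y: "y \<in> Irred G\<^sub>1" and z: "z \<in> Irred G\<^sub>1"
    and ij: "i < hdim y" "j < hdim y" and kl: "k < hdim z" "l < hdim z"
  shows "\<theta> (u y i j * u z k l) = Z y i j * Z z k l"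
proof -
  let ?m = "hdim z" and ?m' = "dim' z"
  let ?n = "hdim y * ?m" and ?n' = "dim' y * ?m'"
  note dm = div_mod_less_mult
  define w where "w q r = \<theta> (u y (q div ?m) (r div ?m) * u z (q mod ?m) (r mod ?m))" for q r
  define w' where "w' q r = Z y (q div ?m) (r div ?m) * Z z (q mod ?m) (r mod ?m)" for q r
  obtain B and A :: "'a1 mat set \<Rightarrow> nat \<Rightarrow> nat \<Rightarrow> nat \<Rightarrow> nat \<Rightarrow> complex" where B: "finite B" "B \<subseteq> Irred G\<^sub>1"
    and A: "\<And>x b p. x \<in> B \<Longrightarrow> b < hdim x \<Longrightarrow> p < ?n \<Longrightarrow> mat ?n (hdim x) (\<lambda>(q, a). A x a b q p) \<in> mor [y, z] [x]"
    and A1: "\<And>q r. q < ?n \<Longrightarrow> r < ?n \<Longrightarrow> (\<Sum>x\<in>B. \<Sum>a<hdim x. A x a a q r) = (if q = r then 1 else 0)"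
    using G1.kron_decomposition[OF y z] by blast
  have 1: "(\<Sum>r<?n. T $$ (r, a) *\<^sub>C w q r) = (\<Sum>c<hdim x. T $$ (q, c) *\<^sub>C Z x c a)"
    if x: "x \<in> Irred G\<^sub>1" and T: "T \<in> mor [y, z] [x]" and qa: "q < ?n" "a < hdim x" for x T q a
  proof -
    have "\<theta> (\<Sum>r<?n. T $$ (r, a) *\<^sub>C (u y (q div ?m) (r div ?m) * u z (q mod ?m) (r mod ?m)))
        = \<theta> (\<Sum>c<hdim x. T $$ (q, c) *\<^sub>C u x c a)"
      using T[unfolded G1.mor_pair[OF y z x]] qa by simp
    then show ?thesis
      using x qa by (simp add: clinear_sum[OF clinear_\<theta>] clinear_scale[OF clinear_\<theta>] \<theta>_u w_def)
  qed
  have 2: "(\<Sum>r<?n. T $$ (r, a) *\<^sub>C w' q r) = (\<Sum>c<hdim x. T $$ (q, c) *\<^sub>C Z x c a)"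
    if x: "x \<in> Irred G\<^sub>1" and T: "T \<in> mor [y, z] [x]" and qa: "q < ?n" "a < hdim x" for x T q a
  proof -
    obtain R where RX: "\<forall>q<?n. \<forall>b<dim' x.
      (\<Sum>s<?n'. R $$ (s, b) *\<^sub>C (X' y (q div hdim z) (s div dim' z) * X' z (q mod hdim z) (s mod dim' z)))
      = (\<Sum>c<hdim x. T $$ (q, c) *\<^sub>C X' x c b)"
      and RY: "\<forall>s<?n'. \<forall>a<hdim x.
      (\<Sum>r<?n. T $$ (r, a) *\<^sub>C (Y' y (s div dim' z) (r div hdim z) * Y' z (s mod dim' z) (r mod hdim z)))
      = (\<Sum>b<dim' x. R $$ (s, b) *\<^sub>C Y' x b a)"
      using link_relation[OF x y z T] by (elim exE conjE)
    define XX where "XX s = X' y (q div ?m) (s div ?m') * X' z (q mod ?m) (s mod ?m')" for s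
    define YY where "YY s r = Y' y (s div ?m') (r div ?m) * Y' z (s mod ?m') (r mod ?m)" for s r
    have w': "w' q r = (\<Sum>s<?n'. XX s \<otimes>\<^sub>t YY s r)" for r
      unfolding w'_def Z_def sum_product tensor_elem_mult XX_def YY_def by (rule sum_div_mod[symmetric])
    \<comment> \<open>\<open>T\<close> passes through the \<open>Y\<close> leg and becomes
      \<open>R\<close>; \<open>R\<close> is then moved across the tensor sign and passes through the
      \<open>X\<close> leg, where it becomes \<open>T\<close> again.\<close>
    have "(\<Sum>r<?n. T $$ (r, a) *\<^sub>C w' q r) = (\<Sum>s<?n'. XX s \<otimes>\<^sub>t (\<Sum>r<?n. T $$ (r, a) *\<^sub>C YY s r))"
      unfolding w' by (simp only: complex_vector.scale_sum_right tensor_sum_right tensor_elem_bilin(4)) (rule sum.swap)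
    also have "\<dots> = (\<Sum>s<?n'. XX s \<otimes>\<^sub>t (\<Sum>b<dim' x. R $$ (s, b) *\<^sub>C Y' x b a))"
      using RY qa(2) by (simp add: YY_def)
    also have "\<dots> = (\<Sum>b<dim' x. (\<Sum>s<?n'. R $$ (s, b) *\<^sub>C XX s) \<otimes>\<^sub>t Y' x b a)"
      by (simp only: tensor_sum_right tensor_sum_left tensor_elem_bilin(3,4)) (rule sum.swap)
    also have "\<dots> = (\<Sum>b<dim' x. (\<Sum>c<hdim x. T $$ (q, c) *\<^sub>C X' x c b) \<otimes>\<^sub>t Y' x b a)"
      using RX qa(1) by (simp add: XX_def)
    also have "\<dots> = (\<Sum>c<hdim x. T $$ (q, c) *\<^sub>C Z x c a)"
      by (simp only: Z_def complex_vector.scale_sum_right tensor_sum_left tensor_elem_bilin(3)) (rule sum.swap)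
    finally show ?thesis .
  qed
  have unique: "M q r = (\<Sum>x\<in>B. \<Sum>a<hdim x. \<Sum>c<hdim x. A x c a q r *\<^sub>C Z x c a)"
    if M: "\<And>x T a. x \<in> Irred G\<^sub>1 \<Longrightarrow> T \<in> mor [y, z] [x] \<Longrightarrow> a < hdim x \<Longrightarrow>
        (\<Sum>r<?n. T $$ (r, a) *\<^sub>C M q r) = (\<Sum>c<hdim x. T $$ (q, c) *\<^sub>C Z x c a)"
      and qr: "q < ?n" "r < ?n" for M :: "nat \<Rightarrow> nat \<Rightarrow> 'b \<otimes> 'c" and q r
  proof -
    \<comment> \<open>The identity matrix is inserted as the sum of the diagonal columns of
      \<open>A\<close>. Each of them is a column of an intertwiner, on which \<open>M\<close> is
      known.\<close>
    have "M q r = (\<Sum>p<?n. (\<Sum>x\<in>B. \<Sum>a<hdim x. A x a a p r) *\<^sub>C M q p)"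
      using qr by (simp add: A1 if_distrib[where f = "\<lambda>c. c *\<^sub>C _"] cong: if_cong)
    also have "\<dots> = (\<Sum>x\<in>B. \<Sum>a<hdim x. \<Sum>p<?n. A x a a p r *\<^sub>C M q p)"
      by (simp only: complex_vector.scale_sum_left, subst sum.swap, rule sum.cong[OF refl], rule sum.swap)
    also have "\<dots> = (\<Sum>x\<in>B. \<Sum>a<hdim x. \<Sum>c<hdim x. A x c a q r *\<^sub>C Z x c a)"
    proof (rule sum.cong[OF refl], rule sum.cong[OF refl])
      fix x a assume xa: "x \<in> B" "a \<in> {..<hdim x}"
      then have a: "a < hdim x" and xI: "x \<in> Irred G\<^sub>1" using B by auto
      show "(\<Sum>p<?n. A x a a p r *\<^sub>C M q p) = (\<Sum>c<hdim x. A x c a q r *\<^sub>C Z x c a)"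
        using M[OF xI A[OF xa(1) a qr(2)] a] a qr by simp
    qed
    finally show ?thesis .
  qed
  have "w q r = w' q r" if qr: "q < ?n" "r < ?n" for q r
  proof -
    have "w q r = (\<Sum>x\<in>B. \<Sum>a<hdim x. \<Sum>c<hdim x. A x c a q r *\<^sub>C Z x c a)"
      by (rule unique[OF _ qr]) (rule 1[OF _ _ qr(1)])
    moreover have "w' q r = (\<Sum>x\<in>B. \<Sum>a<hdim x. \<Sum>c<hdim x. A x c a q r *\<^sub>C Z x c a)"
      by (rule unique[OF _ qr]) (rule 2[OF _ _ qr(1)])
    ultimately show ?thesis by simp
  qed
  moreover have "a * ?m + b < ?n" "(a * ?m + b) div ?m = a" "(a * ?m + b) mod ?m = b" if "a < hdim y" "b < ?m" for a b
  proof -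
    have "Suc a * ?m \<le> ?n" using that by (intro mult_right_mono) auto
    then show "a * ?m + b < ?n" using that by auto
  qed (use that in auto)
  ultimately have "w (i * ?m + k) (j * ?m + l) = w' (i * ?m + k) (j * ?m + l)"
    and "(i * ?m + k) div ?m = i" "(i * ?m + k) mod ?m = k" "(j * ?m + l) div ?m = j" "(j * ?m + l) mod ?m = l"
    using ij kl by auto
  then show ?thesis unfolding w_def w'_def by simp
qed

end

lemma clinear_mult: "clinear (\<lambda>a. a * b)" "clinear (\<lambda>a. b * a)" for b :: "'a::complex_algebra_1"
  by (auto intro!: clinearI simp: distrib_left distrib_right scaleC_mult_left scaleC_mult_right)

lemma bilin_scaleC:
  assumes "clinear f"
  shows "bilin id (\<lambda>b a. f b *\<^sub>C a)" "bilin id (\<lambda>a b. f b *\<^sub>C a)"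
  by (auto simp: bilin_def id_apply clinear_simps[OF assms] scaleC_add_left scaleC_add_right scaleC_scaleC
      scaleC_complex_def mult.commute)

lemma bilin_mult_functionals:
  fixes f :: "'a::complex_vector \<Rightarrow> complex" and g :: "'b::complex_vector \<Rightarrow> complex"
  assumes "clinear f" "clinear g"
  shows "bilin id (\<lambda>b c. f b * g c)"
  by (auto simp: bilin_def id_apply clinear_simps[OF assms(1)] clinear_simps[OF assms(2)] distrib_left distrib_right
      scaleC_complex_def ac_simps)

context hopf_quantum_group
begin

lemma star_in_coeff: "a \<in> coeff_algebra G \<Longrightarrow> star a \<in> coeff_algebra G"
  using hopf by (simp_all add: hopf_star_algebra_def)

end

context link_algebras
begin

lemma \<theta>_mult:
  assumes a: "a \<in> coeff_algebra G\<^sub>1" and b: "b \<in> coeff_algebra G\<^sub>1"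
  shows "\<theta> (a * b) = \<theta> a * \<theta> b"
proof (rule G1.clinear_eq_on_coeff[OF clinear_compose[OF clinear_\<theta> clinear_mult(2)] clinear_compose[OF clinear_mult(2) clinear_\<theta>] b])
  fix z k l assume z: "z \<in> Irred G\<^sub>1" "k < hdim z" "l < hdim z"
  show "\<theta> (a * u z k l) = \<theta> a * \<theta> (u z k l)"
    by (rule G1.clinear_eq_on_coeff[OF clinear_compose[OF clinear_\<theta> clinear_mult(1)]
          clinear_compose[OF clinear_mult(1) clinear_\<theta>] a]) (simp add: \<theta>_mult_u \<theta>_u z)
qed

lemma dim'_triv: "dim' (triv G\<^sub>1) = 1"
  by (simp add: \<psi>_triv G2.hdim_triv)

text \<open>Let \<open>R\<close> correspond to the morphism 1 from the trivial class to its square.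
  At the trivial class the link relations are \<open>R x\<^sup>2 = x\<close> and
  \<open>y\<^sup>2 = R y\<close> with \<open>x\<close> and \<open>y\<close> unitary. Hence
  \<open>R x = 1\<close> and \<open>y = R 1\<close>, and the scalar cancels in the tensor
  product.\<close>

lemma \<theta>_one: "\<theta> 1 = 1"
proof -
  let ?t = "triv G\<^sub>1"
  define x where "x = X' ?t 0 0"
  define y where "y = Y' ?t 0 0"
  note t = G1.triv_in
  have T: "1\<^sub>m 1 \<in> mor [?t, ?t] [?t]"
    unfolding G1.mor_pair[OF t t t] by (simp add: G1.hdim_triv G1.u_triv)
  obtain R where R: "R $$ (0, 0) *\<^sub>C (x * x) = x" "y * y = R $$ (0, 0) *\<^sub>C y"
    using link_relation[OF t t t T] by (auto simp: G1.hdim_triv dim'_triv x_def y_def)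
  have un: "star x * x = 1" "star y * y = 1"
    using unitary_matD(1)[OF unitary_X[OF t] carrier_X[OF t], of 0 0]
      unitary_matD(1)[OF unitary_Y[OF t] carrier_Y[OF t], of 0 0]
    by (simp_all add: G1.hdim_triv dim'_triv x_def y_def)
  have "R $$ (0, 0) *\<^sub>C x = star x * (R $$ (0, 0) *\<^sub>C (x * x))"
    by (simp add: scaleC_mult_right un flip: mult.assoc)
  then have rx: "R $$ (0, 0) *\<^sub>C x = 1" by (simp add: R un)
  have "y = star y * (y * y)" by (simp add: un flip: mult.assoc)
  also have "\<dots> = R $$ (0, 0) *\<^sub>C 1" by (simp add: R scaleC_mult_right un)
  finally have "Z ?t 0 0 = (R $$ (0, 0) *\<^sub>C x) \<otimes>\<^sub>t 1"
    by (simp add: Z_def dim'_triv tensor_elem_bilin flip: x_def y_def)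
  then show ?thesis
    using \<theta>_u[OF t, of 0 0] by (simp add: G1.u_triv G1.hdim_triv rx tensor_one)
qed

text \<open>Unitarity of \<open>Y\<close> collapses the two middle indices to one, and unitarity of
  \<open>X\<close> evaluates the remaining sum.\<close>

lemma Z_unitary:
  assumes y: "y \<in> Irred G\<^sub>1" and ij: "i < hdim y" "j < hdim y"
  shows "(\<Sum>k<hdim y. Z y i k * star (Z y j k)) = (if i = j then 1 else 0)"
proof -
  let ?n = "hdim y" and ?m = "dim' y"
  have "(\<Sum>k<?n. Z y i k * star (Z y j k)) = (\<Sum>k<?n. \<Sum>a<?m. \<Sum>b<?m. (X' y i a * star (X' y j b)) \<otimes>\<^sub>t (Y' y a k * star (Y' y b k)))"
    by (simp add: Z_def star_sum tensor_elem_star sum_product tensor_elem_mult)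
  also have "\<dots> = (\<Sum>a<?m. \<Sum>b<?m. (X' y i a * star (X' y j b)) \<otimes>\<^sub>t (\<Sum>k<?n. Y' y a k * star (Y' y b k)))"
    by (simp only: tensor_sum_right, subst sum.swap, rule sum.cong[OF refl], rule sum.swap)
  also have "\<dots> = (\<Sum>a<?m. (X' y i a * star (X' y j a)) \<otimes>\<^sub>t 1)"
    by (simp add: unitary_matD(2)[OF unitary_Y[OF y] carrier_Y[OF y]] if_distrib[where f = "\<lambda>c. _ \<otimes>\<^sub>t c"] cong: if_cong)
  also have "\<dots> = (if i = j then 1 else 0)"
    using unitary_matD(2)[OF unitary_X[OF y] carrier_X[OF y] ij]
    by (simp add: tensor_one flip: tensor_sum_left)
  finally show ?thesis .
qed

text \<open>\<open>\<theta> (U\<^sup>*)\<close> and \<open>Z\<^sup>*\<close> are both inverse to \<open>\<theta> U = Z\<close>.\<close>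

lemma \<theta>_star_u:
  assumes y: "y \<in> Irred G\<^sub>1" and ij: "i < hdim y" "j < hdim y"
  shows "\<theta> (star (u y j i)) = star (Z y j i)"
proof -
  let ?n = "hdim y"
  have inv: "(\<Sum>k<?n. \<theta> (star (u y k i)) * Z y k l) = (if i = l then 1 else 0)" if l: "l < ?n" for l
  proof -
    have "(\<Sum>k<?n. \<theta> (star (u y k i)) * Z y k l) = \<theta> (\<Sum>k<?n. star (u y k i) * u y k l)"
      using y ij l by (simp add: clinear_sum[OF clinear_\<theta>] \<theta>_mult G1.star_in_coeff G1.u_in_coeff \<theta>_u)
    then show ?thesis
      using G1.unitary_u(1)[OF y ij(1) l] by (simp add: \<theta>_one clinear_0[OF clinear_\<theta>])
  qed
  have "\<theta> (star (u y j i)) = (\<Sum>k<?n. \<theta> (star (u y k i)) * (\<Sum>l<?n. Z y k l * star (Z y j l)))"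
    using ij by (simp add: Z_unitary[OF y] if_distrib[where f = "\<lambda>c. _ * c"] cong: if_cong)
  also have "\<dots> = (\<Sum>l<?n. (\<Sum>k<?n. \<theta> (star (u y k i)) * Z y k l) * star (Z y j l))"
    by (simp only: sum_distrib_left sum_distrib_right, subst sum.swap, simp only: mult.assoc)
  also have "\<dots> = star (Z y j i)"
    using ij by (simp add: inv if_distrib[where f = "\<lambda>c. c * _"] cong: if_cong)
  finally show ?thesis .
qed

lemma \<theta>_star:
  assumes "a \<in> coeff_algebra G\<^sub>1"
  shows "\<theta> (star a) = star (\<theta> a)"
  using assms unfolding coeff_algebra_def
proof (induction rule: complex_vector.span_induct_alt)
  case (step c v a)
  then show ?case
    by (auto simp: star_add star_scaleC clinear_simps[OF clinear_\<theta>] \<theta>_star_u \<theta>_u)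
qed (simp add: clinear_simps[OF clinear_\<theta>])

section \<open>Injectivity and image of \<open>\<theta>\<close>\<close>

lemma dim'_pos: "y \<in> Irred G\<^sub>1 \<Longrightarrow> 0 < dim' y"
  using irreducible_repD(4)[OF irreducible_irrep[OF \<psi>_in]] by (simp add: hdim_def)

lemma coordinates:
  obtains eX eY where "\<And>p. clinear (eX p)" "\<And>q. clinear (eY q)"
    "\<And>p y i j. p \<in> ix_X \<Longrightarrow> y \<in> Irred G\<^sub>1 \<Longrightarrow> i < hdim y \<Longrightarrow> j < dim' y \<Longrightarrow>
      eX p (X' y i j) = (if p = (y, i, j) then 1 else 0 :: complex)"
    "\<And>q y i j. q \<in> ix_Y \<Longrightarrow> y \<in> Irred G\<^sub>1 \<Longrightarrow> i < dim' y \<Longrightarrow> j < hdim y \<Longrightarrow>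
      eY q (Y' y i j) = (if q = (y, i, j) then 1 else 0 :: complex)"
proof -
  obtain eX where eX: "\<And>p. clinear (eX p)" "\<And>p q. p \<in> ix_X \<Longrightarrow> q \<in> ix_X \<Longrightarrow>
      eX p (case q of (y, i, j) \<Rightarrow> X' y i j) = (if p = q then 1 else 0 :: complex)"
    using dual_family[OF basis_X(1,2)] by blast
  obtain eY where eY: "\<And>p. clinear (eY p)" "\<And>p q. p \<in> ix_Y \<Longrightarrow> q \<in> ix_Y \<Longrightarrow>
      eY p (case q of (y, i, j) \<Rightarrow> Y' y i j) = (if p = q then 1 else 0 :: complex)"
    using dual_family[OF basis_Y(1,2)] by blast
  show ?thesis
  proof (rule that[of eX eY])
    show "eX p (X' y i j) = (if p = (y, i, j) then 1 else 0)"
      if "p \<in> ix_X" "y \<in> Irred G\<^sub>1" "i < hdim y" "j < dim' y" for p y i j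
      using eX(2)[OF that(1), of "(y, i, j)"] that(2-) by (simp add: ix_X_def)
    show "eY q (Y' y i j) = (if q = (y, i, j) then 1 else 0)"
      if "q \<in> ix_Y" "y \<in> Irred G\<^sub>1" "i < dim' y" "j < hdim y" for q y i j
      using eY(2)[OF that(1), of "(y, i, j)"] that(2-) by (simp add: ix_Y_def)
  qed (fact eX eY)+
qed

text \<open>Among the summands of \<open>Z y i j\<close> is the basis tensor with middle index 0,
  which occurs in no other entry of any \<open>Z\<close>. Its coordinate functional isolates one
  coefficient of a relation, so the family \<open>Z\<close> is independent; index 0 exists because
  \<open>dim'\<close> is positive.\<close>

lemma \<theta>_left_inverse:
  obtains \<kappa> where "clinear \<kappa>" "\<And>a. a \<in> coeff_algebra G\<^sub>1 \<Longrightarrow> \<kappa> (\<theta> a) = a"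
proof -
  obtain eX eY where e: "\<And>p. clinear (eX p)" "\<And>q. clinear (eY q)"
    and eX: "\<And>p y i j. p \<in> ix_X \<Longrightarrow> y \<in> Irred G\<^sub>1 \<Longrightarrow> i < hdim y \<Longrightarrow> j < dim' y \<Longrightarrow>
      eX p (X' y i j) = (if p = (y, i, j) then 1 else 0 :: complex)"
    and eY: "\<And>q y i j. q \<in> ix_Y \<Longrightarrow> y \<in> Irred G\<^sub>1 \<Longrightarrow> i < dim' y \<Longrightarrow> j < hdim y \<Longrightarrow>
      eY q (Y' y i j) = (if q = (y, i, j) then 1 else 0 :: complex)"
    using coordinates by blast
  let ?z = "\<lambda>(y, i, j). Z y i j"
  have *: "c s = 0" if F: "finite F" "F \<subseteq> coeff_index G\<^sub>1" "(\<Sum>s\<in>F. c s *\<^sub>C ?z s) = 0" and s: "s \<in> F" for F c s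
  proof -
    obtain y i j where y: "s = (y, i, j)" "y \<in> Irred G\<^sub>1" "i < hdim y" "j < hdim y"
      using s F(2) by (auto simp: coeff_index_def)
    note y0 = dim'_pos[OF y(2)]
    have p: "(y, i, 0) \<in> ix_X" "(y, 0, j) \<in> ix_Y" using y y0 by (auto simp: ix_X_def ix_Y_def)
    let ?L = "tensor_lift (\<lambda>b c. eX (y, i, 0) b * eY (y, 0, j) c)"
    note bi = bilin_mult_functionals[OF e]
    note L = clinear_simps[OF tensor_lift_linear[OF bi]]
    have "?L (?z t) = (if t = s then 1 else 0)" if t_in: "t \<in> F" for t
    proof -
      obtain y' i' j' where t: "t = (y', i', j')" "y' \<in> Irred G\<^sub>1" "i' < hdim y'" "j' < hdim y'"
        using subsetD[OF F(2) t_in] by (auto simp: coeff_index_def)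
      have "?L (?z t) = (\<Sum>k<dim' y'. (if (y, i, 0) = (y', i', k) then 1 else 0) * (if (y, 0, j) = (y', k, j') then 1 else 0))"
        using t p by (simp add: Z_def L tensor_lift_elem[OF bi] eX eY)
      also have "\<dots> = (\<Sum>k<dim' y'. if k = 0 then (if t = s then 1 else 0) else 0)"
        unfolding t y(1) by (rule sum.cong[OF refl]) simp
      also have "\<dots> = (if t = s then 1 else 0)" using dim'_pos[OF t(2)] by simp
      finally show ?thesis .
    qed
    then have "?L (\<Sum>s\<in>F. c s *\<^sub>C ?z s) = (\<Sum>t\<in>F. c t * (if t = s then 1 else 0))"
      by (simp add: L scaleC_complex_def)
    then show ?thesis using F s by (simp add: L if_distrib[where f = "\<lambda>x. _ * x"] cong: if_cong)
  qed
  have "inj_on ?z (coeff_index G\<^sub>1)" "cindependent (?z ` coeff_index G\<^sub>1)"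
    by (rule independent_familyI, rule *, assumption+)+
  from clinear_extend[OF this, of "\<lambda>(y, i, j). u y i j"] obtain \<kappa> where \<kappa>: "clinear \<kappa>"
    "\<And>s. s \<in> coeff_index G\<^sub>1 \<Longrightarrow> \<kappa> (?z s) = (case s of (y, i, j) \<Rightarrow> u y i j)" by blast
  have "\<kappa> (\<theta> a) = a" if "a \<in> coeff_algebra G\<^sub>1" for a
  proof (rule G1.clinear_eq_on_coeff[OF clinear_compose[OF \<kappa>(1) clinear_\<theta>] clinear_id(2) that])
    fix y i j assume "y \<in> Irred G\<^sub>1" "i < hdim y" "j < hdim y"
    then show "\<kappa> (\<theta> (u y i j)) = u y i j"
      using \<kappa>(2)[of "(y, i, j)"] by (simp add: \<theta>_u coeff_index_def)
  qed
  then show ?thesis using that \<kappa>(1) by blast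
qed

lemma clinear_eq_on_link:
  assumes "clinear f" "clinear g"
    and "\<And>y i j z k l. y \<in> Irred G\<^sub>1 \<Longrightarrow> i < hdim y \<Longrightarrow> j < dim' y \<Longrightarrow> z \<in> Irred G\<^sub>1 \<Longrightarrow> k < dim' z \<Longrightarrow> l < hdim z \<Longrightarrow>
      f (X' y i j \<otimes>\<^sub>t Y' z k l) = g (X' y i j \<otimes>\<^sub>t Y' z k l)"
  shows "f s = g s"
proof (rule clinear_eq_tensor[OF assms(1,2)])
  fix b c
  show "f (b \<otimes>\<^sub>t c) = g (b \<otimes>\<^sub>t c)"
  proof (rule clinear_eq_on_span[OF clinear_compose[OF assms(1) clinear_tensor_elem(2)] clinear_compose[OF assms(2) clinear_tensor_elem(2)]])
    show "c \<in> cspan ((\<lambda>(y, i, j). Y' y i j) ` ix_Y)" unfolding basis_Y(3) by (rule UNIV_I)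
    fix c assume c: "c \<in> (\<lambda>(y, i, j). Y' y i j) ` ix_Y"
    show "f (b \<otimes>\<^sub>t c) = g (b \<otimes>\<^sub>t c)"
    proof (rule clinear_eq_on_span[OF clinear_compose[OF assms(1) clinear_tensor_elem(1)] clinear_compose[OF assms(2) clinear_tensor_elem(1)]])
      show "b \<in> cspan ((\<lambda>(y, i, j). X' y i j) ` ix_X)" unfolding basis_X(3) by (rule UNIV_I)
    qed (use c assms(3) in \<open>auto simp: ix_X_def ix_Y_def\<close>)
  qed
qed

lemma equalizer_\<theta>:
  assumes s: "assoc_right (tensor_map \<delta>\<^sub>2 id s) = tensor_map id \<gamma>\<^sub>2 s"
  shows "s \<in> \<theta> ` coeff_algebra G\<^sub>1"
proof -
  obtain eX eY where e: "\<And>p. clinear (eX p)" "\<And>q. clinear (eY q)"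
    and eX: "\<And>p y i j. p \<in> ix_X \<Longrightarrow> y \<in> Irred G\<^sub>1 \<Longrightarrow> i < hdim y \<Longrightarrow> j < dim' y \<Longrightarrow>
      eX p (X' y i j) = (if p = (y, i, j) then 1 else 0 :: complex)"
    and eY: "\<And>q y i j. q \<in> ix_Y \<Longrightarrow> y \<in> Irred G\<^sub>1 \<Longrightarrow> i < dim' y \<Longrightarrow> j < hdim y \<Longrightarrow>
      eY q (Y' y i j) = (if q = (y, i, j) then 1 else 0 :: complex)"
    using coordinates by blast
  define c where "c p q = tensor_lift (\<lambda>b c. eX p b * eY q c)" for p q
  note bi = bilin_mult_functionals[OF e]
  have cl: "clinear (c p q)" for p q unfolding c_def by (rule tensor_lift_linear[OF bi])
  have c: "c p q (b \<otimes>\<^sub>t b') = eX p b * eY q b'" for p q b b'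
    unfolding c_def by (rule tensor_lift_elem[OF bi])
  \<comment> \<open>\<open>sl p q\<close> takes coordinates on the two outer legs and leaves an
    element of the algebra of \<open>G\<^sub>2\<close> in the middle.\<close>
  define sl :: "_ \<Rightarrow> _ \<Rightarrow> 'b \<otimes> 'a2 \<otimes> 'c \<Rightarrow> 'a2" where "sl p q = (\<lambda>t. tensor_lift (\<lambda>b t. eX p b *\<^sub>C t) (tensor_map id (tensor_lift (\<lambda>a b'. eY q b' *\<^sub>C a)) t))"
    for p q
  have sll: "clinear (sl p q)" for p q
    unfolding sl_def by (intro clinear_compose[OF tensor_lift_linear clinear_tensor_map] bilin_scaleC e clinear_id tensor_lift_linear)
  have sl: "sl p q (b \<otimes>\<^sub>t a \<otimes>\<^sub>t b') = (eX p b * eY q b') *\<^sub>C a" for p q b a b'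
    unfolding sl_def
    by (simp add: tensor_map_id_elem[OF tensor_lift_linear[OF bilin_scaleC(2)[OF e(2)]]]
        tensor_lift_elem[OF bilin_scaleC(2)[OF e(2)]] tensor_lift_elem[OF bilin_scaleC(1)[OF e(1)]] scaleC_scaleC)
  note \<delta>l = clinear_actions(2) and \<gamma>l = clinear_actions(4)
  \<comment> \<open>The slices of the two sides of the equalizer condition are computed for
    arbitrary \<open>s\<close>, by linearity on basis tensors: the right action moves the column
    index of \<open>X'\<close>, and below the left action moves the row index of
    \<open>Y'\<close>.\<close>
  have s1: "sl (y, i, m) (z, n, l) (assoc_right (tensor_map \<delta>\<^sub>2 id s)) = (\<Sum>j<dim' y. c (y, i, j) (z, n, l) s *\<^sub>C u' y m j)"
    if y: "y \<in> Irred G\<^sub>1" "i < hdim y" "m < dim' y" and z: "z \<in> Irred G\<^sub>1" "n < dim' z" "l < hdim z" for y i m z n l s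
  proof (rule clinear_eq_on_link[where s = s])
    show "clinear (\<lambda>s. sl (y, i, m) (z, n, l) (assoc_right (tensor_map \<delta>\<^sub>2 id s)))"
      by (rule clinear_compose[OF sll clinear_compose[OF clinear_assoc_right clinear_tensor_map[OF \<delta>l clinear_id(1)]]])
    show "clinear (\<lambda>s. \<Sum>j<dim' y. c (y, i, j) (z, n, l) s *\<^sub>C u' y m j)"
      by (rule clinearI) (simp_all add: clinear_simps[OF cl] scaleC_add_left sum.distrib scaleC_complex_def
          complex_vector.scale_sum_right scaleC_scaleC)
    fix y' i' j' z' k' l'
    assume y': "y' \<in> Irred G\<^sub>1" "i' < hdim y'" "j' < dim' y'" and z': "z' \<in> Irred G\<^sub>1" "k' < dim' z'" "l' < hdim z'"
    have ix: "(y, i, j) \<in> ix_X \<longleftrightarrow> j < dim' y" "(z, n, l) \<in> ix_Y" for j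
      using y z by (auto simp: ix_X_def ix_Y_def)
    have "sl (y, i, m) (z, n, l) (assoc_right (tensor_map \<delta>\<^sub>2 id (X' y' i' j' \<otimes>\<^sub>t Y' z' k' l')))
      = (\<Sum>p<dim' y'. (eX (y, i, m) (X' y' i' p) * eY (z, n, l) (Y' z' k' l')) *\<^sub>C u' y' p j')"
      using y' by (simp add: tensor_map_id_elem[OF \<delta>l] action_X tensor_sum_left clinear_sum[OF clinear_assoc_right]
          clinear_sum[OF sll] assoc_right_elem sl)
    also have "\<dots> = (\<Sum>p<dim' y'. if p = m then (if (y, i) = (y', i') \<and> (z, n, l) = (z', k', l') then u' y m j' else 0) else 0)"
      using y y' z' by (intro sum.cong refl) (simp add: eX eY ix)
    also have "\<dots> = (if (y, i) = (y', i') \<and> (z, n, l) = (z', k', l') then u' y m j' else 0)"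
      using y by (cases "y = y'") simp_all
    also have "\<dots> = (\<Sum>j<dim' y. if j = j' then (if (y, i) = (y', i') \<and> (z, n, l) = (z', k', l') then u' y m j' else 0) else 0)"
      using y' by (cases "y = y'") simp_all
    also have "\<dots> = (\<Sum>j<dim' y. c (y, i, j) (z, n, l) (X' y' i' j' \<otimes>\<^sub>t Y' z' k' l') *\<^sub>C u' y m j)"
      using y y' z' by (intro sum.cong refl) (simp add: c eX eY ix)
    finally show "sl (y, i, m) (z, n, l) (assoc_right (tensor_map \<delta>\<^sub>2 id (X' y' i' j' \<otimes>\<^sub>t Y' z' k' l')))
      = (\<Sum>j<dim' y. c (y, i, j) (z, n, l) (X' y' i' j' \<otimes>\<^sub>t Y' z' k' l') *\<^sub>C u' y m j)" .
  qed
  have s2: "sl (y, i, m) (z, n, l) (tensor_map id \<gamma>\<^sub>2 s) = (\<Sum>k<dim' z. c (y, i, m) (z, k, l) s *\<^sub>C u' z k n)"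
    if y: "y \<in> Irred G\<^sub>1" "i < hdim y" "m < dim' y" and z: "z \<in> Irred G\<^sub>1" "n < dim' z" "l < hdim z" for y i m z n l s
  proof (rule clinear_eq_on_link[where s = s])
    show "clinear (\<lambda>s. sl (y, i, m) (z, n, l) (tensor_map id \<gamma>\<^sub>2 s))"
      by (rule clinear_compose[OF sll clinear_tensor_map[OF clinear_id(1) \<gamma>l]])
    show "clinear (\<lambda>s. \<Sum>k<dim' z. c (y, i, m) (z, k, l) s *\<^sub>C u' z k n)"
      by (rule clinearI) (simp_all add: clinear_simps[OF cl] scaleC_add_left sum.distrib scaleC_complex_def
          complex_vector.scale_sum_right scaleC_scaleC)
    fix y' i' j' z' k' l'
    assume y': "y' \<in> Irred G\<^sub>1" "i' < hdim y'" "j' < dim' y'" and z': "z' \<in> Irred G\<^sub>1" "k' < dim' z'" "l' < hdim z'"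
    have ix: "(y, i, m) \<in> ix_X" "(z, k, l) \<in> ix_Y \<longleftrightarrow> k < dim' z" for k
      using y z by (auto simp: ix_X_def ix_Y_def)
    have "sl (y, i, m) (z, n, l) (tensor_map id \<gamma>\<^sub>2 (X' y' i' j' \<otimes>\<^sub>t Y' z' k' l'))
      = (\<Sum>p<dim' z'. (eX (y, i, m) (X' y' i' j') * eY (z, n, l) (Y' z' p l')) *\<^sub>C u' z' k' p)"
      using z' by (simp add: tensor_map_id_elem[OF \<gamma>l] action_Y tensor_sum_right clinear_sum[OF sll] sl)
    also have "\<dots> = (\<Sum>p<dim' z'. if p = n then (if (y, i, m) = (y', i', j') \<and> (z, l) = (z', l') then u' z k' n else 0) else 0)"
      using z y' z' by (intro sum.cong refl) (simp add: eX eY ix)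
    also have "\<dots> = (if (y, i, m) = (y', i', j') \<and> (z, l) = (z', l') then u' z k' n else 0)"
      using z by (cases "z = z'") simp_all
    also have "\<dots> = (\<Sum>k<dim' z. if k = k' then (if (y, i, m) = (y', i', j') \<and> (z, l) = (z', l') then u' z k' n else 0) else 0)"
      using z' by (cases "z = z'") simp_all
    also have "\<dots> = (\<Sum>k<dim' z. c (y, i, m) (z, k, l) (X' y' i' j' \<otimes>\<^sub>t Y' z' k' l') *\<^sub>C u' z k n)"
      using y y' z' by (intro sum.cong refl) (simp add: c eX eY ix)
    finally show "sl (y, i, m) (z, n, l) (tensor_map id \<gamma>\<^sub>2 (X' y' i' j' \<otimes>\<^sub>t Y' z' k' l'))
      = (\<Sum>k<dim' z. c (y, i, m) (z, k, l) (X' y' i' j' \<otimes>\<^sub>t Y' z' k' l') *\<^sub>C u' z k n)" .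
  qed
  \<comment> \<open>\<open>d y i l\<close> reads the scalar supplied by Schur's lemma off the entry
    at position 0, 0.\<close>
  define d where "d y i l = c (y, i, 0) (y, 0, l) s" for y i l
  have cd: "c (y, i, j) (z, n, l) s = (if y = z \<and> j = n then d y i l else 0)"
    if y: "y \<in> Irred G\<^sub>1" "i < hdim y" "j < dim' y" and z: "z \<in> Irred G\<^sub>1" "n < dim' z" "l < hdim z" for y i j z n l
  proof -
    \<comment> \<open>For fixed outer indices \<open>i\<close> and \<open>l\<close>, the coordinates
      as a matrix in the two middle indices intertwine \<open>irrep (\<psi> y)\<close> and
      \<open>irrep (\<psi> z)\<close>.\<close>
    have T: "(\<Sum>k<dim' y. c (y, i, k) (z, n, l) s *\<^sub>C u' y m k) = (\<Sum>k<dim' z. c (y, i, m) (z, k, l) s *\<^sub>C u' z k n)"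
      if "m < dim' y" "n < dim' z" for m n
      using s1[OF y(1,2) that(1) z(1) that(2) z(3), of s] s2[OF y(1,2) that(1) z(1) that(2) z(3), of s] s by simp
    show ?thesis
    proof (cases "y = z")
      case True
      obtain r where r: "\<forall>j<dim' y. \<forall>n<dim' y. c (y, i, j) (y, n, l) s = (if j = n then r else 0)"
        using Schur_equal[OF \<psi>_in[OF y(1)] \<psi>_in[OF z(1)] T] True by auto
      have "d y i l = r" unfolding d_def using r dim'_pos[OF y(1)] by simp
      then show ?thesis using r y z True by auto
    next
      case False
      then have "\<psi> y \<noteq> \<psi> z" using \<psi>_eq_iff y z by simp
      from Schur_distinct[OF \<psi>_in[OF y(1)] \<psi>_in[OF z(1)] T this y(3) z(2)] False show ?thesis by simp
    qed
  qed
  let ?v = "\<lambda>(y, i, j). X' y i j" and ?w = "\<lambda>(y, i, j). Y' y i j"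
  define Q where "Q s F0 H0 \<longleftrightarrow> (finite F0 \<and> finite H0 \<and> F0 \<subseteq> ix_X \<and> H0 \<subseteq> ix_Y) \<and>
     (\<forall>F H. finite F \<longrightarrow> finite H \<longrightarrow> F0 \<subseteq> F \<longrightarrow> H0 \<subseteq> H \<longrightarrow> F \<subseteq> ix_X \<longrightarrow> H \<subseteq> ix_Y \<longrightarrow>
       s = (\<Sum>p\<in>F. \<Sum>q\<in>H. c p q s *\<^sub>C (?v p \<otimes>\<^sub>t ?w q)))" for s F0 H0
  have "\<exists>F0 H0. Q s F0 H0" for s
  proof (induction s rule: tensor_induct)
    case (elem a b)
    have eX': "eX p (?v q) = (if p = q then 1 else 0)" if "p \<in> ix_X" "q \<in> ix_X" for p q
      using that by (cases q) (auto simp: ix_X_def eX)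
    have eY': "eY p (?w q) = (if p = q then 1 else 0)" if "p \<in> ix_Y" "q \<in> ix_Y" for p q
      using that by (cases q) (auto simp: ix_Y_def eY)
    have "\<exists>F0. finite F0 \<and> F0 \<subseteq> ix_X \<and> (\<forall>F. finite F \<longrightarrow> F0 \<subseteq> F \<longrightarrow> F \<subseteq> ix_X \<longrightarrow>
        a = (\<Sum>s\<in>F. eX s a *\<^sub>C ?v s))"
      by (rule basis_expansion[OF e(1) _ UNIV_I[of a, folded basis_X(3)]]) (rule eX', assumption+)
    then obtain F0 where F0: "finite F0" "F0 \<subseteq> ix_X" "\<And>F. finite F \<Longrightarrow> F0 \<subseteq> F \<Longrightarrow> F \<subseteq> ix_X \<Longrightarrow> a = (\<Sum>p\<in>F. eX p a *\<^sub>C ?v p)"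
      by (elim exE conjE) blast
    have "\<exists>F0. finite F0 \<and> F0 \<subseteq> ix_Y \<and> (\<forall>F. finite F \<longrightarrow> F0 \<subseteq> F \<longrightarrow> F \<subseteq> ix_Y \<longrightarrow>
        b = (\<Sum>s\<in>F. eY s b *\<^sub>C ?w s))"
      by (rule basis_expansion[OF e(2) _ UNIV_I[of b, folded basis_Y(3)]]) (rule eY', assumption+)
    then obtain H0 where H0: "finite H0" "H0 \<subseteq> ix_Y" "\<And>F. finite F \<Longrightarrow> H0 \<subseteq> F \<Longrightarrow> F \<subseteq> ix_Y \<Longrightarrow> b = (\<Sum>p\<in>F. eY p b *\<^sub>C ?w p)"
      by (elim exE conjE) blast
    have "a \<otimes>\<^sub>t b = (\<Sum>p\<in>F. \<Sum>q\<in>H. c p q (a \<otimes>\<^sub>t b) *\<^sub>C (?v p \<otimes>\<^sub>t ?w q))"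
      if "finite F" "finite H" "F0 \<subseteq> F" "H0 \<subseteq> H" "F \<subseteq> ix_X" "H \<subseteq> ix_Y" for F H
    proof -
      have "a \<otimes>\<^sub>t b = (\<Sum>p\<in>F. eX p a *\<^sub>C ?v p) \<otimes>\<^sub>t (\<Sum>q\<in>H. eY q b *\<^sub>C ?w q)"
        using F0(3)[OF that(1,3,5)] H0(3)[OF that(2,4,6)] by simp
      also have "\<dots> = (\<Sum>p\<in>F. \<Sum>q\<in>H. c p q (a \<otimes>\<^sub>t b) *\<^sub>C (?v p \<otimes>\<^sub>t ?w q))"
        by (simp only: tensor_sum_left tensor_sum_right tensor_elem_bilin(3,4) c
            complex_vector.scale_sum_right scaleC_scaleC, subst sum.swap, simp only: mult.commute)
      finally show ?thesis .
    qed
    then have "Q (a \<otimes>\<^sub>t b) F0 H0" unfolding Q_def using F0(1,2) H0(1,2) by simp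
    then show ?case by blast
  next
    case (add s t)
    obtain F0 H0 F1 H1 where st: "Q s F0 H0" "Q t F1 H1" using add by blast
    have "s + t = (\<Sum>p\<in>F. \<Sum>q\<in>H. c p q (s + t) *\<^sub>C (?v p \<otimes>\<^sub>t ?w q))"
      if "finite F" "finite H" "F0 \<union> F1 \<subseteq> F" "H0 \<union> H1 \<subseteq> H" "F \<subseteq> ix_X" "H \<subseteq> ix_Y" for F H
    proof -
      have "s = (\<Sum>p\<in>F. \<Sum>q\<in>H. c p q s *\<^sub>C (?v p \<otimes>\<^sub>t ?w q))"
        by (rule st(1)[unfolded Q_def, THEN conjunct2, rule_format]) (use that in auto)
      moreover have "t = (\<Sum>p\<in>F. \<Sum>q\<in>H. c p q t *\<^sub>C (?v p \<otimes>\<^sub>t ?w q))"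
        by (rule st(2)[unfolded Q_def, THEN conjunct2, rule_format]) (use that in auto)
      ultimately have "s + t = (\<Sum>p\<in>F. \<Sum>q\<in>H. c p q s *\<^sub>C (?v p \<otimes>\<^sub>t ?w q)) +
          (\<Sum>p\<in>F. \<Sum>q\<in>H. c p q t *\<^sub>C (?v p \<otimes>\<^sub>t ?w q))"
        by (rule arg_cong2)
      also have "\<dots> = (\<Sum>p\<in>F. \<Sum>q\<in>H. c p q (s + t) *\<^sub>C (?v p \<otimes>\<^sub>t ?w q))"
        by (simp only: clinear_add[OF cl] scaleC_add_left sum.distrib)
      finally show ?thesis .
    qed
    moreover have "finite (F0 \<union> F1)" "finite (H0 \<union> H1)" "F0 \<union> F1 \<subseteq> ix_X" "H0 \<union> H1 \<subseteq> ix_Y"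
      using st by (auto simp: Q_def)
    ultimately have "Q (s + t) (F0 \<union> F1) (H0 \<union> H1)" unfolding Q_def by simp
    then show ?case by blast
  qed
  then obtain F0 H0 where FH: "Q s F0 H0" by blast
  \<comment> \<open>The supports are enlarged to full blocks over the same classes for both legs, so
    that the diagonal entries found by Schur's lemma can be summed over the whole middle
    index.\<close>
  define B where "B = fst ` F0 \<union> fst ` H0"
  have B: "finite B" "B \<subseteq> Irred G\<^sub>1" using FH by (auto simp: B_def Q_def ix_X_def ix_Y_def)
  let ?F = "{(y, i, j). y \<in> B \<and> i < hdim y \<and> j < dim' y}" and ?H = "{(y, i, j). y \<in> B \<and> i < dim' y \<and> j < hdim y}"
  have "s = (\<Sum>p\<in>?F. \<Sum>q\<in>?H. c p q s *\<^sub>C (?v p \<otimes>\<^sub>t ?w q))"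
  proof (rule FH[unfolded Q_def, THEN conjunct2, rule_format])
    show "finite ?F" "finite ?H" by (rule sum_blocks(1)[OF B(1)])+
    show "F0 \<subseteq> ?F"
    proof
      fix p assume p: "p \<in> F0"
      then have "p \<in> ix_X" "fst p \<in> B" using FH unfolding Q_def B_def by blast+
      then show "p \<in> ?F" by (cases p) (simp add: ix_X_def)
    qed
    show "H0 \<subseteq> ?H"
    proof
      fix p assume p: "p \<in> H0"
      then have "p \<in> ix_Y" "fst p \<in> B" using FH unfolding Q_def B_def by blast+
      then show "p \<in> ?H" by (cases p) (simp add: ix_Y_def)
    qed
    show "?F \<subseteq> ix_X" "?H \<subseteq> ix_Y" using B(2) by (auto simp: ix_X_def ix_Y_def)
  qed
  also have "\<dots> = (\<Sum>y\<in>B. \<Sum>i<hdim y. \<Sum>j<dim' y. \<Sum>z\<in>B. \<Sum>n<dim' z. \<Sum>l<hdim z.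
      c (y, i, j) (z, n, l) s *\<^sub>C (X' y i j \<otimes>\<^sub>t Y' z n l))"
    unfolding sum_blocks(2)[OF B(1)] by simp
  also have "\<dots> = (\<Sum>y\<in>B. \<Sum>i<hdim y. \<Sum>j<dim' y. \<Sum>l<hdim y. d y i l *\<^sub>C (X' y i j \<otimes>\<^sub>t Y' y j l))"
  proof (rule sum.cong[OF refl], rule sum.cong[OF refl], rule sum.cong[OF refl])
    fix y i j assume "y \<in> B" "i \<in> {..<hdim y}" "j \<in> {..<dim' y}"
    then have y: "y \<in> B" "y \<in> Irred G\<^sub>1" "i < hdim y" "j < dim' y" using B by auto
    have "(\<Sum>z\<in>B. \<Sum>n<dim' z. \<Sum>l<hdim z. c (y, i, j) (z, n, l) s *\<^sub>C (X' y i j \<otimes>\<^sub>t Y' z n l))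
      = (\<Sum>z\<in>B. if z = y then (\<Sum>n<dim' z. if n = j then (\<Sum>l<hdim z. d y i l *\<^sub>C (X' y i j \<otimes>\<^sub>t Y' z n l)) else 0) else 0)"
    proof (rule sum.cong[OF refl])
      fix z assume "z \<in> B"
      then have z: "z \<in> Irred G\<^sub>1" using B by auto
      show "(\<Sum>n<dim' z. \<Sum>l<hdim z. c (y, i, j) (z, n, l) s *\<^sub>C (X' y i j \<otimes>\<^sub>t Y' z n l))
        = (if z = y then (\<Sum>n<dim' z. if n = j then (\<Sum>l<hdim z. d y i l *\<^sub>C (X' y i j \<otimes>\<^sub>t Y' z n l)) else 0) else 0)"
      proof (cases "z = y")
        case True
        have "(\<Sum>l<hdim z. c (y, i, j) (z, n, l) s *\<^sub>C (X' y i j \<otimes>\<^sub>t Y' z n l))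
          = (if n = j then (\<Sum>l<hdim z. d y i l *\<^sub>C (X' y i j \<otimes>\<^sub>t Y' z n l)) else 0)" if "n < dim' z" for n
          using True that by (cases "n = j") (simp_all add: cd[OF y(2-4) y(2)])
        then show ?thesis using True by simp
      next
        case False
        then show ?thesis by (simp add: cd[OF y(2-4) z])
      qed
    qed
    also have "\<dots> = (\<Sum>l<hdim y. d y i l *\<^sub>C (X' y i j \<otimes>\<^sub>t Y' y j l))"
      using y B by simp
    finally show "(\<Sum>z\<in>B. \<Sum>n<dim' z. \<Sum>l<hdim z. c (y, i, j) (z, n, l) s *\<^sub>C (X' y i j \<otimes>\<^sub>t Y' z n l))
      = (\<Sum>l<hdim y. d y i l *\<^sub>C (X' y i j \<otimes>\<^sub>t Y' y j l))" .
  qed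
  \<comment> \<open>As \<open>d y i l\<close> does not depend on the middle index \<open>j\<close>,
    the sum over \<open>j\<close> is an entry of \<open>Z\<close>.\<close>
  also have "\<dots> = (\<Sum>y\<in>B. \<Sum>i<hdim y. \<Sum>l<hdim y. d y i l *\<^sub>C Z y i l)"
    by (rule sum.cong[OF refl], rule sum.cong[OF refl], simp only: Z_def complex_vector.scale_sum_right, rule sum.swap)
  also have "\<dots> = \<theta> (\<Sum>y\<in>B. \<Sum>i<hdim y. \<Sum>l<hdim y. d y i l *\<^sub>C u y i l)"
    using B(2) by (auto simp: clinear_sum[OF clinear_\<theta>] clinear_scale[OF clinear_\<theta>] \<theta>_u intro!: sum.cong)
  finally have sE: "s = \<theta> (\<Sum>y\<in>B. \<Sum>i<hdim y. \<Sum>l<hdim y. d y i l *\<^sub>C u y i l)" .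
  have "(\<Sum>y\<in>B. \<Sum>i<hdim y. \<Sum>l<hdim y. d y i l *\<^sub>C u y i l) \<in> coeff_algebra G\<^sub>1"
    unfolding coeff_algebra_def
    by (intro complex_vector.span_sum complex_vector.span_scale complex_vector.span_base) (use B(2) in auto)
  with sE show ?thesis by (rule image_eqI)
qed

end

section \<open>The isomorphism\<close>

lemma tensor_map_minus:
  assumes "clinear f" "clinear g"
  shows "tensor_map (\<lambda>x. f x - g x) id t = tensor_map f id t - tensor_map g id t"
    and "tensor_map id (\<lambda>x. f x - g x) s = tensor_map id f s - tensor_map id g s"
proof -
  note fg = clinear_minus[OF assms]
  have *: "(a - b) \<otimes>\<^sub>t c = a \<otimes>\<^sub>t c - b \<otimes>\<^sub>t c" "c' \<otimes>\<^sub>t (a - b) = c' \<otimes>\<^sub>t a - c' \<otimes>\<^sub>t b" for a b c c'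
    by (rule clinear_diff[OF clinear_tensor_elem(1)], rule clinear_diff[OF clinear_tensor_elem(2)])
  show "tensor_map (\<lambda>x. f x - g x) id t = tensor_map f id t - tensor_map g id t"
    by (rule clinear_eq_tensor[OF clinear_tensor_map[OF fg clinear_id(1)] clinear_minus[OF clinear_tensor_map
            [OF assms(1) clinear_id(1)] clinear_tensor_map[OF assms(2) clinear_id(1)]]])
      (simp only: tensor_map_id_elem fg assms *)
  show "tensor_map id (\<lambda>x. f x - g x) s = tensor_map id f s - tensor_map id g s"
    by (rule clinear_eq_tensor[OF clinear_tensor_map[OF clinear_id(1) fg] clinear_minus[OF clinear_tensor_map
            [OF clinear_id(1) assms(1)] clinear_tensor_map[OF clinear_id(1) assms(2)]]])
      (simp only: tensor_map_id_elem fg assms *)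
qed

lemma tensor_span_mono: "W \<subseteq> W' \<Longrightarrow> tensor_span V W \<subseteq> tensor_span V W'"
  unfolding tensor_span_def by (rule complex_vector.span_mono) blast

lemma tensor_span_image:
  assumes f: "clinear f" and t: "t \<in> tensor_span (UNIV :: 'd::complex_vector set) (f ` A)"
  obtains s where "s \<in> tensor_span UNIV A" "t = tensor_map id f s"
proof -
  have "\<exists>s\<in>tensor_span UNIV A. t = tensor_map (id :: 'd \<Rightarrow> 'd) f s"
    using t unfolding tensor_span_def
  proof (induction rule: complex_vector.span_induct_alt)
    case base
    show ?case
      by (intro bexI[of _ 0]) (simp_all add: complex_vector.span_zero clinear_0[OF clinear_tensor_map[OF clinear_id(1) f]])
  next
    case (step c x y)
    then obtain v a s where x: "x = v \<otimes>\<^sub>t f a" "a \<in> A" and s: "s \<in> cspan {v \<otimes>\<^sub>t w |v w. v \<in> UNIV \<and> w \<in> A}"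
      "y = tensor_map id f s" by auto
    show ?case
    proof (rule bexI[of _ "c *\<^sub>C (v \<otimes>\<^sub>t a) + s"])
      show "c *\<^sub>C x + y = tensor_map id f (c *\<^sub>C (v \<otimes>\<^sub>t a) + s)"
        using x s by (simp add: clinear_simps[OF clinear_tensor_map[OF clinear_id(1) f]] tensor_map_id_elem[OF f])
      show "c *\<^sub>C (v \<otimes>\<^sub>t a) + s \<in> cspan {v \<otimes>\<^sub>t w |v w. v \<in> UNIV \<and> w \<in> A}"
        by (rule complex_vector.span_add[OF complex_vector.span_scale[OF complex_vector.span_base] s(1)]) (use x in auto)
    qed
  qed
  then show ?thesis using that by blast
qed

lemma tensor_map_in_span:
  fixes f :: "'d::complex_vector \<Rightarrow> 'e::complex_vector"
  assumes f: "clinear f" and t: "t \<in> tensor_span UNIV A"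
  shows "tensor_map f id t \<in> tensor_span UNIV A"
  using t unfolding tensor_span_def
proof (induction rule: complex_vector.span_induct_alt)
  case base
  show ?case by (simp add: clinear_0[OF clinear_tensor_map[OF f]] complex_vector.span_zero)
next
  case (step c x y)
  then obtain v w where x: "x = v \<otimes>\<^sub>t w" "w \<in> A" by auto
  have "tensor_map f id x \<in> cspan {v \<otimes>\<^sub>t w |v w. v \<in> UNIV \<and> w \<in> A}"
    unfolding x(1) tensor_map_id_elem(2)[OF f] by (rule complex_vector.span_base) (use x(2) in blast)
  with step show ?case
    by (simp add: clinear_simps[OF clinear_tensor_map[OF f]] complex_vector.span_add complex_vector.span_scale)
qed

context hopf_quantum_group
begin

lemma clinear_eq_on_tensor_coeff:
  fixes f :: "'d::complex_vector \<otimes> 'a \<Rightarrow> 'e::complex_vector"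
  assumes "clinear f" "clinear g" "t \<in> tensor_span UNIV (coeff_algebra G)"
    and "\<And>d x i j. x \<in> Irred G \<Longrightarrow> i < hdim x \<Longrightarrow> j < hdim x \<Longrightarrow> f (d \<otimes>\<^sub>t u x i j) = g (d \<otimes>\<^sub>t u x i j)"
  shows "f t = g t"
proof (rule clinear_eq_on_span[OF assms(1,2) assms(3)[unfolded tensor_span_def]])
  fix t assume "t \<in> {v \<otimes>\<^sub>t w |v w. v \<in> (UNIV :: 'd set) \<and> w \<in> coeff_algebra G}"
  then obtain d a where t: "t = d \<otimes>\<^sub>t a" "a \<in> coeff_algebra G" by auto
  show "f t = g t" unfolding t(1)
    by (rule clinear_eq_on_coeff[OF clinear_compose[OF assms(1) clinear_tensor_elem(2)]
          clinear_compose[OF assms(2) clinear_tensor_elem(2)] t(2) assms(4)])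
qed

text \<open>The coaction axiom compares tensors after embedding. On the values of
  \<open>\<alpha>\<close>, whose second legs are coefficients, \<open>comult\<close> factors through
  \<open>emb\<close> and \<open>\<Delta>\<close>, and the injective map \<open>id\<close> tensor
  \<open>emb\<close> cancels.\<close>

lemma right_action_algebraic:
  assumes \<alpha>: "right_action G \<epsilon> \<alpha>" and \<Delta>: "clinear \<Delta>" "\<And>a. a \<in> coeff_algebra G \<Longrightarrow> emb G (\<Delta> a) = comult G a"
  shows "tensor_map \<alpha> id (\<alpha> d) = assoc_left (tensor_map id \<Delta> (\<alpha> d))"
proof -
  have "\<alpha> d \<in> tensor_span UNIV (coeff_algebra G)" using \<alpha> by (auto simp: right_action_def)
  then have "tensor_map id (comult G) (\<alpha> d) = tensor_map id (\<lambda>a. emb G (\<Delta> a)) (\<alpha> d)"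
    by (rule clinear_eq_on_tensor_coeff[OF clinear_tensor_map[OF clinear_id(1) clinear_comult]
          clinear_tensor_map[OF clinear_id(1) clinear_compose[OF clinear_emb \<Delta>(1)]]])
      (simp add: tensor_map_id_elem clinear_comult clinear_compose[OF clinear_emb \<Delta>(1)] \<Delta>(2) u_in_coeff)
  also have "\<dots> = tensor_map id (emb G) (tensor_map id \<Delta> (\<alpha> d))"
    by (rule tensor_map_compose_id(1)[OF clinear_emb \<Delta>(1), symmetric])
  finally have "tensor_map id (emb G) (assoc_right (tensor_map \<alpha> id (\<alpha> d))) = tensor_map id (emb G) (tensor_map id \<Delta> (\<alpha> d))"
    using \<alpha> by (simp only: right_action_def)
  then have "assoc_right (tensor_map \<alpha> id (\<alpha> d)) = tensor_map id \<Delta> (\<alpha> d)"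
    by (rule injD[OF inj_tensor_map_id(1)[OF clinear_emb inj_emb]])
  then show ?thesis by (metis assoc_left_right)
qed

end

context link_algebras
begin

section \<open>The map \<open>\<Psi>\<close> and its range\<close>

context
  fixes \<alpha> :: "'d::star_algebra \<Rightarrow> 'd \<otimes> 'a1"
  assumes \<alpha>: "right_action G\<^sub>1 \<epsilon>\<^sub>1 \<alpha>"
begin

definition \<Psi> :: "'d \<Rightarrow> ('d \<otimes> 'b) \<otimes> 'c" where
  "\<Psi> d = assoc_left (tensor_map id \<theta> (\<alpha> d))"

lemma clinear_\<alpha>: "clinear \<alpha>" and \<alpha>_coeff: "\<alpha> d \<in> tensor_span UNIV (coeff_algebra G\<^sub>1)"
  and \<alpha>_counit: "tensor_lift (\<lambda>d a. \<epsilon>\<^sub>1 a *\<^sub>C d) (\<alpha> d) = d"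
  using \<alpha> by (auto simp: right_action_def star_hom_def)

lemma clinear_id_\<theta>: "clinear (\<lambda>s :: 'e::complex_vector \<otimes> 'a1. assoc_left (tensor_map id \<theta> s))"
  by (rule clinear_compose[OF clinear_assoc_left clinear_tensor_map[OF clinear_id(1) clinear_\<theta>]])

lemma id_\<theta>_u:
  assumes "y \<in> Irred G\<^sub>1" "i < hdim y" "j < hdim y"
  shows "assoc_left (tensor_map id \<theta> (d \<otimes>\<^sub>t u y i j)) = (\<Sum>k<dim' y. (d \<otimes>\<^sub>t X' y i k) \<otimes>\<^sub>t Y' y k j)"
  using assms by (simp add: tensor_map_id_elem[OF clinear_\<theta>] \<theta>_u Z_def tensor_sum_right
      clinear_sum[OF clinear_assoc_left] assoc_left_elem)

lemma star_hom_\<Psi>: "star_hom \<Psi>"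
proof -
  have h: "star_hom \<alpha>" using \<alpha> by (simp add: right_action_def)
  have m: "tensor_map id \<theta> (\<alpha> x * \<alpha> y) = tensor_map id \<theta> (\<alpha> x) * tensor_map id \<theta> (\<alpha> y)" for x y
    by (rule tensor_map_hom_on(1)[OF clinear_\<theta> _ _ \<alpha>_coeff \<alpha>_coeff]) (simp_all add: \<theta>_mult \<theta>_star)
  have s: "tensor_map id \<theta> (star (\<alpha> x)) = star (tensor_map id \<theta> (\<alpha> x))" for x
    by (rule tensor_map_hom_on(2)[OF clinear_\<theta> _ _ \<alpha>_coeff \<alpha>_coeff]) (simp_all add: \<theta>_mult \<theta>_star)
  have "clinear \<Psi>" unfolding \<Psi>_def by (rule clinear_compose[OF clinear_id_\<theta> clinear_\<alpha>])
  moreover have "\<Psi> 1 = 1"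
    by (simp add: \<Psi>_def star_homD(2)[OF h] tensor_one tensor_map_id_elem[OF clinear_\<theta>] \<theta>_one assoc_left_elem)
  moreover have "\<Psi> (x * y) = \<Psi> x * \<Psi> y" for x y
    by (simp add: \<Psi>_def star_homD(3)[OF h] m star_homD(3)[OF star_hom_assoc_left])
  moreover have "\<Psi> (star x) = star (\<Psi> x)" for x
    by (simp add: \<Psi>_def star_homD(4)[OF h] s star_homD(4)[OF star_hom_assoc_left])
  ultimately show ?thesis by (simp add: star_hom_def)
qed

text \<open>A left inverse of \<open>\<theta>\<close> on coefficients recovers
  \<open>\<alpha> d\<close>, and the counit recovers \<open>d\<close> from it.\<close>

lemma inj_\<Psi>: "inj \<Psi>"
proof (rule injI)
  fix d d' assume "\<Psi> d = \<Psi> d'"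
  then have eq: "tensor_map id \<theta> (\<alpha> d) = tensor_map id \<theta> (\<alpha> d')"
    unfolding \<Psi>_def by (rule injD[OF inj_assoc_left])
  obtain \<kappa> where \<kappa>: "clinear \<kappa>" "\<And>a. a \<in> coeff_algebra G\<^sub>1 \<Longrightarrow> \<kappa> (\<theta> a) = a"
    using \<theta>_left_inverse by blast
  have "tensor_map id \<kappa> (tensor_map id \<theta> (\<alpha> d)) = \<alpha> d" for d
    by (rule G1.clinear_eq_on_tensor_coeff[OF clinear_compose[OF clinear_tensor_map[OF clinear_id(1) \<kappa>(1)]
            clinear_tensor_map[OF clinear_id(1) clinear_\<theta>]] clinear_id(2) \<alpha>_coeff])
      (simp add: tensor_map_id_elem \<kappa> clinear_\<theta> G1.u_in_coeff)
  then have "\<alpha> d = \<alpha> d'" using eq by metis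
  then show "d = d'" using \<alpha>_counit by metis
qed

text \<open>\<open>\<gamma>\<^sub>1\<close> acts on the column index of \<open>Y\<close> as the
  comultiplication acts on that of the representation, so \<open>\<theta>\<close> carries
  \<open>\<Delta>\<close> to \<open>id\<close> tensor \<open>\<gamma>\<^sub>1\<close>. The coaction
  identity of \<open>\<alpha>\<close> does the rest.\<close>

lemma \<Psi>_equivariant: "assoc_left (tensor_map id \<gamma>\<^sub>1 (\<Psi> d)) = tensor_map \<Psi> id (\<alpha> d)"
proof -
  obtain \<Delta> where \<Delta>: "clinear \<Delta>"
    "\<And>x i j. x \<in> Irred G\<^sub>1 \<Longrightarrow> i < hdim x \<Longrightarrow> j < hdim x \<Longrightarrow> \<Delta> (u x i j) = (\<Sum>k<hdim x. u x i k \<otimes>\<^sub>t u x k j)"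
    "\<And>a. a \<in> coeff_algebra G\<^sub>1 \<Longrightarrow> emb G\<^sub>1 (\<Delta> a) = comult G\<^sub>1 a"
    using G1.algebraic_comult by blast
  note \<gamma> = clinear_actions(3)
  have "tensor_map \<Psi> id (\<alpha> d) = tensor_map (\<lambda>s. assoc_left (tensor_map id \<theta> s)) id (tensor_map \<alpha> id (\<alpha> d))"
    unfolding \<Psi>_def by (rule tensor_map_compose_id(2)[OF clinear_id_\<theta> clinear_\<alpha>, symmetric])
  also have "\<dots> = tensor_map (\<lambda>s. assoc_left (tensor_map id \<theta> s)) id (assoc_left (tensor_map id \<Delta> (\<alpha> d)))"
    by (simp only: G1.right_action_algebraic[OF \<alpha> \<Delta>(1,3)])
  also have "\<dots> = assoc_left (tensor_map id \<gamma>\<^sub>1 (assoc_left (tensor_map id \<theta> (\<alpha> d))))"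
  proof (rule G1.clinear_eq_on_tensor_coeff[OF _ _ \<alpha>_coeff])
    show "clinear (\<lambda>s. tensor_map (\<lambda>s. assoc_left (tensor_map id \<theta> s)) id (assoc_left (tensor_map id \<Delta> s)))"
      by (rule clinear_compose[OF clinear_tensor_map[OF clinear_id_\<theta> clinear_id(1)]
            clinear_compose[OF clinear_assoc_left clinear_tensor_map[OF clinear_id(1) \<Delta>(1)]]])
    show "clinear (\<lambda>s. assoc_left (tensor_map id \<gamma>\<^sub>1 (assoc_left (tensor_map id \<theta> s))))"
      by (rule clinear_compose[OF clinear_compose[OF clinear_assoc_left clinear_tensor_map[OF clinear_id(1) \<gamma>]] clinear_id_\<theta>])
    fix d :: 'd and y i j assume y: "y \<in> Irred G\<^sub>1" "i < hdim y" "j < hdim y"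
    have "tensor_map (\<lambda>s. assoc_left (tensor_map id \<theta> s)) id (assoc_left (tensor_map id \<Delta> (d \<otimes>\<^sub>t u y i j)))
      = (\<Sum>l<hdim y. \<Sum>k<dim' y. ((d \<otimes>\<^sub>t X' y i k) \<otimes>\<^sub>t Y' y k l) \<otimes>\<^sub>t u y l j)"
      using y by (simp add: tensor_map_id_elem[OF \<Delta>(1)] \<Delta>(2) tensor_sum_right clinear_sum[OF clinear_assoc_left] assoc_left_elem
          clinear_sum[OF clinear_tensor_map[OF clinear_id_\<theta> clinear_id(1)]] tensor_map_id_elem[OF clinear_id_\<theta>]
          id_\<theta>_u tensor_sum_left)
    also have "\<dots> = assoc_left (tensor_map id \<gamma>\<^sub>1 (assoc_left (tensor_map id \<theta> (d \<otimes>\<^sub>t u y i j))))"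
      unfolding id_\<theta>_u[OF y] using y
      by (subst sum.swap) (simp add: clinear_sum[OF clinear_tensor_map[OF clinear_id(1) \<gamma>]] tensor_map_id_elem[OF \<gamma>] action_Y
          tensor_sum_right clinear_sum[OF clinear_assoc_left] assoc_left_elem)
    finally show "tensor_map (\<lambda>s. assoc_left (tensor_map id \<theta> s)) id (assoc_left (tensor_map id \<Delta> (d \<otimes>\<^sub>t u y i j)))
      = assoc_left (tensor_map id \<gamma>\<^sub>1 (assoc_left (tensor_map id \<theta> (d \<otimes>\<^sub>t u y i j))))" .
  qed
  finally show ?thesis by (simp only: \<Psi>_def)
qed

text \<open>The counterpart on the row index: \<open>\<delta>\<^sub>1\<close> splits off
  \<open>u y i m\<close> from \<open>X'\<close> on the left exactly as \<open>\<Delta>\<close>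
  splits it off from the coefficient.\<close>

lemma id_\<delta>\<^sub>1_\<theta>:
  assumes z: "z \<in> tensor_span (UNIV :: 'd set) (coeff_algebra G\<^sub>1)"
    and \<Delta>: "clinear \<Delta>" "\<And>x i j. x \<in> Irred G\<^sub>1 \<Longrightarrow> i < hdim x \<Longrightarrow> j < hdim x \<Longrightarrow> \<Delta> (u x i j) = (\<Sum>k<hdim x. u x i k \<otimes>\<^sub>t u x k j)"
  shows "tensor_map (\<lambda>t. assoc_left (tensor_map id \<delta>\<^sub>1 t)) id (assoc_left (tensor_map id \<theta> z))
    = assoc_left (tensor_map id \<theta> (assoc_left (tensor_map id \<Delta> z)))"
proof (rule G1.clinear_eq_on_tensor_coeff[OF _ _ z])
  note \<delta> = clinear_actions(1)
  note l = clinear_compose[OF clinear_assoc_left clinear_tensor_map[OF clinear_id(1) \<delta>]]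
  show "clinear (\<lambda>z. tensor_map (\<lambda>t. assoc_left (tensor_map id \<delta>\<^sub>1 t)) id (assoc_left (tensor_map id \<theta> z)))"
    by (rule clinear_compose[OF clinear_tensor_map[OF l clinear_id(1)] clinear_id_\<theta>])
  show "clinear (\<lambda>z. assoc_left (tensor_map id \<theta> (assoc_left (tensor_map id \<Delta> z))))"
    by (rule clinear_compose[OF clinear_id_\<theta> clinear_compose[OF clinear_assoc_left clinear_tensor_map[OF clinear_id(1) \<Delta>(1)]]])
  fix d :: 'd and y i j assume y: "y \<in> Irred G\<^sub>1" "i < hdim y" "j < hdim y"
  have "assoc_left (tensor_map id \<theta> (assoc_left (tensor_map id \<Delta> (d \<otimes>\<^sub>t u y i j))))
     = (\<Sum>m<hdim y. \<Sum>k<dim' y. ((d \<otimes>\<^sub>t u y i m) \<otimes>\<^sub>t X' y m k) \<otimes>\<^sub>t Y' y k j)"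
    using y by (simp add: tensor_map_id_elem[OF \<Delta>(1)] \<Delta>(2) tensor_sum_right clinear_sum[OF clinear_assoc_left]
        clinear_sum[OF clinear_tensor_map[OF clinear_id(1) clinear_\<theta>]] assoc_left_elem id_\<theta>_u)
  also have "\<dots> = tensor_map (\<lambda>t. assoc_left (tensor_map id \<delta>\<^sub>1 t)) id (assoc_left (tensor_map id \<theta> (d \<otimes>\<^sub>t u y i j)))"
    unfolding id_\<theta>_u[OF y] using y
    by (subst sum.swap) (simp add: clinear_sum[OF clinear_tensor_map[OF l clinear_id(1)]] tensor_map_id_elem[OF l] tensor_map_id_elem[OF \<delta>]
        action_X tensor_sum_right tensor_sum_left clinear_sum[OF clinear_assoc_left] assoc_left_elem)
  finally show "tensor_map (\<lambda>t. assoc_left (tensor_map id \<delta>\<^sub>1 t)) id (assoc_left (tensor_map id \<theta> (d \<otimes>\<^sub>t u y i j)))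
     = assoc_left (tensor_map id \<theta> (assoc_left (tensor_map id \<Delta> (d \<otimes>\<^sub>t u y i j))))" by simp
qed

lemma \<alpha>_id_\<theta>: "tensor_map (tensor_map \<alpha> id) id (assoc_left (tensor_map id \<theta> z)) = assoc_left (tensor_map id \<theta> (tensor_map \<alpha> id z))"
proof -
  have l: "clinear (tensor_map \<alpha> (id :: 'b \<Rightarrow> 'b))" "clinear (tensor_map \<alpha> (id :: 'a1 \<Rightarrow> 'a1))" "clinear (tensor_map \<alpha> (id :: 'b \<otimes> 'c \<Rightarrow> _))"
    by (rule clinear_tensor_map[OF clinear_\<alpha> clinear_id(1)])+
  have 1: "tensor_map (tensor_map \<alpha> id) id (assoc_left s) = assoc_left (tensor_map \<alpha> id s)" for s :: "'d \<otimes> 'b \<otimes> 'c"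
    by (rule clinear_eq_tensor3[OF clinear_compose[OF clinear_tensor_map[OF l(1) clinear_id(1)] clinear_assoc_left]
          clinear_compose[OF clinear_assoc_left l(3)]])
      (simp add: assoc_left_elem tensor_map_id_elem l clinear_\<alpha>)
  have 2: "tensor_map \<alpha> id (tensor_map id \<theta> z) = tensor_map id \<theta> (tensor_map \<alpha> id z)"
    by (rule clinear_eq_tensor[OF clinear_compose[OF l(3) clinear_tensor_map[OF clinear_id(1) clinear_\<theta>]]
          clinear_compose[OF clinear_tensor_map[OF clinear_id(1) clinear_\<theta>] l(2)]])
      (simp add: tensor_map_id_elem clinear_\<theta> clinear_\<alpha>)
  show ?thesis by (simp only: 1 2)
qed

lemma range_\<Psi>_subset:
  "\<Psi> d \<in> box_product (box_product UNIV \<alpha> \<delta>\<^sub>1) (\<lambda>t. assoc_left (tensor_map id \<delta>\<^sub>2 t)) \<gamma>\<^sub>2"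
proof -
  obtain \<Delta> where \<Delta>: "clinear \<Delta>"
    "\<And>x i j. x \<in> Irred G\<^sub>1 \<Longrightarrow> i < hdim x \<Longrightarrow> j < hdim x \<Longrightarrow> \<Delta> (u x i j) = (\<Sum>k<hdim x. u x i k \<otimes>\<^sub>t u x k j)"
    "\<And>a. a \<in> coeff_algebra G\<^sub>1 \<Longrightarrow> emb G\<^sub>1 (\<Delta> a) = comult G\<^sub>1 a"
    using G1.algebraic_comult by blast
  have l1: "clinear (tensor_map \<alpha> (id :: 'b \<Rightarrow> 'b))" by (rule clinear_tensor_map[OF clinear_\<alpha> clinear_id(1)])
  have l2: "clinear (\<lambda>t :: 'd \<otimes> 'b. assoc_left (tensor_map id \<delta>\<^sub>1 t))" "clinear (\<lambda>t :: 'd \<otimes> 'b. assoc_left (tensor_map id \<delta>\<^sub>2 t))"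
    by (rule clinear_compose[OF clinear_assoc_left clinear_tensor_map[OF clinear_id(1) clinear_actions(1)]]
        clinear_compose[OF clinear_assoc_left clinear_tensor_map[OF clinear_id(1) clinear_actions(2)]])+
  have "tensor_map (tensor_map \<alpha> id) id (\<Psi> d) = tensor_map (\<lambda>t. assoc_left (tensor_map id \<delta>\<^sub>1 t)) id (\<Psi> d)"
    by (simp only: \<Psi>_def \<alpha>_id_\<theta> id_\<delta>\<^sub>1_\<theta>[OF \<alpha>_coeff \<Delta>(1,2)] G1.right_action_algebraic[OF \<alpha> \<Delta>(1,3)])
  \<comment> \<open>The condition holds for the tensor \<open>\<Psi> d\<close> as a whole. Written
    as a kernel, it shows that \<open>\<Psi> d\<close> is spanned by tensors with first factor in
    the inner box product, as the outer one demands.\<close>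
  then have "tensor_map (\<lambda>t. tensor_map \<alpha> id t - assoc_left (tensor_map id \<delta>\<^sub>1 t)) id (\<Psi> d) = 0"
    by (simp add: tensor_map_minus(1)[OF l1 l2(1)])
  from kernel_tensor_map(1)[OF clinear_minus[OF l1 l2(1)] this]
  have 1: "\<Psi> d \<in> tensor_span (box_product UNIV \<alpha> \<delta>\<^sub>1) UNIV" by (simp add: box_product_def)
  \<comment> \<open>Both actions insert a coefficient of \<open>irrep (\<psi> y)\<close> between
    \<open>X'\<close> and \<open>Y'\<close> and produce the same double sum, with the two middle
    indices exchanged.\<close>
  have 2: "tensor_map (\<lambda>t. assoc_left (tensor_map id \<delta>\<^sub>2 t)) id (\<Psi> d) = assoc_left (tensor_map id \<gamma>\<^sub>2 (\<Psi> d))"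
    unfolding \<Psi>_def
  proof (rule G1.clinear_eq_on_tensor_coeff[OF _ _ \<alpha>_coeff])
    note \<gamma>l = clinear_compose[OF clinear_assoc_left clinear_tensor_map[OF clinear_id(1) clinear_actions(4)]]
    show "clinear (\<lambda>s. tensor_map (\<lambda>t :: 'd \<otimes> 'b. assoc_left (tensor_map id \<delta>\<^sub>2 t)) id (assoc_left (tensor_map id \<theta> s)))"
      by (rule clinear_compose[OF clinear_tensor_map[OF l2(2) clinear_id(1)] clinear_id_\<theta>])
    show "clinear (\<lambda>s :: 'd \<otimes> 'a1. assoc_left (tensor_map id \<gamma>\<^sub>2 (assoc_left (tensor_map id \<theta> s))))"
      by (rule clinear_compose[OF \<gamma>l clinear_id_\<theta>])
    fix d :: 'd and y i j assume y: "y \<in> Irred G\<^sub>1" "i < hdim y" "j < hdim y"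
    have "tensor_map (\<lambda>t. assoc_left (tensor_map id \<delta>\<^sub>2 t)) id (assoc_left (tensor_map id \<theta> (d \<otimes>\<^sub>t u y i j)))
      = (\<Sum>k<dim' y. \<Sum>m<dim' y. ((d \<otimes>\<^sub>t X' y i m) \<otimes>\<^sub>t u' y m k) \<otimes>\<^sub>t Y' y k j)"
      unfolding id_\<theta>_u[OF y] using y
      by (simp add: clinear_sum[OF clinear_tensor_map[OF l2(2) clinear_id(1)]] tensor_map_id_elem[OF l2(2)]
          tensor_map_id_elem[OF clinear_actions(2)] action_X tensor_sum_right tensor_sum_left clinear_sum[OF clinear_assoc_left] assoc_left_elem)
    also have "\<dots> = assoc_left (tensor_map id \<gamma>\<^sub>2 (assoc_left (tensor_map id \<theta> (d \<otimes>\<^sub>t u y i j))))"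
      unfolding id_\<theta>_u[OF y] using y
      by (subst sum.swap) (simp add: clinear_sum[OF clinear_tensor_map[OF clinear_id(1) clinear_actions(4)]]
          tensor_map_id_elem[OF clinear_actions(4)] action_Y tensor_sum_right clinear_sum[OF clinear_assoc_left] assoc_left_elem)
    finally show "tensor_map (\<lambda>t. assoc_left (tensor_map id \<delta>\<^sub>2 t)) id (assoc_left (tensor_map id \<theta> (d \<otimes>\<^sub>t u y i j)))
      = assoc_left (tensor_map id \<gamma>\<^sub>2 (assoc_left (tensor_map id \<theta> (d \<otimes>\<^sub>t u y i j))))" .
  qed
  show ?thesis unfolding box_product_def[of "box_product UNIV \<alpha> \<delta>\<^sub>1"] using 1 2 by simp
qed

lemma range_\<Psi>_supset:
  assumes t: "t \<in> box_product (box_product UNIV \<alpha> \<delta>\<^sub>1) (\<lambda>t. assoc_left (tensor_map id \<delta>\<^sub>2 t)) \<gamma>\<^sub>2"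
  shows "t \<in> range \<Psi>"
proof -
  obtain \<Delta> where \<Delta>: "clinear \<Delta>"
    "\<And>x i j. x \<in> Irred G\<^sub>1 \<Longrightarrow> i < hdim x \<Longrightarrow> j < hdim x \<Longrightarrow> \<Delta> (u x i j) = (\<Sum>k<hdim x. u x i k \<otimes>\<^sub>t u x k j)"
    "\<And>a. a \<in> coeff_algebra G\<^sub>1 \<Longrightarrow> emb G\<^sub>1 (\<Delta> a) = comult G\<^sub>1 a"
    using G1.algebraic_comult by blast
  obtain \<kappa> where \<kappa>: "clinear \<kappa>" "\<And>a. a \<in> coeff_algebra G\<^sub>1 \<Longrightarrow> \<kappa> (\<theta> a) = a"
    using \<theta>_left_inverse by blast
  note la = clinear_assoc_left
  have lt: "clinear (tensor_map (id :: 'e::complex_vector \<Rightarrow> 'e) f)" "clinear (tensor_map f (id :: 'e \<Rightarrow> 'e))"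
    if "clinear f" for f :: "'f::complex_vector \<Rightarrow> 'g::complex_vector"
    using that by (simp_all add: clinear_tensor_map)
  note \<delta> = clinear_actions(2) and \<gamma> = clinear_actions(4)
  define g1 where "g1 r = assoc_right (tensor_map \<delta>\<^sub>2 id r)" for r :: "'b \<otimes> 'c"
  have g1: "clinear g1" unfolding g1_def
    by (rule clinear_compose[OF clinear_assoc_right clinear_tensor_map[OF \<delta> clinear_id(1)]])
  have g2: "clinear (tensor_map (id :: 'b \<Rightarrow> 'b) \<gamma>\<^sub>2)" by (rule clinear_tensor_map[OF clinear_id(1) \<gamma>])
  have ld: "clinear (\<lambda>t :: 'd \<otimes> 'b. assoc_left (tensor_map id \<delta>\<^sub>2 t))" 
    by (rule clinear_compose[OF la clinear_tensor_map[OF clinear_id(1) \<delta>]])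
  \<comment> \<open>\<open>c1\<close> and \<open>c2\<close> rebracket both sides of the outer box
    condition so that it becomes an equation between maps of the last two legs alone.\<close>
  have c1: "tensor_map (\<lambda>t. assoc_left (tensor_map id \<delta>\<^sub>2 t)) id (assoc_left s) = assoc_left (assoc_left (tensor_map id g1 s))"
    for s :: "'d \<otimes> 'b \<otimes> 'c"
  proof (rule clinear_eq_tensor3[OF clinear_compose[OF clinear_tensor_map[OF ld clinear_id(1)] la]
        clinear_compose[OF la clinear_compose[OF la clinear_tensor_map[OF clinear_id(1) g1]]]])
    fix d :: 'd and b :: 'b and c :: 'c
    have "assoc_left (d \<otimes>\<^sub>t w) \<otimes>\<^sub>t c = assoc_left (assoc_left (d \<otimes>\<^sub>t assoc_right (w \<otimes>\<^sub>t c)))" for w :: "'b \<otimes> 'a2"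
      by (rule clinear_eq_tensor[OF clinear_compose[OF clinear_tensor_elem(1) clinear_compose[OF la clinear_tensor_elem(2)]]
            clinear_compose[OF la clinear_compose[OF la clinear_compose[OF clinear_tensor_elem(2)
              clinear_compose[OF clinear_assoc_right clinear_tensor_elem(1)]]]]])
        (simp only: assoc_left_elem assoc_right_elem)
    then show "tensor_map (\<lambda>t. assoc_left (tensor_map id \<delta>\<^sub>2 t)) id (assoc_left (d \<otimes>\<^sub>t b \<otimes>\<^sub>t c)) =
       assoc_left (assoc_left (tensor_map id g1 (d \<otimes>\<^sub>t b \<otimes>\<^sub>t c)))"
      by (simp add: assoc_left_elem tensor_map_id_elem[OF ld] tensor_map_id_elem[OF \<delta>] tensor_map_id_elem[OF g1] g1_def)
  qed
  have c2: "assoc_left (tensor_map id \<gamma>\<^sub>2 (assoc_left s)) = assoc_left (assoc_left (tensor_map id (tensor_map id \<gamma>\<^sub>2) s))"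
    for s :: "'d \<otimes> 'b \<otimes> 'c"
    by (rule clinear_eq_tensor3[OF clinear_compose[OF la clinear_compose[OF clinear_tensor_map[OF clinear_id(1) \<gamma>] la]]
        clinear_compose[OF la clinear_compose[OF la clinear_tensor_map[OF clinear_id(1) g2]]]])
      (simp add: assoc_left_elem tensor_map_id_elem[OF \<gamma>] tensor_map_id_elem[OF g2])
  define s where "s = assoc_right t"
  have ts: "t = assoc_left s" by (simp add: s_def)
  have "tensor_map (\<lambda>t. assoc_left (tensor_map id \<delta>\<^sub>2 t)) id t = assoc_left (tensor_map id \<gamma>\<^sub>2 t)"
    using t by (simp add: box_product_def[of "box_product UNIV \<alpha> \<delta>\<^sub>1"])
  then have "tensor_map id g1 s = tensor_map id (tensor_map id \<gamma>\<^sub>2) s"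
    unfolding ts c1 c2 by (intro injD[OF inj_assoc_left])
  then have "tensor_map id (\<lambda>r. g1 r - tensor_map id \<gamma>\<^sub>2 r) s = 0"
    by (simp add: tensor_map_minus(2)[OF g1 g2])
  \<comment> \<open>The last two legs can now be taken in the equalizer, hence in the image of
    \<open>\<theta>\<close>, which yields the preimage \<open>z\<close>.\<close>
  from kernel_tensor_map(2)[OF clinear_minus[OF g1 g2] this]
  have "s \<in> tensor_span UNIV {r. g1 r = tensor_map id \<gamma>\<^sub>2 r}" by simp
  moreover have "{r. g1 r = tensor_map id \<gamma>\<^sub>2 r} \<subseteq> \<theta> ` coeff_algebra G\<^sub>1"
    using equalizer_\<theta> by (auto simp: g1_def)
  ultimately have "s \<in> tensor_span UNIV (\<theta> ` coeff_algebra G\<^sub>1)"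
    using tensor_span_mono by blast
  then obtain z where z: "z \<in> tensor_span UNIV (coeff_algebra G\<^sub>1)" "s = tensor_map id \<theta> z"
    using tensor_span_image[OF clinear_\<theta>] by blast
  have tz: "t = assoc_left (tensor_map id \<theta> z)" by (simp add: ts z)
  have l1: "clinear (tensor_map \<alpha> (id :: 'b \<Rightarrow> 'b))" by (rule clinear_tensor_map[OF clinear_\<alpha> clinear_id(1)])
  have l2: "clinear (\<lambda>t :: 'd \<otimes> 'b. assoc_left (tensor_map id \<delta>\<^sub>1 t))"
    by (rule clinear_compose[OF la clinear_tensor_map[OF clinear_id(1) clinear_actions(1)]])
  have "t \<in> tensor_span (box_product UNIV \<alpha> \<delta>\<^sub>1) UNIV"
    using t by (simp add: box_product_def[of "box_product UNIV \<alpha> \<delta>\<^sub>1"])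
  \<comment> \<open>On first factors from the inner box product the two maps agree, so they agree on
    the span. Through \<open>\<theta>\<close> this becomes a condition on \<open>z\<close>.\<close>
  then have "tensor_map (tensor_map \<alpha> id) id t = tensor_map (\<lambda>t. assoc_left (tensor_map id \<delta>\<^sub>1 t)) id t"
    unfolding tensor_span_def
    by (rule clinear_eq_on_span[OF clinear_tensor_map[OF l1 clinear_id(1)] clinear_tensor_map[OF l2 clinear_id(1)]])
      (auto simp: box_product_def tensor_map_id_elem[OF l1] tensor_map_id_elem[OF l2])
  then have "tensor_map id \<theta> (tensor_map \<alpha> id z) = tensor_map id \<theta> (assoc_left (tensor_map id \<Delta> z))"
    unfolding tz \<alpha>_id_\<theta>
    by (intro injD[OF inj_assoc_left]) (rule trans[OF _ id_\<delta>\<^sub>1_\<theta>[OF z(1) \<Delta>(1,2)]])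
  \<comment> \<open>\<open>\<kappa>\<close> removes \<open>\<theta>\<close> again; this is
    legitimate because the last legs on both sides are coefficients, as \<open>k1\<close> and
    \<open>k2\<close> verify.\<close>
  then have eq: "tensor_map id \<kappa> (tensor_map id \<theta> (tensor_map \<alpha> id z)) = tensor_map id \<kappa> (tensor_map id \<theta> (assoc_left (tensor_map id \<Delta> z)))"
    by (rule arg_cong)
  note \<kappa>\<theta> = clinear_compose[OF clinear_tensor_map[OF clinear_id(1) \<kappa>(1)] clinear_tensor_map[OF clinear_id(1) clinear_\<theta>]]
  have k1: "tensor_map id \<kappa> (tensor_map id \<theta> (tensor_map \<alpha> id z)) = tensor_map \<alpha> id z"
    by (rule G1.clinear_eq_on_tensor_coeff[OF \<kappa>\<theta> clinear_id(2) tensor_map_in_span[OF clinear_\<alpha> z(1)]])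
      (simp add: tensor_map_id_elem \<kappa> clinear_\<theta> G1.u_in_coeff)
  have k2: "tensor_map id \<kappa> (tensor_map id \<theta> (assoc_left (tensor_map id \<Delta> z))) = assoc_left (tensor_map id \<Delta> z)"
  proof (rule G1.clinear_eq_on_tensor_coeff[OF clinear_compose[OF \<kappa>\<theta> ] _ z(1)])
    show l: "clinear (\<lambda>z. assoc_left (tensor_map id \<Delta> z))"
      by (rule clinear_compose[OF la clinear_tensor_map[OF clinear_id(1) \<Delta>(1)]])
    show "clinear (\<lambda>z. assoc_left (tensor_map id \<Delta> z))" by (rule l)
    fix d :: 'd and y i j assume y: "y \<in> Irred G\<^sub>1" "i < hdim y" "j < hdim y"
    then show "tensor_map id \<kappa> (tensor_map id \<theta> (assoc_left (tensor_map id \<Delta> (d \<otimes>\<^sub>t u y i j)))) = assoc_left (tensor_map id \<Delta> (d \<otimes>\<^sub>t u y i j))"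
      by (simp add: tensor_map_id_elem[OF \<Delta>(1)] \<Delta>(2) tensor_sum_right clinear_sum[OF la] assoc_left_elem clinear_sum[OF \<kappa>\<theta>]
          tensor_map_id_elem[OF clinear_\<theta>] tensor_map_id_elem[OF \<kappa>(1)] \<kappa>(2) G1.u_in_coeff)
  qed
  have coaction: "tensor_map \<alpha> id z = assoc_left (tensor_map id \<Delta> z)"
    by (rule trans[OF trans[OF k1[symmetric] eq] k2])
  \<comment> \<open>\<open>E\<close> and \<open>E0\<close> apply the counit to the last leg. Applied
    to the coaction identity, one side becomes \<open>\<alpha> (E0 z)\<close> and the other
    \<open>z\<close>, so \<open>E0 z\<close> is the preimage sought.\<close>
  define E :: "('d \<otimes> 'a1) \<otimes> 'a1 \<Rightarrow> 'd \<otimes> 'a1" where "E = tensor_lift (\<lambda>t a. \<epsilon>\<^sub>1 a *\<^sub>C t)"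
  define E0 :: "'d \<otimes> 'a1 \<Rightarrow> 'd" where "E0 = tensor_lift (\<lambda>d a. \<epsilon>\<^sub>1 a *\<^sub>C d)"
  have E: "clinear E" "E (w \<otimes>\<^sub>t a) = \<epsilon>\<^sub>1 a *\<^sub>C w" for w a
    unfolding E_def by (rule tensor_lift_linear[OF bilin_scaleC(2)[OF G1.clinear_counit]]
        tensor_lift_elem[OF bilin_scaleC(2)[OF G1.clinear_counit]])+
  have E0: "clinear E0" "E0 (d \<otimes>\<^sub>t a) = \<epsilon>\<^sub>1 a *\<^sub>C d" for d a
    unfolding E0_def by (rule tensor_lift_linear[OF bilin_scaleC(2)[OF G1.clinear_counit]]
        tensor_lift_elem[OF bilin_scaleC(2)[OF G1.clinear_counit]])+
  have E1: "E (tensor_map \<alpha> id z) = \<alpha> (E0 z)"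
    by (rule clinear_eq_tensor[OF clinear_compose[OF E(1) clinear_tensor_map[OF clinear_\<alpha> clinear_id(1)]] clinear_compose[OF clinear_\<alpha> E0(1)]])
      (simp add: tensor_map_id_elem[OF clinear_\<alpha>] E E0 clinear_scale[OF clinear_\<alpha>])
  have E2: "E (assoc_left (tensor_map id \<Delta> z)) = z"
  proof (rule G1.clinear_eq_on_tensor_coeff[OF clinear_compose[OF E(1)] clinear_id(2) z(1)])
    show "clinear (\<lambda>z. assoc_left (tensor_map id \<Delta> z))"
      by (rule clinear_compose[OF la clinear_tensor_map[OF clinear_id(1) \<Delta>(1)]])
    fix d :: 'd and y i j assume y: "y \<in> Irred G\<^sub>1" "i < hdim y" "j < hdim y"
    then show "E (assoc_left (tensor_map id \<Delta> (d \<otimes>\<^sub>t u y i j))) = d \<otimes>\<^sub>t u y i j"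
      by (simp add: tensor_map_id_elem[OF \<Delta>(1)] \<Delta>(2) tensor_sum_right clinear_sum[OF la] assoc_left_elem clinear_sum[OF E(1)] E
          G1.counit_antipode_u if_distrib[where f = "\<lambda>c. c *\<^sub>C _"] cong: if_cong)
  qed
  have "z = \<alpha> (E0 z)" by (rule trans[OF E2[symmetric] E1[unfolded coaction]])
  then have "t = \<Psi> (E0 z)" unfolding \<Psi>_def tz by (rule arg_cong)
  then show ?thesis by (rule range_eqI)
qed

lemma link_duality:
  "\<exists>\<Psi>. star_hom \<Psi> \<and>
     bij_betw \<Psi> UNIV (box_product (box_product UNIV \<alpha> \<delta>\<^sub>1) (\<lambda>t. assoc_left (tensor_map id \<delta>\<^sub>2 t)) \<gamma>\<^sub>2) \<and>
     (\<forall>d. assoc_left (tensor_map id \<gamma>\<^sub>1 (\<Psi> d)) = tensor_map \<Psi> id (\<alpha> d))"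
proof (intro exI[of _ \<Psi>] conjI allI)
  show "bij_betw \<Psi> UNIV (box_product (box_product UNIV \<alpha> \<delta>\<^sub>1) (\<lambda>t. assoc_left (tensor_map id \<delta>\<^sub>2 t)) \<gamma>\<^sub>2)"
    using inj_\<Psi> range_\<Psi>_subset range_\<Psi>_supset by (intro bij_betw_imageI) blast+
qed (rule star_hom_\<Psi> \<Psi>_equivariant)+

end

end

theorem proposition7p7:
  fixes G\<^sub>1 :: "('a1::cstar_algebra, 'aa1::cstar_algebra, 'aaa1::cstar_algebra) quantum_group"
    and G\<^sub>2 :: "('a2::cstar_algebra, 'aa2::cstar_algebra, 'aaa2::cstar_algebra) quantum_group"
    and \<epsilon>\<^sub>1 :: "'a1 \<Rightarrow> complex" and S\<^sub>1 :: "'a1 \<Rightarrow> 'a1"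
    and \<epsilon>\<^sub>2 :: "'a2 \<Rightarrow> complex" and S\<^sub>2 :: "'a2 \<Rightarrow> 'a2"
    and \<phi> :: "'a2 mat set \<Rightarrow> 'a1 mat set"
    and \<Phi> :: "'a2 mat set list \<Rightarrow> 'a2 mat set list \<Rightarrow> complex mat \<Rightarrow> complex mat"
    and \<omega> :: "'b::star_algebra \<Rightarrow> complex" and X :: "'a2 mat set \<Rightarrow> 'b mat"
    and \<delta>\<^sub>1 :: "'b \<Rightarrow> 'a1 \<otimes> 'b" and \<delta>\<^sub>2 :: "'b \<Rightarrow> 'b \<otimes> 'a2"
    and \<omega>' :: "'c::star_algebra \<Rightarrow> complex" and Y :: "'a1 mat set \<Rightarrow> 'c mat"
    and \<gamma>\<^sub>2 :: "'c \<Rightarrow> 'a2 \<otimes> 'c" and \<gamma>\<^sub>1 :: "'c \<Rightarrow> 'c \<otimes> 'a1"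
    and \<alpha>\<^sub>1 :: "'d::star_algebra \<Rightarrow> 'd \<otimes> 'a1"
  assumes "compact_quantum_group G\<^sub>1" and "hopf_star_algebra G\<^sub>1 \<epsilon>\<^sub>1 S\<^sub>1"
    and "compact_quantum_group G\<^sub>2" and "hopf_star_algebra G\<^sub>2 \<epsilon>\<^sub>2 S\<^sub>2"
    and "monoidal_equivalence G\<^sub>2 G\<^sub>1 \<phi> \<Phi>"
    and "link_algebra G\<^sub>2 \<phi> \<Phi> \<omega> X"
    and "link_actions G\<^sub>2 \<epsilon>\<^sub>2 G\<^sub>1 \<epsilon>\<^sub>1 \<phi> X \<delta>\<^sub>1 \<delta>\<^sub>2"
    and "link_algebra G\<^sub>1 (inverse_obj G\<^sub>2 \<phi>) (inverse_mor G\<^sub>2 \<phi> \<Phi>) \<omega>' Y"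
    and "link_actions G\<^sub>1 \<epsilon>\<^sub>1 G\<^sub>2 \<epsilon>\<^sub>2 (inverse_obj G\<^sub>2 \<phi>) Y \<gamma>\<^sub>2 \<gamma>\<^sub>1"
    and "right_action G\<^sub>1 \<epsilon>\<^sub>1 \<alpha>\<^sub>1"
  shows "let \<alpha>\<^sub>2 = (\<lambda>t. assoc_left (tensor_map id \<delta>\<^sub>2 t)) :: 'd \<otimes> 'b \<Rightarrow> ('d \<otimes> 'b) \<otimes> 'a2;
             \<D>\<^sub>2 = box_product UNIV \<alpha>\<^sub>1 \<delta>\<^sub>1;
             \<D>\<^sub>3 = box_product \<D>\<^sub>2 \<alpha>\<^sub>2 \<gamma>\<^sub>2;
             \<alpha>\<^sub>1' = (\<lambda>t. assoc_left (tensor_map id \<gamma>\<^sub>1 t))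
         in \<exists>\<Psi>. star_hom \<Psi> \<and> bij_betw \<Psi> UNIV \<D>\<^sub>3 \<and>
              (\<forall>d. \<alpha>\<^sub>1' (\<Psi> d) = tensor_map \<Psi> id (\<alpha>\<^sub>1 d))"
proof -
  interpret link_algebras G\<^sub>1 \<epsilon>\<^sub>1 S\<^sub>1 G\<^sub>2 \<epsilon>\<^sub>2 S\<^sub>2 \<phi> \<Phi> \<omega> X \<delta>\<^sub>1 \<delta>\<^sub>2 \<omega>' Y \<gamma>\<^sub>2 \<gamma>\<^sub>1
    using assms by (auto intro!: link_algebras.intro hopf_quantum_group.intro link_algebras_axioms.intro)
  show ?thesis
    using link_duality[OF assms(10)] by (simp only: Let_def)
qed

end
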